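(* Let $n\ge 2$, $p\ge 1$ and let $f\colon M^{2n}\to\mathbb{R}^{2n+p}$ be a real Kaehler submanifold (with substantial codimension $p$). Assume that $p\leq 11$ and that the complex $s$-nullities of $f$ satisfy $\nu^c_s(x)<2(n-s)$ at every $x\in M^{2n}$ for all $1\leq s\leq p$. Then $p$ is even and $f$ is holomorphic.
   Context: A real Kaehler submanifold $f\colon M^{2n}\to\mathbb{R}^{2n+p}$ is an isometric immersion into Euclidean space of a connected Kaehler manifold $(M^{2n},J)$ of complex dimension $n\geq 2$ (real dimension $2n$, complex structure $J$), with substantial codimension $p$; the latter means that the codimension cannot be reduced, even locally (i.e. no nonempty open subset of $M^{2n}$ is mapped by $f$ into an affine subspace of dimension less than $2n+p$). That $f$ is holomorphic means that $p$ is even and $f$ is holomorphic with respect to some complex structure in $\mathbb{R}^{2n+p}$, i.e. there is a linear orthogonal map $\tilde J$ of $\mathbb{R}^{2n+p}$ with $\tilde J^2=-I$ (identifying $\mathbb{R}^{2n+p}$ with $\mathbb{C}^{n+p/2}$) such that $f_*\circ J=\tilde J\circ f_*$. Let $\alpha\colon TM\times TM\to N_fM$ denote the second fundamental form of $f$, with values in the normal bundle $N_fM$. For $x\in M$, $1\le s\le p$ and an $s$-dimensional subspace $U^s\subset N_fM(x)$, let $\pi_{U^s}\colon N_fM(x)\to U^s$ be the orthogonal projection, $\alpha_{U^s}=\pi_{U^s}\circ\alpha$, and $$\mathcal{N}(\alpha_{U^s})=\{X\in T_xM : \alpha_{U^s}(X,Y)=0 \text{ for all } Y\in T_xM\}.$$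 The complex $s$-nullity of $f$ at $x$ is $$\nu^c_s(x)=\max_{U^s\subset N_fM(x)}\dim\big(\mathcal{N}(\alpha_{U^s})\cap J\mathcal{N}(\alpha_{U^s})\big),$$ where the maximum is over all $s$-dimensional subspaces $U^s$ of $N_fM(x)$ and dimensions are real. *)

theory Defs
  imports "HOL-Analysis.Analysis"
begin

section \<open>Smooth maps between Euclidean spaces\<close>

text \<open>The set \<open>S\<close> is meant to be open throughout.\<close>

fun Ck_on :: "nat \<Rightarrow> 'a::euclidean_space set \<Rightarrow> ('a \<Rightarrow> 'b::euclidean_space) \<Rightarrow> bool" where
  "Ck_on 0 S f \<longleftrightarrow> continuous_on S f"
| "Ck_on (Suc k) S f \<longleftrightarrow>
     (\<forall>x\<in>S. f differentiable (at x)) \<and>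
     (\<forall>v. Ck_on k S (\<lambda>x. frechet_derivative f (at x) v))"

definition smooth_on :: "'a::euclidean_space set \<Rightarrow> ('a \<Rightarrow> 'b::euclidean_space) \<Rightarrow> bool" where
  "smooth_on S f \<longleftrightarrow> (\<forall>k. Ck_on k S f)"


section \<open>Smooth manifolds\<close>

text \<open>A chart is a pair of a domain and a coordinate map. Only the values of the coordinate map
  on the domain matter.\<close>

type_synonym ('a, 'e) chart = "'a set \<times> ('a \<Rightarrow> 'e)"

definition chart_dom :: "('a, 'e) chart \<Rightarrow> 'a set" where
  "chart_dom c = fst c"

definition coord :: "('a, 'e) chart \<Rightarrow> 'a \<Rightarrow> 'e" where
  "coord c = snd c"

definition chart_inv :: "('a, 'e) chart \<Rightarrow> 'e \<Rightarrow> 'a" where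
  "chart_inv c = inv_into (chart_dom c) (coord c)"

definition chart_img :: "('a, 'e) chart \<Rightarrow> 'e set" where
  "chart_img c = coord c ` chart_dom c"

definition is_chart :: "'a topology \<Rightarrow> ('a, 'e::euclidean_space) chart \<Rightarrow> bool" where
  "is_chart X c \<longleftrightarrow>
     openin X (chart_dom c) \<and> open (chart_img c) \<and>
     homeomorphic_map (subtopology X (chart_dom c)) (top_of_set (chart_img c)) (coord c)"

definition smooth_atlas :: "'a topology \<Rightarrow> ('a, 'e::euclidean_space) chart set \<Rightarrow> bool" where
  "smooth_atlas X A \<longleftrightarrow>
     (\<forall>c\<in>A. is_chart X c) \<and>
     (\<Union>c\<in>A. chart_dom c) = topspace X \<and>
     (\<forall>c\<in>A. \<forall>d\<in>A.
        smooth_on (coord c ` (chart_dom c \<inter> chart_dom d)) (coord d \<circ> chart_inv c))"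

definition smooth_manifold :: "'a topology \<Rightarrow> ('a, 'e::euclidean_space) chart set \<Rightarrow> bool" where
  "smooth_manifold X A \<longleftrightarrow>
     topspace X \<noteq> {} \<and> Hausdorff_space X \<and> second_countable X \<and> smooth_atlas X A"

text \<open>A chart \<open>c\<close> around \<open>x\<close> identifies the tangent space at \<open>x\<close> with the model space \<open>'e\<close>
  (coordinate components). Tensor fields are given by their components in every chart of the
  atlas; the components in two charts \<open>c\<close>, \<open>d\<close> around \<open>x\<close> are related by the following linear map.\<close>

definition transition_deriv ::
  "('a, 'e::euclidean_space) chart \<Rightarrow> ('a, 'e) chart \<Rightarrow> 'a \<Rightarrow> 'e \<Rightarrow> 'e" where
  "transition_deriv c d x = frechet_derivative (coord d \<circ> chart_inv c) (at (coord c x))"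


section \<open>Kaehler manifolds\<close>

type_synonym ('a, 'e) metric_field = "('a, 'e) chart \<Rightarrow> 'a \<Rightarrow> 'e \<Rightarrow> 'e \<Rightarrow> real"
type_synonym ('a, 'e) endo_field = "('a, 'e) chart \<Rightarrow> 'a \<Rightarrow> 'e \<Rightarrow> 'e"

definition riemannian_metric ::
  "('a, 'e::euclidean_space) chart set \<Rightarrow> ('a, 'e) metric_field \<Rightarrow> bool" where
  "riemannian_metric A g \<longleftrightarrow>
     (\<forall>c\<in>A. \<forall>x\<in>chart_dom c. bilinear (g c x) \<and>
        (\<forall>v w. g c x v w = g c x w v) \<and> (\<forall>v. v \<noteq> 0 \<longrightarrow> g c x v v > 0)) \<and>
     (\<forall>c\<in>A. \<forall>v w. smooth_on (chart_img c) (\<lambda>y. g c (chart_inv c y) v w)) \<and>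
     (\<forall>c\<in>A. \<forall>d\<in>A. \<forall>x\<in>chart_dom c \<inter> chart_dom d. \<forall>v w.
        g d x (transition_deriv c d x v) (transition_deriv c d x w) = g c x v w)"

text \<open>The derivative of \<open>g(w, z)\<close> in direction \<open>v\<close> at \<open>x\<close>, for coordinate-constant vector
  fields \<open>w\<close>, \<open>z\<close>.\<close>

definition metric_deriv ::
  "('a, 'e::euclidean_space) metric_field \<Rightarrow> ('a, 'e) chart \<Rightarrow> 'a \<Rightarrow> 'e \<Rightarrow> 'e \<Rightarrow> 'e \<Rightarrow> real" where
  "metric_deriv g c x v w z =
     frechet_derivative (\<lambda>y. g c (chart_inv c y) w z) (at (coord c x)) v"

text \<open>Koszul's formula for coordinate-constant vector fields, whose brackets vanish.\<close>

definition christoffel ::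
  "('a, 'e::euclidean_space) metric_field \<Rightarrow> ('a, 'e) chart \<Rightarrow> 'a \<Rightarrow> 'e \<Rightarrow> 'e \<Rightarrow> 'e" where
  "christoffel g c x v w = (THE u. \<forall>z.
     2 * g c x u z = metric_deriv g c x v w z + metric_deriv g c x w v z - metric_deriv g c x z v w)"

text \<open>The Levi-Civita covariant derivative at \<open>x\<close> in direction \<open>v\<close> of a vector field given by its
  components \<open>Y\<close> in \<open>c\<close>, as a function of the coordinates.\<close>

definition cov_deriv ::
  "('a, 'e::euclidean_space) metric_field \<Rightarrow> ('a, 'e) chart \<Rightarrow> ('e \<Rightarrow> 'e) \<Rightarrow> 'a \<Rightarrow> 'e \<Rightarrow> 'e" where
  "cov_deriv g c Y x v =
     frechet_derivative Y (at (coord c x)) v + christoffel g c x v (Y (coord c x))"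

definition almost_complex_structure ::
  "('a, 'e::euclidean_space) chart set \<Rightarrow> ('a, 'e) endo_field \<Rightarrow> bool" where
  "almost_complex_structure A J \<longleftrightarrow>
     (\<forall>c\<in>A. \<forall>x\<in>chart_dom c. linear (J c x) \<and> (\<forall>v. J c x (J c x v) = - v)) \<and>
     (\<forall>c\<in>A. \<forall>v. smooth_on (chart_img c) (\<lambda>y. J c (chart_inv c y) v)) \<and>
     (\<forall>c\<in>A. \<forall>d\<in>A. \<forall>x\<in>chart_dom c \<inter> chart_dom d. \<forall>v.
        J d x (transition_deriv c d x v) = transition_deriv c d x (J c x v))"

definition parallel_endo ::
  "('a, 'e::euclidean_space) chart set \<Rightarrow> ('a, 'e) metric_field \<Rightarrow> ('a, 'e) endo_field \<Rightarrow> bool" where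
  "parallel_endo A g J \<longleftrightarrow>
     (\<forall>c\<in>A. \<forall>Y. smooth_on (chart_img c) Y \<longrightarrow> (\<forall>x\<in>chart_dom c. \<forall>v.
        cov_deriv g c (\<lambda>y. J c (chart_inv c y) (Y y)) x v = J c x (cov_deriv g c Y x v)))"

text \<open>Integrability of \<open>J\<close> is not listed: it follows from \<open>J\<close> being parallel, because the
  Levi-Civita connection is torsion free.\<close>

definition kaehler_manifold ::
  "'a topology \<Rightarrow> ('a, 'e::euclidean_space) chart set \<Rightarrow> ('a, 'e) metric_field \<Rightarrow>
   ('a, 'e) endo_field \<Rightarrow> bool" where
  "kaehler_manifold X A g J \<longleftrightarrow>
     smooth_manifold X A \<and> riemannian_metric A g \<and> almost_complex_structure A J \<and>
     (\<forall>c\<in>A. \<forall>x\<in>chart_dom c. \<forall>v w. g c x (J c x v) (J c x w) = g c x v w) \<and>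
     parallel_endo A g J"


section \<open>Isometric immersions into Euclidean space\<close>

text \<open>The differential at \<open>x\<close>, in terms of the identification of the tangent space given by \<open>c\<close>.\<close>

definition differential ::
  "('a \<Rightarrow> 'v::euclidean_space) \<Rightarrow> ('a, 'e::euclidean_space) chart \<Rightarrow> 'a \<Rightarrow> 'e \<Rightarrow> 'v" where
  "differential f c x = frechet_derivative (f \<circ> chart_inv c) (at (coord c x))"

definition isometric_immersion ::
  "('a, 'e::euclidean_space) chart set \<Rightarrow> ('a, 'e) metric_field \<Rightarrow>
   ('a \<Rightarrow> 'v::euclidean_space) \<Rightarrow> bool" where
  "isometric_immersion A g f \<longleftrightarrow>
     (\<forall>c\<in>A. smooth_on (chart_img c) (f \<circ> chart_inv c)) \<and>
     (\<forall>c\<in>A. \<forall>x\<in>chart_dom c. inj (differential f c x) \<and>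
        (\<forall>v w. differential f c x v \<bullet> differential f c x w = g c x v w))"

definition substantial :: "'a topology \<Rightarrow> ('a \<Rightarrow> 'v::euclidean_space) \<Rightarrow> bool" where
  "substantial X f \<longleftrightarrow>
     \<not> (\<exists>W S. openin X W \<and> W \<noteq> {} \<and> affine S \<and> aff_dim S < int DIM('v) \<and> f ` W \<subseteq> S)"

definition real_kaehler_submanifold ::
  "'a topology \<Rightarrow> ('a, 'e::euclidean_space) chart set \<Rightarrow> ('a, 'e) metric_field \<Rightarrow>
   ('a, 'e) endo_field \<Rightarrow> ('a \<Rightarrow> 'v::euclidean_space) \<Rightarrow> bool" where
  "real_kaehler_submanifold X A g J f \<longleftrightarrow>
     kaehler_manifold X A g J \<and> connected_space X \<and> isometric_immersion A g f \<and> substantial X f"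

definition holomorphic_immersion ::
  "('a, 'e::euclidean_space) chart set \<Rightarrow> ('a, 'e) endo_field \<Rightarrow>
   ('a \<Rightarrow> 'v::euclidean_space) \<Rightarrow> bool" where
  "holomorphic_immersion A J f \<longleftrightarrow>
     (\<exists>Jt. orthogonal_transformation Jt \<and> (\<forall>u. Jt (Jt u) = - u) \<and>
        (\<forall>c\<in>A. \<forall>x\<in>chart_dom c. \<forall>v. differential f c x (J c x v) = Jt (differential f c x v)))"


section \<open>Second fundamental form and complex nullities\<close>

text \<open>Orthogonal projection onto a linear subspace.\<close>

definition orth_proj :: "'v::euclidean_space set \<Rightarrow> 'v \<Rightarrow> 'v" where
  "orth_proj U v = (THE u. u \<in> U \<and> (\<forall>w\<in>U. orthogonal (v - u) w))"

lemma orth_proj_correct: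
  assumes "subspace U"
  shows "orth_proj U v \<in> U" and "w \<in> U \<Longrightarrow> orthogonal (v - orth_proj U v) w"
proof -
  have ex: "\<exists>u. u \<in> U \<and> (\<forall>w\<in>U. orthogonal (v - u) w)"
    using orthogonal_subspace_decomp_exists[of U v] span_eq_iff[of U] assms
    by (metis add_diff_cancel_left')
  have uniq: "u = u'" if "u \<in> U" "\<forall>w\<in>U. orthogonal (v - u) w"
    "u' \<in> U" "\<forall>w\<in>U. orthogonal (v - u') w" for u u'
  proof -
    have "u - u' \<in> U" using assms that subspace_diff by blast
    then have "(v - u') \<bullet> (u - u') - (v - u) \<bullet> (u - u') = 0"
      using that by (simp add: orthogonal_def)
    then have "(u - u') \<bullet> (u - u') = 0" by (simp add: inner_diff_left)
    then show ?thesis by simp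
  qed
  have "orth_proj U v \<in> U \<and> (\<forall>w\<in>U. orthogonal (v - orth_proj U v) w)"
    unfolding orth_proj_def by (rule theI') (use ex uniq in blast)
  then show "orth_proj U v \<in> U" and "w \<in> U \<Longrightarrow> orthogonal (v - orth_proj U v) w"
    by auto
qed

definition normal_space ::
  "('a \<Rightarrow> 'v::euclidean_space) \<Rightarrow> ('a, 'e::euclidean_space) chart \<Rightarrow> 'a \<Rightarrow> 'v set" where
  "normal_space f c x = orthogonal_comp (range (differential f c x))"

text \<open>The normal component of the ambient derivative in direction \<open>v\<close> of \<open>f\<^sub>*w\<close>, where the tangent
  vector \<open>w\<close> at \<open>x\<close> is extended to the coordinate-constant vector field.\<close>

definition second_fundamental_form ::
  "('a \<Rightarrow> 'v::euclidean_space) \<Rightarrow> ('a, 'e::euclidean_space) chart \<Rightarrow> 'a \<Rightarrow> 'e \<Rightarrow> 'e \<Rightarrow> 'v" where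
  "second_fundamental_form f c x v w =
     orth_proj (normal_space f c x)
       (frechet_derivative (\<lambda>y. frechet_derivative (f \<circ> chart_inv c) (at y) w) (at (coord c x)) v)"

definition nullity_space ::
  "('a \<Rightarrow> 'v::euclidean_space) \<Rightarrow> ('a, 'e::euclidean_space) chart \<Rightarrow> 'a \<Rightarrow> 'v set \<Rightarrow> 'e set" where
  "nullity_space f c x U = {v. \<forall>w. orth_proj U (second_fundamental_form f c x v w) = 0}"

text \<open>The value does not depend on the choice of the chart \<open>c\<close> around \<open>x\<close>: the transition
  derivatives are linear isomorphisms that intertwine the components of all tensors involved.\<close>

definition complex_nullity ::
  "('a, 'e::euclidean_space) endo_field \<Rightarrow> ('a \<Rightarrow> 'v::euclidean_space) \<Rightarrow> ('a, 'e) chart \<Rightarrow>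
   nat \<Rightarrow> 'a \<Rightarrow> nat" where
  "complex_nullity J f c s x =
     Max {dim (nullity_space f c x U \<inter> J c x ` nullity_space f c x U) | U.
            subspace U \<and> U \<subseteq> normal_space f c x \<and> dim U = s}"

end

theory Submission
  imports Defs
begin

text \<open>
  For a Kaehler metric the Gauss equation says that the complex bilinear extension of the inner
  product, evaluated on \<open>\<gamma>(X, Y) = \<alpha>(X, Y) - i \<alpha>(X, J Y)\<close>, satisfies
  \<open>\<langle>\<gamma>(X, Y), \<gamma>(Z, T)\<rangle> = \<langle>\<gamma>(Z, Y), \<gamma>(X, T)\<rangle>\<close>, i.e. \<open>\<gamma>\<close> is flat. A first application of Moore's
  regular elements, together with the nullity hypothesis, gives \<open>\<alpha>(J X, Y) = \<alpha>(X, J Y)\<close>, so that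
  \<open>\<gamma>\<close> is symmetric and complex bilinear. A flat symmetric map whose values span a nondegenerate space
  of dimension at most 11 has nullity of codimension at most that dimension; applied to \<open>\<gamma>\<close> modulo the
  radical of its span and combined with the nullity hypothesis, this forces the span of \<open>\<gamma>\<close> to be
  isotropic. Hence \<open>\<alpha>(X, Y) \<mapsto> \<alpha>(X, J Y)\<close> is an isometry of the normal space, and with \<open>J\<close> on
  the tangent space it gives an orthogonal complex structure of the ambient space at every point.
  Its derivative \<open>K\<close> along the immersion is skew, vanishes on tangent vectors, and makes
  \<open>\<langle>K\<^sub>Z \<alpha>(V, W), \<alpha>(S, T)\<rangle>\<close> totally symmetric as well as antisymmetric under exchange of the pairs
  \<open>(V, W)\<close> and \<open>(S, T)\<close>. Hence \<open>K = 0\<close> and the structure is constant.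
\<close>

section \<open>Regular elements of bilinear maps\<close>

text \<open>Both uses of the nullity hypothesis are dimension counts of one type. A subspace U of
  the normal space is singled out; rank-nullity produces a J-invariant space of dimension at least 2
  (n - dim U) inside the nullity of the U-component of \<alpha>; the hypothesis for s = dim U then
  leaves only U = 0. The first count is real. The form on its target has signature (p, p), but the
  opposite parities of the two components make it definite on the pairs of values that matter. The
  second count is complex, and no definiteness is available. Passing to the quotient by the radical
  costs twice the dimension of the radical in U; this loss is covered because the radical and the
  conjugate of the span are independent, and so are the span and the conjugate of the radical. Since
  one count is over the reals and one over the complex numbers, regular elements are treated over
  any field of characteristic 0, with a condition on lines in place of the Zariski topology. The
  bound 11 enters in the second count only, where the codimension of a nullity space is compared
  with the dimension of a span.\<close>

context vector_space
begin

text \<open>\<open>P\<close> stands in for the quotient map by \<open>K\<close>: its kernel is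
  exactly \<open>K\<close>, and \<open>P w\<close> represents the class of \<open>w\<close>.
  Applying \<open>P\<close> to \<open>w - P w\<close> shows that it is idempotent.\<close>

lemma projection_exists:
  assumes K: "subspace K"
  obtains P where "Vector_Spaces.linear scale scale P" "\<And>w. w - P w \<in> K" "\<And>w. w \<in> K \<Longrightarrow> P w = 0"
proof -
  interpret VP: vector_space_pair scale scale by unfold_locales
  obtain B where B: "B \<subseteq> K" "independent B" "K \<subseteq> span B"
    using maximal_independent_subset by blast
  obtain B' where B': "B \<subseteq> B'" "independent B'" "UNIV \<subseteq> span B'"
    using maximal_independent_subset_extend[of B UNIV] B by auto
  define P where "P = VP.construct B' (\<lambda>b. if b \<in> B then 0 else b)"
  have lin: "Vector_Spaces.linear scale scale P"
    unfolding P_def by (rule VP.linear_construct[OF B'(2)])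
  interpret P: Vector_Spaces.linear scale scale P by (rule lin)
  have PB: "P b = (if b \<in> B then 0 else b)" if "b \<in> B'" for b
    unfolding P_def using VP.construct_basis[OF B'(2) that] by simp
  have "w - P w \<in> K" for w
  proof -
    have "w \<in> span B'" using B' by auto
    then show ?thesis
    proof (induction rule: span_induct_alt)
      case base show ?case using subspace_0[OF K] by simp
    next
      case (step c x y)
      have "x - P x \<in> K" using PB[OF step(1)] B subspace_0[OF K] by auto
      then have "scale c (x - P x) + (y - P y) \<in> K"
        using step K subspace_add subspace_scale by blast
      moreover have "scale c x + y - P (scale c x + y) = scale c (x - P x) + (y - P y)"
        by (simp add: P.add P.scale scale_right_diff_distrib)
      ultimately show ?case by (simp only:)
    qed
  qed
  moreover have "P w = 0" if "w \<in> K" for w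
  proof -
    have "w \<in> span B" using that B by auto
    then show ?thesis
    proof (induction rule: span_induct_alt)
      case base show ?case by simp
    next
      case (step c x y)
      then show ?case using PB[of x] B' by (auto simp: P.add P.scale)
    qed
  qed
  ultimately show ?thesis using that lin by blast
qed

lemma complement_exists:
  assumes K: "subspace K" and U: "subspace U" and KU: "K \<subseteq> U"
  obtains C where "subspace C" "C \<subseteq> U" "K \<inter> C = {0}" "U = {x + y | x y. x \<in> K \<and> y \<in> C}"
proof -
  obtain P where P: "Vector_Spaces.linear scale scale P" "\<And>w. w - P w \<in> K" "\<And>w. w \<in> K \<Longrightarrow> P w = 0"
    using projection_exists[OF K] by blast
  interpret P: Vector_Spaces.linear scale scale P by fact
  have PU: "P u \<in> U" if "u \<in> U" for u
    using subspace_diff[OF U that, of "u - P u"] P(2)[of u] KU by auto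
  have PP: "P (P u) = P u" for u
    using P(3)[OF P(2)[of u]] by (simp add: P.diff)
  show ?thesis
  proof
    show "subspace (P ` U)" using P.subspace_image[OF U] .
    show "P ` U \<subseteq> U" using PU by auto
    show "K \<inter> P ` U = {0}"
      using P(3) PP subspace_0[OF K] subspace_0[OF U] P.zero by force
    show "U = {x + y | x y. x \<in> K \<and> y \<in> P ` U}"
    proof
      show "U \<subseteq> {x + y | x y. x \<in> K \<and> y \<in> P ` U}"
      proof
        fix u assume "u \<in> U"
        then have "u = (u - P u) + P u \<and> u - P u \<in> K \<and> P u \<in> P ` U" using P(2) by auto
        then show "u \<in> {x + y | x y. x \<in> K \<and> y \<in> P ` U}" by blast
      qed
      show "{x + y | x y. x \<in> K \<and> y \<in> P ` U} \<subseteq> U"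
        using KU PU subspace_add[OF U] by auto
    qed
  qed
qed

end

section \<open>Rank, kernels and perturbations of linear maps\<close>

context finite_dimensional_vector_space
begin

lemma dim_complement:
  assumes "subspace K" "subspace C" "K \<inter> C = {0}" "U = {x + y | x y. x \<in> K \<and> y \<in> C}"
  shows "dim U = dim K + dim C"
proof -
  have "dim (K \<inter> C) = 0" unfolding assms(3) by simp
  then show ?thesis using dim_sums_Int[OF assms(1,2)] unfolding assms(4) by linarith
qed
lemma finite_dimensional_pair_scalars:
  "finite_dimensional_vector_space_pair scale Basis ((*) :: 'a \<Rightarrow> 'a \<Rightarrow> 'a) {1}"
  by (intro finite_dimensional_vector_space_pair.intro finite_dimensional_vector_space_axioms
     vector_space_over_itself.finite_dimensional_vector_space_axioms)

end

context finite_dimensional_vector_space_pair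
begin

lemma dim_kernel_complement:
  assumes lf: "Vector_Spaces.linear s1 s2 f" and U: "vs1.subspace U"
  obtains C where "vs1.subspace C" "C \<subseteq> U" "\<forall>u\<in>C. f u = 0 \<longrightarrow> u = 0"
    "vs1.dim C = vs2.dim (f ` U)" "vs1.dim U = vs1.dim {u\<in>U. f u = 0} + vs1.dim C"
proof -
  interpret f: Vector_Spaces.linear s1 s2 f by fact
  have K: "vs1.subspace {u\<in>U. f u = 0}"
    using vs1.subspace_inter[OF U f.subspace_kernel] by (simp add: Int_def)
  obtain C where C: "vs1.subspace C" "C \<subseteq> U" "{u\<in>U. f u = 0} \<inter> C = {0}"
    "U = {x + y | x y. x \<in> {u\<in>U. f u = 0} \<and> y \<in> C}"
    using vs1.complement_exists[OF K U] by blast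
  have inj: "u = 0" if "u \<in> C" "f u = 0" for u using C that by auto
  have "f ` U = f ` C"
  proof
    show "f ` U \<subseteq> f ` C"
    proof
      fix w assume "w \<in> f ` U"
      then obtain u where u: "u \<in> U" "w = f u" by auto
      then obtain x y where "u = x + y" "f x = 0" "y \<in> C" using C(4) by blast
      then show "w \<in> f ` C" using u by (auto simp: f.add)
    qed
  qed (use C in auto)
  moreover have "inj_on f (vs1.span C)"
    unfolding vs1.span_eq_iff[THEN iffD2, OF C(1)] f.inj_on_iff_eq_0[OF C(1)] using inj by blast
  ultimately have "vs1.dim C = vs2.dim (f ` U)" using dim_image_eq[OF lf] by simp
  moreover have "\<forall>u\<in>C. f u = 0 \<longrightarrow> u = 0" using inj by blast
  ultimately show ?thesis using that[OF C(1,2)] vs1.dim_complement[OF K C(1) C(3) C(4)] by blast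
qed

lemma rank_nullity:
  assumes "Vector_Spaces.linear s1 s2 f" "vs1.subspace U"
  shows "vs1.dim U = vs2.dim (f ` U) + vs1.dim {u\<in>U. f u = 0}"
proof (rule dim_kernel_complement[OF assms])
  fix C
  assume C: "vs1.dim C = vs2.dim (f ` U)" and U: "vs1.dim U = vs1.dim {u\<in>U. f u = 0} + vs1.dim C"
  show ?thesis using U unfolding C by (simp only: add.commute)
qed

text \<open>Records the rank of \<open>f\<close> by a subspace on which \<open>f\<close> is
  injective. Injectivity there survives almost all perturbations of \<open>f\<close> along a line,
  so this subspace does the work of a nonvanishing minor.\<close>

lemma injective_complement_of_kernel:
  assumes "Vector_Spaces.linear s1 s2 f"
  shows "\<exists>C. vs1.subspace C \<and> (\<forall>u\<in>C. f u = 0 \<longrightarrow> u = 0) \<and> vs1.dim C = vs2.dim (range f)"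
  by (rule dim_kernel_complement[OF assms vs1.subspace_UNIV]) (intro exI conjI)

lemma dim_le_of_injective:
  assumes lf: "Vector_Spaces.linear s1 s2 f" and U: "vs1.subspace U"
    and inj: "\<And>u. u \<in> U \<Longrightarrow> f u = 0 \<Longrightarrow> u = 0" and sub: "f ` U \<subseteq> T"
  shows "vs1.dim U \<le> vs2.dim T"
proof -
  interpret f: Vector_Spaces.linear s1 s2 f by fact
  have "{u\<in>U. f u = 0} \<subseteq> {0}" using inj by auto
  then have z: "vs1.dim {u\<in>U. f u = 0} = 0" unfolding vs1.dim_eq_0 .
  have "vs1.dim U = vs2.dim (f ` U)" using rank_nullity[OF lf U] unfolding z by (simp only: add_0_right)
  then show ?thesis using vs2.dim_subset[OF sub] by (simp only:)
qed

text \<open>Eigenvectors of a pencil \<open>f + t g\<close> for distinct \<open>t\<close> are independent.\<close>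

lemma finite_singular_perturbations:
  assumes lf: "Vector_Spaces.linear s1 s2 f" and lg: "Vector_Spaces.linear s1 s2 g"
    and U: "vs1.subspace U" and inj: "\<And>u. u \<in> U \<Longrightarrow> f u = 0 \<Longrightarrow> u = 0"
  shows "finite {t. \<not> (\<forall>u\<in>U. f u + s2 t (g u) = 0 \<longrightarrow> u = 0)}" (is "finite ?Bad")
proof (rule ccontr)
  interpret f: Vector_Spaces.linear s1 s2 f by fact
  interpret g: Vector_Spaces.linear s1 s2 g by fact
  assume inf: "infinite ?Bad"
  have "\<forall>t\<in>?Bad. \<exists>u. u \<in> U \<and> u \<noteq> 0 \<and> f u + s2 t (g u) = 0" by blast
  from bchoice[OF this]
  obtain u where u: "\<And>t. t \<in> ?Bad \<Longrightarrow> u t \<in> U \<and> u t \<noteq> 0 \<and> f (u t) + s2 t (g (u t)) = 0"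
    by blast
  have nz: "t \<noteq> 0" if "t \<in> ?Bad" for t using u[OF that] inj by auto
  have gu: "g (u t) = - s2 (1/t) (f (u t))" if "t \<in> ?Bad" for t
  proof -
    have "s2 (1/t) (f (u t) + s2 t (g (u t))) = 0" using u[OF that] by simp
    then show ?thesis using nz[OF that]
      by (simp add: vs2.scale_right_distrib add_eq_0_iff)
  qed
  have indep: "\<forall>c. (\<Sum>t\<in>F. s1 (c t) (u t)) = 0 \<longrightarrow> (\<forall>t\<in>F. c t = 0)"
    if "finite F" "F \<subseteq> ?Bad" for F
    using that
  proof (induction F)
    case empty then show ?case by simp
  next
    case (insert t0 F)
    show ?case
    proof (intro allI impI)
      fix c assume z: "(\<Sum>t\<in>insert t0 F. s1 (c t) (u t)) = 0"
      have t0: "t0 \<in> ?Bad" and F: "F \<subseteq> ?Bad" using insert by auto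
      \<comment> \<open>With the coefficients divided by \<open>t\<close>, \<open>f\<close> maps the
        sum to minus \<open>g\<close> of the vanishing combination, so \<open>?v\<close> is zero by
        injectivity. Subtracting the given relation from \<open>t0\<close> times this one cancels
        the term of \<open>t0\<close>.\<close>
      let ?v = "\<Sum>t\<in>insert t0 F. s1 (c t / t) (u t)"
      have "f ?v = - g (\<Sum>t\<in>insert t0 F. s1 (c t) (u t))"
        unfolding f.sum g.sum sum_negf[symmetric]
        by (rule sum.cong[OF refl], subst g.scale, subst gu)
          (use t0 F in \<open>auto simp: f.scale\<close>)
      then have "f ?v = 0" using z by (simp add: g.zero)
      moreover have "?v \<in> U"
        using u t0 F by (intro vs1.subspace_sum[OF U] vs1.subspace_scale[OF U]) auto
      ultimately have "?v = 0" using inj by blast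
      then have "s1 t0 ?v - (\<Sum>t\<in>insert t0 F. s1 (c t) (u t)) = 0" using z by simp
      then have "(\<Sum>t\<in>insert t0 F. s1 (t0 * (c t / t) - c t) (u t)) = 0"
        by (simp only: vs1.scale_sum_right vs1.scale_scale sum_subtractf[symmetric]
            vs1.scale_left_diff_distrib)
      then have "(\<Sum>t\<in>F. s1 (t0 * (c t / t) - c t) (u t)) = 0"
        using insert nz[OF t0] by simp
      then have *: "\<forall>t\<in>F. t0 * (c t / t) - c t = 0"
        using insert.IH[OF F, rule_format, of "\<lambda>t. t0 * (c t / t) - c t"] by blast
      have cF: "\<forall>t\<in>F. c t = 0"
      proof
        fix t assume t: "t \<in> F"
        have e: "t0 * (c t / t) - c t = 0" using * t by blast
        have tn: "t \<noteq> 0" using nz F t by blast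
        have "t \<noteq> t0" using insert(2) t by blast
        moreover have "c t * (t0 - t) = (t0 * (c t / t) - c t) * t"
          using tn by (simp add: algebra_simps)
        ultimately show "c t = 0" unfolding e by simp
      qed
      then have "s1 (c t0) (u t0) = 0" using z insert by simp
      then have "c t0 = 0" using u[OF t0] by simp
      then show "\<forall>t\<in>insert t0 F. c t = 0" using cF by simp
    qed
  qed
  obtain F where F: "F \<subseteq> ?Bad" "finite F" "card F = Suc (vs1.dim UNIV)"
    using infinite_arbitrarily_large[OF inf] by blast
  have injF: "inj_on u F"
  proof (rule inj_onI, rule ccontr)
    fix s t assume st: "s \<in> F" "t \<in> F" "u s = u t" "s \<noteq> t"
    let ?c = "\<lambda>x. (if x = s then 1 else 0) - (if x = t then 1 else 0) :: 'a"
    have "s1 (?c x) (u x) = (if x = s then u x else 0) - (if x = t then u x else 0)" for x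
      by simp
    then have "(\<Sum>x\<in>F. s1 (?c x) (u x)) = (\<Sum>x\<in>F. if x = s then u x else 0) - (\<Sum>x\<in>F. if x = t then u x else 0)"
      by (simp only: sum_subtractf)
    also have "\<dots> = 0" using st F(2) by (simp add: sum.delta)
    finally have "\<forall>x\<in>F. ?c x = 0" using indep[OF F(2,1), THEN spec[of _ ?c]] by blast
    from bspec[OF this st(1)] show False using st(4) by simp
  qed
  have "vs1.independent (u ` F)"
  proof (rule vs1.independent_if_scalars_zero)
    show "finite (u ` F)" using F by simp
    fix c x assume s: "(\<Sum>x\<in>u ` F. s1 (c x) x) = 0" and x: "x \<in> u ` F"
    have "(\<Sum>t\<in>F. s1 (c (u t)) (u t)) = 0" using s by (simp add: sum.reindex[OF injF])
    then show "c x = 0" using indep[OF F(2,1), rule_format, of "\<lambda>t. c (u t)"] x by auto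
  qed
  then have "card (u ` F) \<le> vs1.dim UNIV" using vs1.independent_card_le_dim by blast
  then show False using card_image[OF injF] F by simp
qed

end

text \<open>An algebraic substitute for Zariski openness.\<close>

definition line_open :: "('k::field_char_0 \<Rightarrow> 'a::ab_group_add \<Rightarrow> 'a) \<Rightarrow> ('a \<Rightarrow> bool) \<Rightarrow> bool" where
  "line_open s P \<longleftrightarrow> (\<forall>a b. P a \<longrightarrow> finite {t. \<not> P (a + s t b)})"

lemma line_open_conj:
  assumes "line_open s P" "line_open s Q"
  shows "line_open s (\<lambda>a. P a \<and> Q a)"
  unfolding line_open_def
proof (intro allI impI)
  fix a b assume "P a \<and> Q a"
  then have "finite ({t. \<not> P (a + s t b)} \<union> {t. \<not> Q (a + s t b)})"
    using assms by (auto simp: line_open_def)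
  then show "finite {t. \<not> (P (a + s t b) \<and> Q (a + s t b))}"
    by (rule rev_finite_subset) auto
qed

text \<open>Plays the part of the irreducibility of affine space: on the line through the two
  witnesses each condition fails at finitely many parameters only, and a field of characteristic 0
  is infinite.\<close>

lemma line_open_meet:
  assumes "vector_space s" and P: "line_open s P" and Q: "line_open s Q" and a: "P a" and b: "Q b"
  shows "\<exists>c. P c \<and> Q c"
proof -
  interpret vector_space s by fact
  have "finite ((\<lambda>t. 1 - t) ` {t. \<not> Q (b + s t (a - b))})"
    using Q b by (auto simp: line_open_def)
  then have "finite {t. \<not> Q (a + s t (b - a))}"
  proof (rule rev_finite_subset, intro subsetI)
    fix t assume "t \<in> {t. \<not> Q (a + s t (b - a))}"
    moreover have "a + s t (b - a) = b + s (1 - t) (a - b)"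
      by (simp add: scale_left_diff_distrib scale_right_diff_distrib)
    ultimately show "t \<in> (\<lambda>t. 1 - t) ` {t. \<not> Q (b + s t (a - b))}"
      by (intro image_eqI[of _ _ "1 - t"]) auto
  qed
  moreover have "finite {t. \<not> P (a + s t (b - a))}" using P a by (auto simp: line_open_def)
  ultimately have "finite ({t. \<not> P (a + s t (b - a))} \<union> {t. \<not> Q (a + s t (b - a))})" by simp
  then obtain t where "t \<notin> {t. \<not> P (a + s t (b - a))} \<union> {t. \<not> Q (a + s t (b - a))}"
    using infinite_UNIV_char_0 ex_new_if_finite by blast
  then show ?thesis by auto
qed

text \<open>The analogue of containing a nonempty Zariski open set. Finitely many generic conditions
  can be met by one vector, even when, like \<open>good\<close> below, they are only implied by a
  line-open condition.\<close>

definition generic :: "('k::field_char_0 \<Rightarrow> 'a::ab_group_add \<Rightarrow> 'a) \<Rightarrow> ('a \<Rightarrow> bool) \<Rightarrow> bool" where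
  "generic s P \<longleftrightarrow> (\<exists>Q. line_open s Q \<and> (\<exists>a. Q a) \<and> (\<forall>a. Q a \<longrightarrow> P a))"

lemma generic_conj:
  assumes "vector_space s" "generic s P" "generic s Q"
  shows "generic s (\<lambda>a. P a \<and> Q a)"
proof -
  obtain P' a where P': "line_open s P'" "P' a" "\<And>a. P' a \<Longrightarrow> P a"
    using assms(2) unfolding generic_def by blast
  obtain Q' b where Q': "line_open s Q'" "Q' b" "\<And>a. Q' a \<Longrightarrow> Q a"
    using assms(3) unfolding generic_def by blast
  have "line_open s (\<lambda>a. P' a \<and> Q' a)" by (rule line_open_conj[OF P'(1) Q'(1)])
  moreover have "\<exists>a. P' a \<and> Q' a"
    by (rule line_open_meet[OF assms(1) P'(1) Q'(1) P'(2) Q'(2)])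
  ultimately show ?thesis
    unfolding generic_def using P'(3) Q'(3) by (intro exI[of _ "\<lambda>a. P' a \<and> Q' a"]) simp
qed

lemma generic_ex: "generic s P \<Longrightarrow> \<exists>a. P a"
  unfolding generic_def by blast

lemma generic_mono: "generic s P \<Longrightarrow> (\<And>a. P a \<Longrightarrow> Q a) \<Longrightarrow> generic s Q"
  unfolding generic_def by blast

section \<open>Moore's regular elements\<close>

locale fd_pair_char_0 = finite_dimensional_vector_space_pair s1 B1 s2 B2
  for s1 :: "'k::field_char_0 \<Rightarrow> 'a::ab_group_add \<Rightarrow> 'a" and B1
  and s2 :: "'k \<Rightarrow> 'b::ab_group_add \<Rightarrow> 'b" and B2
begin

definition bilinear_map :: "('a \<Rightarrow> 'a \<Rightarrow> 'b) \<Rightarrow> bool" where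
  "bilinear_map \<phi> \<longleftrightarrow> (\<forall>y. Vector_Spaces.linear s1 s2 (\<phi> y)) \<and>
     (\<forall>b. Vector_Spaces.linear s1 s2 (\<lambda>y. \<phi> y b))"

definition regular :: "('a \<Rightarrow> 'a \<Rightarrow> 'b) \<Rightarrow> 'a \<Rightarrow> bool" where
  "regular \<phi> y \<longleftrightarrow> (\<forall>z. vs2.dim (range (\<phi> z)) \<le> vs2.dim (range (\<phi> y)))"

lemma bilinear_mapD:
  assumes "bilinear_map \<phi>"
  shows "\<phi> (x + y) z = \<phi> x z + \<phi> y z" "\<phi> (x - y) z = \<phi> x z - \<phi> y z"
    "\<phi> (s1 c x) z = s2 c (\<phi> x z)" "\<phi> 0 z = 0"
    "\<phi> z (x + y) = \<phi> z x + \<phi> z y" "\<phi> z (x - y) = \<phi> z x - \<phi> z y"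
    "\<phi> z (s1 c x) = s2 c (\<phi> z x)" "\<phi> z 0 = 0"
proof -
  interpret l: Vector_Spaces.linear s1 s2 "\<lambda>y. \<phi> y z" using assms by (simp add: bilinear_map_def)
  interpret r: Vector_Spaces.linear s1 s2 "\<phi> z" using assms by (simp add: bilinear_map_def)
  show "\<phi> (x + y) z = \<phi> x z + \<phi> y z" "\<phi> (x - y) z = \<phi> x z - \<phi> y z"
    "\<phi> (s1 c x) z = s2 c (\<phi> x z)" "\<phi> 0 z = 0"
    by (simp_all add: l.add l.diff l.scale l.zero)
  show "\<phi> z (x + y) = \<phi> z x + \<phi> z y" "\<phi> z (x - y) = \<phi> z x - \<phi> z y"
    "\<phi> z (s1 c x) = s2 c (\<phi> z x)" "\<phi> z 0 = 0"
    by (simp_all add: r.add r.diff r.scale r.zero)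
qed

lemma regular_exists: "\<exists>y. regular \<phi> y"
proof -
  have "\<forall>y. True \<longrightarrow> vs2.dim (range (\<phi> y)) < Suc (vs2.dim UNIV)"
    using vs2.dim_subset le_imp_less_Suc by blast
  from ex_has_greatest_nat[OF _ this] show ?thesis by (auto simp: regular_def)
qed

text \<open>The rank can drop at finitely many points of a line only, because injectivity on a
  complement of the kernel persists; and at a regular element it is already maximal.\<close>

lemma regular_line_open:
  assumes bl: "bilinear_map \<phi>"
  shows "line_open s1 (regular \<phi>)"
  unfolding line_open_def
proof (intro allI impI)
  fix a b assume a: "regular \<phi> a"
  have lin: "Vector_Spaces.linear s1 s2 (\<phi> x)" for x using bl by (simp add: bilinear_map_def)
  obtain C where C: "vs1.subspace C" "\<forall>u\<in>C. \<phi> a u = 0 \<longrightarrow> u = 0"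
    "vs1.dim C = vs2.dim (range (\<phi> a))"
    using injective_complement_of_kernel[OF lin[of a]] by (elim exE conjE)
  have "finite {t. \<not> (\<forall>u\<in>C. \<phi> a u + s2 t (\<phi> b u) = 0 \<longrightarrow> u = 0)}"
    using finite_singular_perturbations[OF lin lin C(1)] C(2) by blast
  moreover have "{t. \<not> regular \<phi> (a + s1 t b)} \<subseteq> {t. \<not> (\<forall>u\<in>C. \<phi> a u + s2 t (\<phi> b u) = 0 \<longrightarrow> u = 0)}"
  proof (rule subsetI, rule ccontr)
    fix t assume t: "t \<in> {t. \<not> regular \<phi> (a + s1 t b)}"
      and "t \<notin> {t. \<not> (\<forall>u\<in>C. \<phi> a u + s2 t (\<phi> b u) = 0 \<longrightarrow> u = 0)}"
    then have "\<And>u. u \<in> C \<Longrightarrow> \<phi> (a + s1 t b) u = 0 \<Longrightarrow> u = 0"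
      by (simp add: bilinear_mapD[OF bl])
    then have "vs1.dim C \<le> vs2.dim (range (\<phi> (a + s1 t b)))"
      by (intro dim_le_of_injective[OF lin C(1)]) auto
    then have "vs2.dim (range (\<phi> a)) \<le> vs2.dim (range (\<phi> (a + s1 t b)))" using C(3) by simp
    then have "regular \<phi> (a + s1 t b)" using a unfolding regular_def by (meson le_trans)
    then show False using t by simp
  qed
  ultimately show "finite {t. \<not> regular \<phi> (a + s1 t b)}" by (rule rev_finite_subset)
qed

lemma generic_regular:
  assumes "bilinear_map \<phi>"
  shows "generic s1 (regular \<phi>)"
  unfolding generic_def
  by (rule exI[of _ "regular \<phi>"]) (simp add: regular_line_open[OF assms] regular_exists)


text \<open>Moore's lemma. If \<open>\<phi> z b\<close> were outside the image of
  \<open>\<phi> y\<close>, then for almost all \<open>t\<close> the map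
  \<open>\<phi> (y + t z)\<close> would be injective on a complement of the kernel of
  \<open>\<phi> y\<close> enlarged by \<open>b\<close>, and its rank would exceed the
  maximum.\<close>

lemma regular_kernel_image:
  assumes bl: "bilinear_map \<phi>" and y: "regular \<phi> y" and b: "\<phi> y b = 0"
  shows "\<phi> z b \<in> range (\<phi> y)"
proof (rule ccontr)
  assume w: "\<phi> z b \<notin> range (\<phi> y)"
  let ?w = "\<phi> z b"
  have lin: "Vector_Spaces.linear s1 s2 (\<phi> x)" for x using bl by (simp add: bilinear_map_def)
  interpret y: Vector_Spaces.linear s1 s2 "\<phi> y" by (rule lin)
  interpret z: Vector_Spaces.linear s1 s2 "\<phi> z" by (rule lin)
  note bD = bilinear_mapD[OF bl]
  have subR: "vs2.subspace (range (\<phi> y))" using y.subspace_image[OF vs1.subspace_UNIV] .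
  then have w0: "?w \<noteq> 0" using w vs2.subspace_0 by metis
  \<comment> \<open>\<open>\<phi> (y + t z) b\<close> is \<open>t\<close> times \<open>?w\<close>
    and thus invisible to \<open>p\<close>, while \<open>p\<close> composed with
    \<open>\<phi> y\<close> is still injective on \<open>C\<close>. A perturbation can therefore be
    tested on \<open>C\<close> first and on \<open>b\<close> afterwards.\<close>
  obtain p where p: "Vector_Spaces.linear s2 s2 p" "\<And>v. v - p v \<in> vs2.span {?w}"
    "\<And>v. v \<in> vs2.span {?w} \<Longrightarrow> p v = 0"
    using vs2.projection_exists[OF vs2.subspace_span] by blast
  interpret p: Vector_Spaces.linear s2 s2 p by fact
  have pw: "p ?w = 0" using p(3) vs2.span_base by blast
  have p_inj: "v = 0" if "v \<in> range (\<phi> y)" "p v = 0" for v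
  proof (rule ccontr)
    assume "v \<noteq> 0"
    have "v \<in> vs2.span {?w}" using p(2)[of v] that by simp
    then obtain c where c: "v = s2 c ?w" by (auto simp: vs2.span_singleton)
    then have "?w = s2 (1/c) v" using \<open>v \<noteq> 0\<close> by auto
    then show False using w that vs2.subspace_scale[OF subR] by metis
  qed
  obtain C where C: "vs1.subspace C" "\<forall>u\<in>C. \<phi> y u = 0 \<longrightarrow> u = 0"
    "vs1.dim C = vs2.dim (range (\<phi> y))"
    using injective_complement_of_kernel[OF lin[of y]] by blast
  have lp: "Vector_Spaces.linear s1 s2 (\<lambda>u. p (\<phi> x u))" for x
    using Vector_Spaces.linear_compose[OF lin p(1)] by (simp add: o_def)
  have "finite ({t. \<not> (\<forall>u\<in>C. p (\<phi> y u) + s2 t (p (\<phi> z u)) = 0 \<longrightarrow> u = 0)} \<union> {0})"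
    using finite_singular_perturbations[OF lp lp C(1)] C(2) p_inj by blast
  from ex_new_if_finite[OF infinite_UNIV_char_0 this]
  obtain t where t: "t \<noteq> 0" "\<forall>u\<in>C. p (\<phi> y u) + s2 t (p (\<phi> z u)) = 0 \<longrightarrow> u = 0" by auto
  have b0: "b \<noteq> 0" using w0 bD(8) by blast
  have bC: "b \<notin> C" using C(2) b b0 by blast
  have inj: "v = 0" if v: "v \<in> vs1.span (insert b C)" and v0: "\<phi> (y + s1 t z) v = 0" for v
  proof -
    obtain k where "v - s1 k b \<in> vs1.span C" using v vs1.span_breakdown_eq by blast
    then have u: "v - s1 k b \<in> C" using C(1) vs1.span_eq_iff by metis
    define u where "u = v - s1 k b"
    have v_eq: "v = u + s1 k b" by (simp add: u_def)
    have *: "\<phi> y u + s2 t (\<phi> z u) + s2 k (s2 t ?w) = 0"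
    proof -
      have "\<phi> y v = \<phi> y u" unfolding v_eq by (simp add: bD b)
      moreover have "s2 t (\<phi> z v) = s2 t (\<phi> z u) + s2 k (s2 t ?w)"
        unfolding v_eq by (simp add: bD vs2.scale_right_distrib mult.commute)
      ultimately show ?thesis using v0 by (simp add: bD add.assoc)
    qed
    have "p (\<phi> y u) + s2 t (p (\<phi> z u)) = p (\<phi> y u + s2 t (\<phi> z u) + s2 k (s2 t ?w))"
      by (simp only: p.add p.scale pw vs2.scale_zero_right add_0_right)
    then have "p (\<phi> y u) + s2 t (p (\<phi> z u)) = 0" unfolding * p.zero .
    then have u0: "u = 0" using t u unfolding u_def[symmetric] by blast
    have "s2 k (s2 t ?w) = 0" using * unfolding u0 by (simp only: bD vs2.scale_zero_right add_0_left)
    then have "k = 0" using t(1) w0 by simp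
    then show ?thesis unfolding v_eq u0 by simp
  qed
  have "vs1.dim (vs1.span (insert b C)) \<le> vs2.dim (range (\<phi> (y + s1 t z)))"
    using inj by (intro dim_le_of_injective[OF lin vs1.subspace_span]) auto
  moreover have "vs1.dim (vs1.span (insert b C)) = Suc (vs1.dim C)"
    unfolding vs1.dim_span vs1.dim_insert vs1.span_eq_iff[THEN iffD2, OF C(1)] using bC by simp
  moreover have "vs2.dim (range (\<phi> (y + s1 t z))) \<le> vs2.dim (range (\<phi> y))"
    using y unfolding regular_def by blast
  ultimately show False using C(3) by linarith
qed

end

section \<open>Common kernels of functionals and pairings\<close>

context finite_dimensional_vector_space
begin

lemma dim_le_dim_common_kernel:
  assumes "finite G" "\<And>g. g \<in> G \<Longrightarrow> Vector_Spaces.linear scale (*) g" "subspace X"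
  shows "dim X \<le> dim {x\<in>X. \<forall>g\<in>G. g x = 0} + card G"
  using assms(1,2)
proof (induction G)
  case empty
  then show ?case by simp
next
  case (insert g G)
  interpret P: finite_dimensional_vector_space_pair scale Basis "(*) :: 'a \<Rightarrow> 'a \<Rightarrow> 'a" "{1}"
    by (rule finite_dimensional_pair_scalars)
  have lin: "Vector_Spaces.linear scale (*) h" if "h \<in> G" for h using insert that by blast
  have lg: "Vector_Spaces.linear scale (*) g" using insert by blast
  let ?Y = "{x\<in>X. \<forall>g\<in>G. g x = 0}"
  have "subspace ?Y"
  proof -
    have "?Y = X \<inter> (\<Inter>h\<in>G. {x. h x = 0})" by auto
    moreover have "subspace (X \<inter> (\<Inter>h\<in>G. {x. h x = 0}))"
      by (intro subspace_inter assms(3) subspace_Int P.linear_subspace_kernel lin)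
    ultimately show ?thesis by (simp only:)
  qed
  from P.rank_nullity[OF lg this]
  have "dim ?Y = vector_space_over_itself.dim (g ` ?Y) + dim {x\<in>?Y. g x = 0}" .
  moreover have "vector_space_over_itself.dim (g ` ?Y) \<le> 1"
    using vector_space_over_itself.dim_subset_UNIV[of "g ` ?Y"] by (simp add: vector_space_over_itself.dimension_def)
  moreover have "{x\<in>?Y. g x = 0} = {x\<in>X. \<forall>g\<in>insert g G. g x = 0}" by auto
  moreover have "dim X \<le> dim ?Y + card G" using insert.IH lin by blast
  ultimately show ?case using insert(1,2) by simp
qed

end

context finite_dimensional_vector_space_pair
begin

text \<open>Vanishing against a basis of the span of \<open>F\<close> suffices, so the number of
  linear conditions is the dimension of \<open>F\<close> and not its size.\<close>

lemma dim_le_dim_pairing_kernel: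
  assumes h1: "\<And>u. Vector_Spaces.linear s1 (*) (h u)"
    and h2: "\<And>x. Vector_Spaces.linear s2 (*) (\<lambda>u. h u x)" and X: "vs1.subspace X"
  shows "vs1.dim X \<le> vs1.dim {x\<in>X. \<forall>u\<in>F. h u x = 0} + vs2.dim F"
proof -
  obtain G where G: "G \<subseteq> F" "vs2.independent G" "F \<subseteq> vs2.span G" "card G = vs2.dim F"
    using vs2.basis_exists by blast
  have fin: "finite G" using vs2.finiteI_independent[OF G(2)] .
  have "h u x = 0" if "u \<in> F" "\<forall>g\<in>h ` G. g x = 0" for u x
  proof -
    interpret l: Vector_Spaces.linear s2 "(*)" "\<lambda>u. h u x" by (rule h2)
    have "u \<in> vs2.span G" using that G by blast
    moreover have "\<And>g. g \<in> G \<Longrightarrow> h g x = 0" using that by simp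
    ultimately show ?thesis using l.eq_0_on_span by blast
  qed
  then have "{x\<in>X. \<forall>g\<in>h ` G. g x = 0} = {x\<in>X. \<forall>u\<in>F. h u x = 0}" using G(1) by auto
  moreover have "vs1.dim X \<le> vs1.dim {x\<in>X. \<forall>g\<in>h ` G. g x = 0} + card (h ` G)"
    by (rule vs1.dim_le_dim_common_kernel[OF _ _ X]) (use fin h1 in auto)
  ultimately show ?thesis using card_image_le[OF fin, of h] G(4) by simp
qed

end

section \<open>Flat symmetric bilinear maps\<close>

text \<open>Together with \<open>sym\<close>, the condition \<open>flat\<close> makes
  \<open>bf (\<alpha> x y) (\<alpha> z t)\<close> symmetric in all four arguments, i.e. the
  polarisation of a quartic form. Nondegeneracy is asked on the span of the values, since
  \<open>bf\<close> may be degenerate on a larger target.\<close>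

locale flat_map = fd_pair_char_0 +
  fixes \<alpha> :: "'b \<Rightarrow> 'b \<Rightarrow> 'c" and bf :: "'c \<Rightarrow> 'c \<Rightarrow> 'a"
  assumes bil: "bilinear_map \<alpha>" and sym: "\<alpha> x y = \<alpha> y x"
    and bf_lin: "Vector_Spaces.linear s2 (*) (bf u)" and bf_sym: "bf u w = bf w u"
    and flat: "bf (\<alpha> x y) (\<alpha> z t) = bf (\<alpha> z y) (\<alpha> x t)"
    and nondeg: "u \<in> vs2.span (\<Union>x. range (\<alpha> x)) \<Longrightarrow> (\<And>x y. bf u (\<alpha> x y) = 0) \<Longrightarrow> u = 0"
begin

definition S :: "'c set" where "S = vs2.span (\<Union>x. range (\<alpha> x))"

lemma subspace_S: "vs2.subspace S"
  unfolding S_def by (rule vs2.subspace_span)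

text \<open>When the second argument is the space \<open>T x\<close> defined below, this contains
  the intersection of \<open>T x\<close> with \<open>T y\<close>. Bounds on it express that the
  spaces attached to generic points overlap little.\<close>

definition annih :: "'b \<Rightarrow> 'c set \<Rightarrow> 'c set" where
  "annih y T = {u\<in>T. \<forall>b. bf u (\<alpha> y b) = 0}"

lemmas alpha_simps = bilinear_mapD[OF bil]

lemma alpha_lin: "Vector_Spaces.linear s1 s2 (\<alpha> y)"
  using bil by (simp add: bilinear_map_def)

lemma bf_lin2: "Vector_Spaces.linear s2 (*) (\<lambda>u. bf u w)"
proof -
  have "(\<lambda>u. bf u w) = bf w" by (rule ext) (rule bf_sym)
  then show ?thesis using bf_lin by simp
qed

lemma bf_simps:
  "bf u (v + w) = bf u v + bf u w" "bf u (v - w) = bf u v - bf u w" "bf u (s2 c w) = c * bf u w"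
  "bf u 0 = 0" "bf (v + w) u = bf v u + bf w u" "bf (v - w) u = bf v u - bf w u"
  "bf (s2 c w) u = c * bf w u" "bf 0 u = 0"
proof -
  interpret r: Vector_Spaces.linear s2 "(*)" "bf u" by (rule bf_lin)
  interpret l: Vector_Spaces.linear s2 "(*)" "\<lambda>w. bf w u" by (rule bf_lin2)
  show "bf u (v + w) = bf u v + bf u w" "bf u (v - w) = bf u v - bf u w" "bf u (s2 c w) = c * bf u w"
    "bf u 0 = 0" by (simp_all add: r.add r.diff r.scale r.zero)
  show "bf (v + w) u = bf v u + bf w u" "bf (v - w) u = bf v u - bf w u"
    "bf (s2 c w) u = c * bf w u" "bf 0 u = 0" by (simp_all add: l.add l.diff l.scale l.zero)
qed

lemma alpha_in_S [simp]: "\<alpha> x y \<in> S"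
  unfolding S_def by (rule vs2.span_base) blast

lemma range_alpha_S: "range (\<alpha> x) \<subseteq> S"
  by auto

lemma bf_span_zero:
  assumes "\<And>u. u \<in> A \<Longrightarrow> bf w u = 0" "u \<in> vs2.span A"
  shows "bf w u = 0"
proof -
  interpret r: Vector_Spaces.linear s2 "(*)" "bf w" by (rule bf_lin)
  show ?thesis using r.eq_0_on_span assms by blast
qed

lemma subspace_orthogonal: "vs2.subspace X \<Longrightarrow> vs2.subspace {w\<in>X. \<forall>u\<in>F. bf u w = 0}"
  by (rule vs2.subspaceI) (auto simp: bf_simps vs2.subspace_0 vs2.subspace_add vs2.subspace_scale)

lemma subspace_annih: "vs2.subspace T \<Longrightarrow> vs2.subspace (annih y T)"
  unfolding annih_def
  by (rule vs2.subspaceI) (auto simp: bf_simps vs2.subspace_0 vs2.subspace_add vs2.subspace_scale)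

lemma annih_subset: "annih y T \<subseteq> T"
  by (auto simp: annih_def)

text \<open>\<open>X\<close> pairs with a complement of its orthogonal space in \<open>S\<close>. If
  \<open>X\<close> were larger than that complement, a nonzero vector of \<open>X\<close> would be
  orthogonal to the complement as well and hence to all of \<open>S\<close>.\<close>

lemma dim_orthogonal_le:
  assumes X: "vs2.subspace X" "X \<subseteq> S"
  shows "vs2.dim {w\<in>S. \<forall>u\<in>X. bf u w = 0} + vs2.dim X \<le> vs2.dim S"
proof (rule ccontr)
  assume less: "\<not> ?thesis"
  interpret WW: finite_dimensional_vector_space_pair s2 B2 s2 B2 by unfold_locales
  let ?P = "{w\<in>S. \<forall>u\<in>X. bf u w = 0}"
  have P: "vs2.subspace ?P" by (rule subspace_orthogonal[OF subspace_S])
  have "?P \<subseteq> S" by blast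
  obtain C where C: "vs2.subspace C" "C \<subseteq> S" "?P \<inter> C = {0}" "S = {x + y | x y. x \<in> ?P \<and> y \<in> C}"
    by (rule vs2.complement_exists[OF P subspace_S \<open>?P \<subseteq> S\<close>])
  have dS: "vs2.dim S = vs2.dim ?P + vs2.dim C"
    by (rule vs2.dim_complement[OF P C(1,3,4)])
  have "vs2.dim X \<le> vs2.dim {w\<in>X. \<forall>u\<in>C. bf u w = 0} + vs2.dim C"
    by (rule WW.dim_le_dim_pairing_kernel[OF bf_lin bf_lin2 X(1)])
  then have "vs2.dim {w\<in>X. \<forall>u\<in>C. bf u w = 0} \<noteq> 0" using less dS by linarith
  then have "\<not> {w\<in>X. \<forall>u\<in>C. bf u w = 0} \<subseteq> {0}" unfolding vs2.dim_eq_0 .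
  then obtain w where w: "w \<in> X" "\<And>u. u \<in> C \<Longrightarrow> bf u w = 0" "w \<noteq> 0" by auto
  have "bf w (\<alpha> x y) = 0" for x y
  proof -
    have "\<alpha> x y \<in> S" by simp
    then obtain u v where uv: "\<alpha> x y = u + v" "u \<in> ?P" "v \<in> C" using C(4) by blast
    then have "bf w u = 0" "bf w v = 0" using w bf_sym by auto
    then show ?thesis unfolding uv(1) by (simp add: bf_simps)
  qed
  then show False using nondeg[of w, folded S_def] w X(2) by blast
qed

lemma dim_isotropic_le:
  assumes X: "vs2.subspace X" "X \<subseteq> S" and iso: "\<And>u w. u \<in> X \<Longrightarrow> w \<in> X \<Longrightarrow> bf u w = 0"
  shows "2 * vs2.dim X \<le> vs2.dim S"
proof -
  have "X \<subseteq> {w\<in>S. \<forall>u\<in>X. bf u w = 0}" using X iso by blast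
  from vs2.dim_subset[OF this] dim_orthogonal_le[OF X] show ?thesis by linarith
qed

text \<open>Along a line \<open>bf u (\<alpha> y y)\<close> is a quadratic polynomial in the
  parameter with nonzero constant term.\<close>

lemma line_open_square:
  "line_open s1 (\<lambda>y. \<exists>u\<in>T. bf u (\<alpha> y y) \<noteq> 0)"
  unfolding line_open_def
proof (intro allI impI)
  fix a b assume "\<exists>u\<in>T. bf u (\<alpha> a a) \<noteq> 0"
  then obtain u where u: "u \<in> T" "bf u (\<alpha> a a) \<noteq> 0" by blast
  let ?q = "[:bf u (\<alpha> a a), 2 * bf u (\<alpha> a b), bf u (\<alpha> b b):]"
  have "bf u (\<alpha> (a + s1 t b) (a + s1 t b)) = poly ?q t" for t
    by (simp add: alpha_simps bf_simps sym[of b a] algebra_simps)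
  then have "{t. \<not> (\<exists>u\<in>T. bf u (\<alpha> (a + s1 t b) (a + s1 t b)) \<noteq> 0)} \<subseteq> {t. poly ?q t = 0}"
    using u(1) by auto
  moreover have "finite {t. poly ?q t = 0}" using u(2) by (intro poly_roots_finite) simp
  ultimately show "finite {t. \<not> (\<exists>u\<in>T. bf u (\<alpha> (a + s1 t b) (a + s1 t b)) \<noteq> 0)}"
    by (rule finite_subset)
qed


text \<open>An element of \<open>annih y T\<close> is a quadratic form that kills \<open>y\<close> and, \<open>y\<close> being regular, also the
  vectors \<open>b\<close> for which \<open>\<alpha> y b\<close> is orthogonal to \<open>T\<close>; these span a space of small codimension.\<close>

lemma dim_annih_le:
  assumes T: "vs2.subspace T" "T \<subseteq> S"
    and y: "regular (\<lambda>y b. p (\<alpha> y b)) y" and sq: "\<exists>u\<in>T. bf u (\<alpha> y y) \<noteq> 0"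
    and p: "Vector_Spaces.linear s2 s2 p" "\<And>w. (\<forall>u\<in>T. bf u (w - p w) = 0)"
      "\<And>w. (\<forall>u\<in>T. bf u w = 0) \<Longrightarrow> p w = 0"
  shows "vs2.dim T \<le> Suc (vs2.dim (annih y T)) \<Longrightarrow> vs2.dim (annih y T) = 0"
    and "vs2.dim T \<le> Suc (Suc (vs2.dim (annih y T))) \<Longrightarrow> vs2.dim (annih y T) \<le> 1"
proof -
  interpret p: Vector_Spaces.linear s2 s2 p by (rule p)
  let ?A = "annih y T"
  have bil': "bilinear_map (\<lambda>y b. p (\<alpha> y b))"
    unfolding bilinear_map_def
    using bil Vector_Spaces.linear_compose[OF _ p(1), of s1] by (auto simp: bilinear_map_def o_def)
  have kerp: "bf u w = 0" if "p w = 0" "u \<in> T" for u w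
    using p(2)[of w] that by simp
  \<comment> \<open>The kernel of \<open>\<alpha> y\<close> modulo the orthogonal space of
    \<open>T\<close>, which is the kernel of \<open>p\<close>. By regularity
    \<open>\<alpha> z b\<close> agrees with some \<open>\<alpha> y c\<close> modulo that space for
    \<open>b\<close> in \<open>N\<close>, and \<open>?A\<close> is orthogonal to the values
    \<open>\<alpha> y c\<close>.\<close>
  define N where "N = {b. \<forall>u\<in>T. bf u (\<alpha> y b) = 0}"
  have N: "vs1.subspace N"
    unfolding N_def by (rule vs1.subspaceI) (auto simp: alpha_simps bf_simps)
  have A_N: "bf u (\<alpha> z b) = 0" if "u \<in> ?A" "b \<in> N" for u z b
  proof -
    have "p (\<alpha> y b) = 0" using p(3) that(2) by (simp add: N_def)
    from regular_kernel_image[OF bil' y this, of z]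
    obtain c where "p (\<alpha> z b) = p (\<alpha> y c)" by blast
    then have "p (\<alpha> z b - \<alpha> y c) = 0" by (simp add: p.diff)
    moreover have "u \<in> T" "bf u (\<alpha> y c) = 0" using that(1) by (auto simp: annih_def)
    ultimately have "bf u (\<alpha> z b - \<alpha> y c) = 0" using kerp by blast
    then show ?thesis using \<open>bf u (\<alpha> y c) = 0\<close> by (simp add: bf_simps)
  qed
  have A_y: "bf u (\<alpha> z y) = 0" if "u \<in> ?A" for u z
    using that by (simp add: annih_def sym[of z y])
  have A_M: "bf u (\<alpha> z b) = 0" if "u \<in> ?A" "b \<in> vs1.span (insert y N)" for u z b
    using that(2)
  proof (induction rule: vs1.span_induct_alt)
    case base show ?case by (simp add: alpha_simps bf_simps)
  next
    case (step c x b)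
    then show ?case using A_N[OF that(1)] A_y[OF that(1)] by (auto simp: alpha_simps bf_simps)
  qed
  \<comment> \<open>The codimension of \<open>N\<close> is at most \<open>dim T - dim ?A\<close>.
    Since \<open>y\<close> is outside \<open>N\<close>, adjoining it gains one dimension: this is
    the origin of the \<open>Suc\<close> in both hypotheses.\<close>
  have "y \<notin> N" using sq by (auto simp: N_def)
  then have dM: "vs1.dim (insert y N) = Suc (vs1.dim N)"
    unfolding vs1.dim_insert vs1.span_eq_iff[THEN iffD2, OF N] by simp
  obtain C where C: "vs2.subspace C" "C \<subseteq> T" "?A \<inter> C = {0}" "T = {x + y | x y. x \<in> ?A \<and> y \<in> C}"
    by (rule vs2.complement_exists[OF subspace_annih[OF T(1)] T(1) annih_subset])
  have dT: "vs2.dim T = vs2.dim ?A + vs2.dim C"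
    by (rule vs2.dim_complement[OF subspace_annih[OF T(1)] C(1,3,4)])
  have "{b\<in>UNIV. \<forall>u\<in>C. bf u (\<alpha> y b) = 0} \<subseteq> N"
  proof
    fix b assume b: "b \<in> {b\<in>UNIV. \<forall>u\<in>C. bf u (\<alpha> y b) = 0}"
    have "bf u (\<alpha> y b) = 0" if "u \<in> T" for u
    proof -
      obtain v w where vw: "u = v + w" "v \<in> ?A" "w \<in> C" using C(4) \<open>u \<in> T\<close> by blast
      have "bf v (\<alpha> y b) = 0" "bf w (\<alpha> y b) = 0" using vw b by (auto simp: annih_def)
      then show ?thesis unfolding vw(1) by (simp add: bf_simps)
    qed
    then show "b \<in> N" by (simp add: N_def)
  qed
  then have "vs1.dim {b\<in>UNIV. \<forall>u\<in>C. bf u (\<alpha> y b) = 0} \<le> vs1.dim N" by (rule vs1.dim_subset)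
  moreover have "vs1.dim UNIV \<le> vs1.dim {b\<in>UNIV. \<forall>u\<in>C. bf u (\<alpha> y b) = 0} + vs2.dim C"
  proof (rule dim_le_dim_pairing_kernel)
    show "Vector_Spaces.linear s1 (*) (\<lambda>b. bf u (\<alpha> y b))" for u
      using Vector_Spaces.linear_compose[OF alpha_lin bf_lin] by (simp add: o_def)
  qed (use bf_lin2 in auto)
  ultimately have n_le: "vs1.dim UNIV + 1 \<le> vs1.dim (insert y N) + vs2.dim C" using dM by linarith
  have A0: "u = 0" if "u \<in> ?A" "\<And>a b. bf u (\<alpha> a b) = 0" for u
    using nondeg[of u, folded S_def] that T annih_subset by blast
  {
    assume "vs2.dim T \<le> Suc (vs2.dim ?A)"
    then have "vs1.dim (insert y N) \<ge> vs1.dim UNIV" using dT n_le by linarith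
    then have "vs1.dim (insert y N) = vs1.dimension"
      using vs1.dim_subset_UNIV[of "insert y N"] vs1.dim_UNIV vs1.dimension_def by simp
    then have "vs1.span (insert y N) = UNIV" using vs1.dim_eq_full by blast
    then have "?A \<subseteq> {0}" using A0 A_M by blast
    then show "vs2.dim ?A = 0" unfolding vs2.dim_eq_0 .
  } note 1 = this
  \<comment> \<open>The forms in \<open>?A\<close> now vanish against a space of codimension at most
    one. If the codimension is one, a form is determined by its value on
    \<open>\<alpha> v v\<close>, so \<open>?A\<close> embeds into the field.\<close>
  assume le2: "vs2.dim T \<le> Suc (Suc (vs2.dim ?A))"
  show "vs2.dim ?A \<le> 1"
  proof (cases "vs1.span (insert y N) = UNIV")
    case True
    then have "?A \<subseteq> {0}" using A0 A_M by blast
    then have "vs2.dim ?A = 0" unfolding vs2.dim_eq_0 .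
    then show ?thesis by linarith
  next
    case False
    then obtain v where v: "v \<notin> vs1.span (insert y N)" by blast
    then have "vs1.dim (insert v (insert y N)) = Suc (vs1.dim (insert y N))"
      unfolding vs1.dim_insert[of v] by (simp only: if_False add_0_right Suc_eq_plus1)
    then have "vs1.dim (insert v (insert y N)) \<ge> vs1.dim UNIV" using dT n_le le2 by linarith
    then have "vs1.dim (insert v (insert y N)) = vs1.dimension"
      using vs1.dim_subset_UNIV[of "insert v (insert y N)"] vs1.dim_UNIV vs1.dimension_def by simp
    then have full: "vs1.span (insert v (insert y N)) = UNIV" using vs1.dim_eq_full by blast
    interpret WF: finite_dimensional_vector_space_pair s2 B2 "(*) :: 'a \<Rightarrow> 'a \<Rightarrow> 'a" "{1}"
      by (rule vs2.finite_dimensional_pair_scalars)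
    have "vs2.dim ?A \<le> vector_space_over_itself.dim (UNIV :: 'a set)"
    proof (rule WF.dim_le_of_injective[where f = "\<lambda>u. bf u (\<alpha> v v)"])
      show "Vector_Spaces.linear s2 (*) (\<lambda>u. bf u (\<alpha> v v))" by (rule bf_lin2)
      show "vs2.subspace ?A" by (rule subspace_annih[OF T(1)])
      fix u assume u: "u \<in> ?A" "bf u (\<alpha> v v) = 0"
      have "bf u (\<alpha> a b) = 0" for a b
      proof -
        obtain k l where kl: "a - s1 k v \<in> vs1.span (insert y N)" "b - s1 l v \<in> vs1.span (insert y N)"
          using full vs1.span_breakdown_eq by (metis UNIV_I)
        define a' b' where "a' = a - s1 k v" and "b' = b - s1 l v"
        have ab: "a = a' + s1 k v" "b = b' + s1 l v" by (simp_all add: a'_def b'_def)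
        have "bf u (\<alpha> z b') = 0" "bf u (\<alpha> z a') = 0" for z
          using A_M[OF u(1)] kl by (simp_all add: a'_def b'_def)
        moreover then have "bf u (\<alpha> a' v) = 0" by (simp add: sym[of a' v])
        ultimately show ?thesis unfolding ab using u(2) by (simp add: alpha_simps bf_simps)
      qed
      then show "u = 0" using A0[OF u(1)] by blast
    qed auto
    then show ?thesis by (simp add: vector_space_over_itself.dimension_def)
  qed
qed

text \<open>The consequences of \<open>dim_annih_le\<close> for d = dim T and a = dim (annih y T),
  where d \<le> a + 1 forces a = 0 and d \<le> a + 2 forces a \<le> 1: for d \<le> 2 a positive a is
  excluded, for d \<le> 4 an a of 2 or more, for d \<le> 5 an a of 3 or more.\<close>

definition good :: "'c set \<Rightarrow> 'b \<Rightarrow> bool" where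
  "good T y \<longleftrightarrow> (vs2.dim T \<le> 2 \<longrightarrow> vs2.dim (annih y T) = 0) \<and>
     (vs2.dim T \<le> 4 \<longrightarrow> vs2.dim (annih y T) \<le> 1) \<and>
     (vs2.dim T \<le> 5 \<longrightarrow> vs2.dim (annih y T) \<le> 2)"

text \<open>If every element of \<open>T\<close> vanishes on all squares
  \<open>\<alpha> y y\<close>, polarisation and nondegeneracy give \<open>T = 0\<close> and every
  vector is good. Otherwise a nonzero square and regularity modulo the orthogonal space of
  \<open>T\<close> are both generic.\<close>

lemma generic_good:
  assumes T: "vs2.subspace T" "T \<subseteq> S"
  shows "generic s1 (good T)"
proof (cases "\<exists>y. \<exists>u\<in>T. bf u (\<alpha> y y) \<noteq> 0")
  case False
  have "u = 0" if u: "u \<in> T" for u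
  proof -
    have "bf u (\<alpha> a b) = 0" for a b
    proof -
      have "bf u (\<alpha> (a + b) (a + b)) = bf u (\<alpha> a a) + bf u (\<alpha> b b) + 2 * bf u (\<alpha> a b)"
        by (simp add: alpha_simps bf_simps sym[of b a])
      moreover have "bf u (\<alpha> z z) = 0" for z using False u by blast
      ultimately show ?thesis by simp
    qed
    then show ?thesis using nondeg[of u, folded S_def] u T(2) by blast
  qed
  then have "annih y T \<subseteq> {0}" for y using annih_subset by blast
  then have "vs2.dim (annih y T) = 0" for y unfolding vs2.dim_eq_0 .
  then have "good T y" for y unfolding good_def by (simp only:) linarith
  then show ?thesis unfolding generic_def by (intro exI[of _ "\<lambda>_. True"]) (simp add: line_open_def)
next
  case True
  have sub: "vs2.subspace {w. \<forall>u\<in>T. bf u w = 0}"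
    using subspace_orthogonal[OF vs2.subspace_UNIV, of T] by simp
  obtain p where p: "Vector_Spaces.linear s2 s2 p" "\<And>w. w - p w \<in> {w. \<forall>u\<in>T. bf u w = 0}"
    "\<And>w. w \<in> {w. \<forall>u\<in>T. bf u w = 0} \<Longrightarrow> p w = 0"
    by (rule vs2.projection_exists[OF sub]) (rule that)
  have bil': "bilinear_map (\<lambda>y b. p (\<alpha> y b))"
    unfolding bilinear_map_def
    using bil Vector_Spaces.linear_compose[OF _ p(1), of s1] by (auto simp: bilinear_map_def o_def)
  have "generic s1 (\<lambda>y. \<exists>u\<in>T. bf u (\<alpha> y y) \<noteq> 0)"
    unfolding generic_def using line_open_square True
    by (intro exI[of _ "\<lambda>y. \<exists>u\<in>T. bf u (\<alpha> y y) \<noteq> 0"]) blast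
  from generic_conj[OF vs1.vector_space_axioms generic_regular[OF bil'] this]
  show ?thesis
  proof (rule generic_mono)
    fix y assume "regular (\<lambda>y b. p (\<alpha> y b)) y \<and> (\<exists>u\<in>T. bf u (\<alpha> y y) \<noteq> 0)"
    then have y: "regular (\<lambda>y b. p (\<alpha> y b)) y" "\<exists>u\<in>T. bf u (\<alpha> y y) \<noteq> 0" by blast+
    have p': "(\<forall>u\<in>T. bf u (w - p w) = 0)" "(\<forall>u\<in>T. bf u w = 0) \<Longrightarrow> p w = 0" for w
      using p(2,3) by blast+
    note D = dim_annih_le[OF T y p(1) p']
    show "good T y" unfolding good_def using D by linarith
  qed
qed


section \<open>Isotropic spaces attached to regular elements\<close>

definition ker :: "'b \<Rightarrow> 'b set" where
  "ker x = {k. \<alpha> x k = 0}"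

text \<open>In the language of graded algebras: the degree two part of the ideal generated by the
  linear forms that \<open>x\<close> annihilates.\<close>

definition T :: "'b \<Rightarrow> 'c set" where
  "T x = vs2.span (\<Union>v. \<alpha> v ` ker x)"

lemma subspace_T: "vs2.subspace (T x)"
  unfolding T_def by (rule vs2.subspace_span)

lemma subspace_ker: "vs1.subspace (ker x)"
  unfolding ker_def by (rule vs1.subspaceI) (auto simp: alpha_simps)

lemma T_subset_S: "T x \<subseteq> S"
  unfolding T_def by (rule vs2.span_minimal[OF _ subspace_S]) auto

lemma alpha_in_T: "k \<in> ker x \<Longrightarrow> \<alpha> v k \<in> T x"
  unfolding T_def by (rule vs2.span_base) blast

text \<open>Flatness moves \<open>x\<close> next to \<open>k\<close>: the product of
  \<open>\<alpha> x b\<close> with \<open>\<alpha> v k\<close> equals that of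
  \<open>\<alpha> v b\<close> with \<open>\<alpha> x k\<close>, which is zero.\<close>

lemma T_orthogonal: assumes "u \<in> T x" shows "bf u (\<alpha> x b) = 0"
proof -
  have "bf (\<alpha> x b) u = 0"
  proof (rule bf_span_zero)
    fix w assume "w \<in> (\<Union>v. \<alpha> v ` ker x)"
    then obtain v k where "w = \<alpha> v k" "\<alpha> x k = 0" by (auto simp: ker_def)
    then show "bf (\<alpha> x b) w = 0" using flat[of x b v k] by (simp add: bf_sym bf_simps)
  qed (use assms T_def in simp)
  then show ?thesis by (simp add: bf_sym)
qed

text \<open>An instance of Moore's lemma. With \<open>T_orthogonal\<close> it makes
  \<open>T x\<close> isotropic for regular \<open>x\<close>.\<close>

lemma T_subset_range: assumes "regular \<alpha> x" shows "T x \<subseteq> range (\<alpha> x)"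
proof -
  interpret l: Vector_Spaces.linear s1 s2 "\<alpha> x" by (rule alpha_lin)
  have "vs2.subspace (range (\<alpha> x))" using l.subspace_image[OF vs1.subspace_UNIV] .
  then show ?thesis unfolding T_def
    using regular_kernel_image[OF bil assms] by (intro vs2.span_minimal) (auto simp: ker_def)
qed

definition null :: "'b set" where
  "null = {a. \<forall>b. \<alpha> a b = 0}"

lemma dim_ker: "vs1.dim UNIV = vs2.dim (range (\<alpha> x)) + vs1.dim (ker x)"
  using rank_nullity[OF alpha_lin vs1.subspace_UNIV, of x] by (simp add: ker_def)

lemma dim_ker_regular:
  assumes "regular \<alpha> x" "regular \<alpha> y"
  shows "vs1.dim (ker x) = vs1.dim (ker y)"
proof -
  have "vs2.dim (range (\<alpha> x)) = vs2.dim (range (\<alpha> y))"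
    using assms unfolding regular_def by (meson le_antisym)
  then show ?thesis using dim_ker[of x] dim_ker[of y] by linarith
qed

lemma dim_add_isotropic_le:
  assumes E: "vs2.subspace E" "E \<subseteq> S" "\<And>u w. u \<in> E \<Longrightarrow> w \<in> E \<Longrightarrow> bf u w = 0"
    and F: "vs2.subspace F" "F \<subseteq> S" "\<And>u w. u \<in> F \<Longrightarrow> w \<in> F \<Longrightarrow> bf u w = 0"
    and EF: "\<And>u w. u \<in> E \<Longrightarrow> w \<in> F \<Longrightarrow> bf u w = 0"
  shows "2 * (vs2.dim E + vs2.dim F) \<le> vs2.dim S + 2 * vs2.dim (E \<inter> F)"
proof -
  have 1: "2 * vs2.dim {u + w | u w. u \<in> E \<and> w \<in> F} \<le> vs2.dim S"
  proof (rule dim_isotropic_le)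
    show "vs2.subspace {u + w | u w. u \<in> E \<and> w \<in> F}" by (rule vs2.subspace_sums[OF E(1) F(1)])
    show "{u + w | u w. u \<in> E \<and> w \<in> F} \<subseteq> S"
      using E(2) F(2) vs2.subspace_add[OF subspace_S] by blast
    fix u w assume "u \<in> {u + w | u w. u \<in> E \<and> w \<in> F}" "w \<in> {u + w | u w. u \<in> E \<and> w \<in> F}"
    then obtain a b c d where *: "u = a + b" "w = c + d" "a \<in> E" "b \<in> F" "c \<in> E" "d \<in> F" by auto
    then have "bf a c = 0" "bf a d = 0" "bf b d = 0" "bf b c = 0"
      using E(3) F(3) EF bf_sym by metis+
    then show "bf u w = 0" unfolding * by (simp add: bf_simps)
  qed
  have "2 * a \<le> s \<Longrightarrow> a + b = c \<Longrightarrow> 2 * c \<le> s + 2 * b" for a b c s :: nat by linarith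
  from this[OF 1 vs2.dim_sums_Int[OF E(1) F(1)]]
  show ?thesis .
qed

text \<open>In algebraic terms: a graded Gorenstein algebra with Hilbert function \<open>(1, n, m, n, 1)\<close> and
  \<open>m \<le> 11\<close> has \<open>n \<le> m\<close>. Stanley's \<open>(1, 13, 12, 13, 1)\<close> shows that 11 is optimal. Otherwise the
  isotropic spaces \<open>T x\<close> for two or three generic points \<open>x\<close> add up to an isotropic space of
  dimension at least 6.\<close>

theorem dim_le_dim_span_plus_nullity:
  assumes "vs2.dim S \<le> 11"
  shows "vs1.dim UNIV \<le> vs2.dim S + vs1.dim null"
proof (rule ccontr)
  assume big: "\<not> ?thesis"
  have T_iso: "bf u w = 0" if "regular \<alpha> x" "u \<in> T x" "w \<in> T x" for x u w
    using T_orthogonal[OF that(2)] T_subset_range[OF that(1)] that(3) by blast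
  have T_le5: "vs2.dim (T x) \<le> 5" if "regular \<alpha> x" for x
    using dim_isotropic_le[OF subspace_T[of x] T_subset_S T_iso[OF that]] assms by linarith
  \<comment> \<open>\<open>T x\<close> is orthogonal to the image of \<open>\<alpha> x\<close>, so
    the rank is at most \<open>dim S - dim (T x)\<close>. The final 1 is the strictness of the
    negated claim.\<close>
  have ker_ge: "vs1.dim (ker x) \<ge> vs2.dim (T x) + vs1.dim null + 1" for x
  proof -
    interpret l: Vector_Spaces.linear s1 s2 "\<alpha> x" by (rule alpha_lin)
    have sub: "vs2.subspace (range (\<alpha> x))" using l.subspace_image[OF vs1.subspace_UNIV] .
    have "T x \<subseteq> {w\<in>S. \<forall>u\<in>range (\<alpha> x). bf u w = 0}"
    proof
      fix w assume w: "w \<in> T x"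
      have "bf (\<alpha> x b) w = 0" for b using T_orthogonal[OF w, of b] by (simp add: bf_sym)
      then show "w \<in> {w\<in>S. \<forall>u\<in>range (\<alpha> x). bf u w = 0}" using w T_subset_S by auto
    qed
    from vs2.dim_subset[OF this] dim_orthogonal_le[OF sub range_alpha_S] dim_ker[of x] big
    show ?thesis by linarith
  qed
  have key: "vs2.dim (T x) = 3 \<and> vs2.dim (T x \<inter> T y) \<le> 1 \<and> (\<forall>u\<in>T x. \<forall>w\<in>T y. bf u w = 0)"
    if x: "regular \<alpha> x" and y: "regular \<alpha> y" "good (T x) y" for x y
  proof -
    let ?A = "annih y (T x)" and ?K = "ker x \<inter> ker y"
    have K: "vs1.subspace ?K" by (intro vs1.subspace_inter subspace_ker)
    have K_A: "\<alpha> v k \<in> ?A" if "k \<in> ?K" for v k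
    proof -
      have "\<alpha> v k \<in> T x" "\<alpha> v k \<in> T y" using that alpha_in_T by auto
      then show ?thesis using T_orthogonal by (auto simp: annih_def)
    qed
    have A: "vs2.subspace ?A" "?A \<subseteq> S"
      using subspace_annih[OF subspace_T] annih_subset T_subset_S by blast+
    have A2: "vs2.dim ?A \<le> 2" using y(2) T_le5[OF x] unfolding good_def by linarith
    \<comment> \<open>A vector \<open>k\<close> of \<open>?K\<close> with
      \<open>\<alpha> z k = 0\<close> has all \<open>\<alpha> v k\<close> in \<open>T z\<close> and
      in \<open>?A\<close>, hence in \<open>annih z ?A\<close>, which is zero for this
      \<open>z\<close>; so \<open>k\<close> is in \<open>null\<close>. It remains to bound the image
      of \<open>?K\<close> under \<open>\<alpha> z\<close>, which lies in \<open>?A\<close>.\<close>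
    obtain z where "good ?A z" using generic_ex[OF generic_good[OF A]] by blast
    then have "vs2.dim (annih z ?A) = 0" using A2 unfolding good_def by linarith
    then have z: "annih z ?A \<subseteq> {0}" unfolding vs2.dim_eq_0 .
    have K_le: "vs1.dim ?K \<le> vs2.dim ?A + vs1.dim null"
    proof -
      have "{k\<in>?K. \<alpha> z k = 0} \<subseteq> null"
      proof
        fix k assume k: "k \<in> {k\<in>?K. \<alpha> z k = 0}"
        have "\<alpha> v k = 0" for v
        proof -
          have "\<alpha> v k \<in> T z" using k by (intro alpha_in_T) (simp add: ker_def)
          then have "\<alpha> v k \<in> annih z ?A" using K_A k T_orthogonal by (auto simp: annih_def)
          then show ?thesis using z by blast
        qed
        then show "k \<in> null" by (simp add: null_def sym[of k])
      qed
      then have "vs1.dim {k\<in>?K. \<alpha> z k = 0} \<le> vs1.dim null" by (rule vs1.dim_subset)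
      moreover have "\<alpha> z ` ?K \<subseteq> ?A" using K_A by blast
      then have "vs2.dim (\<alpha> z ` ?K) \<le> vs2.dim ?A" by (rule vs2.dim_subset)
      ultimately show ?thesis using rank_nullity[OF alpha_lin K, of z] by linarith
    qed
    \<comment> \<open>\<open>?E\<close> lies in \<open>T x\<close> and in the image of
      \<open>\<alpha> y\<close>, so it is orthogonal to \<open>T y\<close>; \<open>?F\<close> is its
      mirror image. Their dimensions agree because regular elements have kernels of equal
      dimension.\<close>
    let ?E = "\<alpha> y ` ker x" and ?F = "\<alpha> x ` ker y"
    have dE: "vs1.dim (ker x) = vs2.dim ?E + vs1.dim ?K"
      using rank_nullity[OF alpha_lin[of y] subspace_ker[of x]] by (simp add: ker_def Int_def)
    have dF: "vs1.dim (ker y) = vs2.dim ?F + vs1.dim ?K"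
      using rank_nullity[OF alpha_lin[of x] subspace_ker[of y]] by (simp add: ker_def Int_def conj_commute)
    have E: "vs2.subspace ?E" "?E \<subseteq> T x" and F: "vs2.subspace ?F" "?F \<subseteq> T y"
      using alpha_in_T linear_subspace_image[OF alpha_lin subspace_ker] by blast+
    have EF: "bf u w = 0" if "u \<in> ?E" "w \<in> T y" for u w
      using T_orthogonal[OF that(2)] that(1) bf_sym by auto
    have "2 * (vs2.dim ?E + vs2.dim ?F) \<le> vs2.dim S + 2 * vs2.dim (?E \<inter> ?F)"
    proof (rule dim_add_isotropic_le[OF E(1) _ _ F(1)])
      show "?E \<subseteq> S" "?F \<subseteq> S" by auto
      show "bf u w = 0" if "u \<in> ?E" "w \<in> ?E" for u w using T_iso[OF x] E that by blast
      show "bf u w = 0" if "u \<in> ?F" "w \<in> ?F" for u w using T_iso[OF y(1)] F that by blast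
      show "bf u w = 0" if "u \<in> ?E" "w \<in> ?F" for u w using EF F that by blast
    qed
    moreover have TA: "T x \<inter> T y \<subseteq> ?A" using T_orthogonal by (auto simp: annih_def)
    then have "?E \<inter> ?F \<subseteq> ?A" using E F by blast
    then have "vs2.dim (?E \<inter> ?F) \<le> vs2.dim ?A" by (rule vs2.dim_subset)
    moreover have "vs2.dim ?E = vs2.dim ?F" using dE dF dim_ker_regular[OF x y(1)] by linarith
    moreover have "vs2.dim ?E + vs2.dim ?A \<ge> vs2.dim (T x) + 1"
      using dE K_le ker_ge[of x] by linarith
    moreover have ET: "vs2.dim ?E \<le> vs2.dim (T x)" by (rule vs2.dim_subset[OF E(2)])
    \<comment> \<open>The inequalities give 4 e \<le> 11 + 2 a and e \<ge> t + 1 - a. For t \<le> 2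
      this says e > t; t = 4 and t = 5 give e \<ge> 4, so 16 \<le> 13 and 16 \<le> 15. With 12 in
      place of 11 the case t = 5, e = 4, a = 2 would survive.\<close>
    moreover have "t = 3 \<and> e = 3 \<and> a \<le> 1"
      if "2 * (e + f) \<le> s + 2 * i" "i \<le> a" "e = f" "t + 1 \<le> e + a" "e \<le> t" "s \<le> 11" "t \<le> 5"
        "(t \<le> 2 \<longrightarrow> a = 0) \<and> (t \<le> 4 \<longrightarrow> a \<le> 1) \<and> (t \<le> 5 \<longrightarrow> a \<le> 2)" for t e a f s i :: nat
      using that by (cases "t \<le> 2"; cases "t \<le> 3"; cases "t \<le> 4") auto
    ultimately have d: "vs2.dim (T x) = 3 \<and> vs2.dim ?E = 3 \<and> vs2.dim ?A \<le> 1"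
      using y(2)[unfolded good_def] T_le5[OF x] assms by blast
    \<comment> \<open>Since \<open>?E\<close> fills \<open>T x\<close>, its orthogonality to
      \<open>T y\<close> becomes that of the whole of \<open>T x\<close>.\<close>
    then have "?E = T x" using vs2.subspace_dim_equal[OF E(1) subspace_T E(2)] by linarith
    then have "\<forall>u\<in>T x. \<forall>w\<in>T y. bf u w = 0" using EF by blast
    then show ?thesis using d vs2.dim_subset[OF TA] by linarith
  qed
  have gen: "generic s1 (\<lambda>y. regular \<alpha> y \<and> good T' y)" if "vs2.subspace T'" "T' \<subseteq> S" for T'
    by (rule generic_conj[OF vs1.vector_space_axioms generic_regular[OF bil] generic_good[OF that]])
  obtain x where x: "regular \<alpha> x" using regular_exists by blast
  obtain y where y: "regular \<alpha> y" "good (T x) y"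
    using generic_ex[OF gen[OF subspace_T T_subset_S]] by blast
  let ?E = "{u + w | u w. u \<in> T x \<and> w \<in> T y}"
  have E: "vs2.subspace ?E" by (rule vs2.subspace_sums[OF subspace_T subspace_T])
  have ES: "?E \<subseteq> S" using T_subset_S vs2.subspace_add[OF subspace_S] by blast
  obtain z where z: "regular \<alpha> z" "good (T x) z" "good (T y) z" "good ?E z"
    using generic_ex[OF generic_conj[OF vs1.vector_space_axioms gen[OF subspace_T T_subset_S, of x]
          generic_conj[OF vs1.vector_space_axioms gen[OF subspace_T T_subset_S, of y] gen[OF E ES]]]]
    by blast
  note xy = key[OF x y] and xz = key[OF x z(1,2)] and yz = key[OF y(1) z(1,3)]
  \<comment> \<open>\<open>key\<close> computes the dimension of \<open>T\<close> at its first
    argument only, so \<open>z\<close> needs a further partner.\<close>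
  obtain w where "regular \<alpha> w" "good (T z) w"
    using generic_ex[OF gen[OF subspace_T T_subset_S]] by blast
  then have Tz: "vs2.dim (T z) = 3" using key[OF z(1)] by blast
  have E_iso: "bf u w = 0" if uw: "u \<in> ?E" "w \<in> ?E" for u w
  proof -
    obtain a b c d where *: "u = a + b" "w = c + d" "a \<in> T x" "b \<in> T y" "c \<in> T x" "d \<in> T y"
      using uw by auto
    then have "bf a c = 0" "bf a d = 0" "bf b d = 0" "bf c b = 0"
      using T_iso x y(1) xy by blast+
    then show "bf u w = 0" unfolding * by (simp add: bf_simps bf_sym[of b c])
  qed
  have E5: "vs2.dim ?E \<ge> 5"
    using vs2.dim_sums_Int[OF subspace_T subspace_T, of x y] xy yz by linarith
  have "2 * (vs2.dim ?E + vs2.dim (T z)) \<le> vs2.dim S + 2 * vs2.dim (?E \<inter> T z)"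
  proof (rule dim_add_isotropic_le[OF E ES E_iso subspace_T T_subset_S T_iso[OF z(1)]])
    fix u w assume "u \<in> ?E" "w \<in> T z"
    then show "bf u w = 0" using xz yz by (auto simp: bf_simps)
  qed
  moreover have "vs2.dim (?E \<inter> T z) \<le> vs2.dim (annih z ?E)"
    using T_orthogonal by (intro vs2.dim_subset) (auto simp: annih_def)
  moreover have "2 * vs2.dim ?E \<le> vs2.dim S" by (rule dim_isotropic_le[OF E ES E_iso])
  \<comment> \<open>Here e = 5, and 2 (5 + 3) = 16 exceeds 11 + 2 * 2 = 15.\<close>
  moreover have False
    if "2 * (e + t) \<le> s + 2 * i" "i \<le> a" "2 * e \<le> s" "5 \<le> e" "t = 3" "s \<le> 11" "e \<le> 5 \<longrightarrow> a \<le> 2"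
    for e t s i a :: nat
    using that by (cases "e \<le> 5") auto
  ultimately show False using E5 Tz z(4)[unfolded good_def] assms by blast
qed

end

section \<open>The second fundamental form at a point\<close>

text \<open>Complex scalars act through \<open>J\<close> on the given real type, so that complex
  subspaces and real inner products live on the same sets and no complexified type is
  needed.\<close>

definition cscale :: "('a \<Rightarrow> 'a) \<Rightarrow> complex \<Rightarrow> 'a \<Rightarrow> 'a::real_vector" where
  "cscale J c v = Re c *\<^sub>R v + Im c *\<^sub>R J v"

lemma vector_space_cscale:
  assumes J: "linear J" "\<And>v. J (J v) = - v"
  shows "vector_space (cscale J)"
proof -
  interpret J: linear J by (rule J)
  show ?thesis
    by unfold_locales
      (simp_all add: cscale_def J.add J.scaleR J(2) algebra_simps)
qed

lemma finite_dimensional_cscale: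
  fixes J :: "'a::euclidean_space \<Rightarrow> 'a"
  assumes J: "linear J" "\<And>v. J (J v) = - v"
  obtains B where "finite_dimensional_vector_space (cscale J) B"
proof -
  interpret C: vector_space "cscale J" by (rule vector_space_cscale[OF J])
  obtain B where B: "B \<subseteq> (Basis :: 'a set)" "C.independent B" "Basis \<subseteq> C.span B"
    by (rule C.maximal_independent_subset)
  have "v \<in> C.span B" for v
  proof -
    have "(\<Sum>b\<in>Basis. cscale J (complex_of_real (v \<bullet> b)) b) \<in> C.span B"
      using B(3) by (intro C.span_sum C.span_scale) auto
    then show ?thesis by (simp add: cscale_def euclidean_representation)
  qed
  then have "finite_dimensional_vector_space (cscale J) B"
    using B by unfold_locales (auto intro: finite_subset[OF _ finite_Basis])
  then show ?thesis by (rule that)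
qed

lemma cscale_subspace_iff:
  assumes "linear J" "\<And>v. J (J v) = - v"
  shows "module.subspace (cscale J) X \<longleftrightarrow> subspace X \<and> J ` X \<subseteq> X"
proof -
  interpret C: vector_space "cscale J" by (rule vector_space_cscale[OF assms])
  show ?thesis
  proof
    assume X: "C.subspace X"
    have "subspace X"
    proof (rule subspaceI)
      show "0 \<in> X" by (rule C.subspace_0[OF X])
      show "x + y \<in> X" if "x \<in> X" "y \<in> X" for x y by (rule C.subspace_add[OF X that])
      show "c *\<^sub>R x \<in> X" if "x \<in> X" for c x
        using C.subspace_scale[OF X that, of "complex_of_real c"] by (simp add: cscale_def)
    qed
    moreover have "J x \<in> X" if "x \<in> X" for x
      using C.subspace_scale[OF X that, of \<i>] by (simp add: cscale_def)
    ultimately show "subspace X \<and> J ` X \<subseteq> X" by blast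
  next
    assume X: "subspace X \<and> J ` X \<subseteq> X"
    show "C.subspace X"
    proof (rule C.subspaceI)
      show "0 \<in> X" using X subspace_0 by blast
      show "x + y \<in> X" if "x \<in> X" "y \<in> X" for x y using X that subspace_add by blast
      show "cscale J c x \<in> X" if "x \<in> X" for c x
        unfolding cscale_def using X that by (intro subspace_add subspace_scale) auto
    qed
  qed
qed

lemma real_dim_eq_twice_complex_dim:
  fixes J :: "'a::euclidean_space \<Rightarrow> 'a"
  assumes J: "linear J" "\<And>v. J (J v) = - v" and X: "module.subspace (cscale J) X"
  shows "dim X = 2 * vector_space.dim (cscale J) X"
proof -
  interpret J: linear J by (rule J)
  obtain B where "finite_dimensional_vector_space (cscale J) B"
    by (rule finite_dimensional_cscale[OF J])
  then interpret C: finite_dimensional_vector_space "cscale J" B .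
  note sub_iff = cscale_subspace_iff[OF J]
  have *: "finite G \<Longrightarrow> C.independent G \<Longrightarrow> dim (C.span G) = 2 * card G" for G
  proof (induction G rule: finite_induct)
    case empty
    then show ?case by simp
  next
    case (insert a G)
    have a: "a \<notin> C.span G" and G: "C.independent G"
      using insert(2,4) C.independent_insert[of a G] by auto
    have sG: "subspace (C.span G)" "J ` C.span G \<subseteq> C.span G"
      using sub_iff C.subspace_span by blast+
    have spanG: "span (C.span G) = C.span G" using sG by (simp add: span_eq_iff)
    \<comment> \<open>\<open>J a - t a\<close> is the multiple of \<open>a\<close> by the nonzero
      complex number i - t. If it were in the complex span of \<open>G\<close>, so would be
      \<open>a\<close>.\<close>
    have Ja: "J a \<notin> span (insert a (C.span G))"
    proof
      assume "J a \<in> span (insert a (C.span G))"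
      then obtain t where "J a - t *\<^sub>R a \<in> span (C.span G)" using span_breakdown_eq by blast
      then have "cscale J (Complex (- t) 1) a \<in> C.span G" by (simp add: cscale_def spanG)
      then have "cscale J (1 / Complex (- t) 1) (cscale J (Complex (- t) 1) a) \<in> C.span G"
        by (rule C.span_scale)
      moreover have "Complex (- t) 1 \<noteq> 0" by (simp add: complex_eq_iff)
      ultimately show False using a by simp
    qed
    have "C.span (insert a G) = span (insert (J a) (insert a (C.span G)))"
    proof (intro equalityI subsetI)
      fix x assume "x \<in> C.span (insert a G)"
      then obtain c where "x - cscale J c a \<in> C.span G" using C.span_breakdown_eq by blast
      then have "(x - cscale J c a) + (Re c *\<^sub>R a + Im c *\<^sub>R J a) \<in> span (insert (J a) (insert a (C.span G)))"
        by (intro span_add span_mul) (auto intro: span_base)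
      then show "x \<in> span (insert (J a) (insert a (C.span G)))" by (simp add: cscale_def)
    next
      fix x assume x: "x \<in> span (insert (J a) (insert a (C.span G)))"
      have S: "subspace (C.span (insert a G))" "J ` C.span (insert a G) \<subseteq> C.span (insert a G)"
        using sub_iff C.subspace_span by blast+
      have "a \<in> C.span (insert a G)" by (simp add: C.span_base)
      moreover have "C.span G \<subseteq> C.span (insert a G)" by (rule C.span_mono) blast
      ultimately have "insert (J a) (insert a (C.span G)) \<subseteq> C.span (insert a G)" using S(2) by blast
      then show "x \<in> C.span (insert a G)" using x span_minimal[OF _ S(1)] by blast
    qed
    then have "dim (C.span (insert a G)) = dim (insert (J a) (insert a (C.span G)))" by simp
    also have "\<dots> = dim (C.span G) + 2"
      using a Ja by (simp add: dim_insert spanG)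
    finally show ?case using insert G by simp
  qed
  obtain G where G: "G \<subseteq> X" "C.independent G" "X \<subseteq> C.span G" "card G = C.dim X"
    by (rule C.basis_exists)
  have "C.span G = X" using G X C.span_minimal by blast
  then show ?thesis using *[OF C.finiteI_independent[OF G(2)] G(2)] G(4) by simp
qed

lemma even_DIM_of_complex_structure:
  fixes J :: "'a::euclidean_space \<Rightarrow> 'a"
  assumes "linear J" "\<And>v. J (J v) = - v"
  shows "even (DIM('a))"
proof -
  have "module.subspace (cscale J) UNIV" using cscale_subspace_iff[OF assms] by simp
  from real_dim_eq_twice_complex_dim[OF assms this] show ?thesis by simp
qed

text \<open>The data at one point. With the curvature expressed through \<alpha>,
  \<open>gauss\<close> says that the curvature operator of \<open>x\<close> and \<open>z\<close> is
  compatible with \<open>J\<close>. In \<open>nullity\<close> the intersection of the nullity space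
  with its image under \<open>J\<close> is written with inner products instead of
  projections.\<close>

locale pointwise_real_kaehler =
  fixes J :: "'e::euclidean_space \<Rightarrow> 'e" and \<alpha> :: "'e \<Rightarrow> 'e \<Rightarrow> 'v::euclidean_space"
    and N :: "'v set" and n p :: nat
  assumes J: "linear J" and JJ [simp]: "J (J x) = - x"
    and bilin: "bilinear \<alpha>" and sym: "\<alpha> x y = \<alpha> y x" and in_N: "\<alpha> x y \<in> N"
    and N: "subspace N" "dim N = p" "p \<le> 11" and n: "DIM('e) = 2 * n"
    and gauss: "\<alpha> x y \<bullet> \<alpha> z t - \<alpha> z y \<bullet> \<alpha> x t = \<alpha> x (J y) \<bullet> \<alpha> z (J t) - \<alpha> z (J y) \<bullet> \<alpha> x (J t)"
    and nullity: "\<And>U. subspace U \<Longrightarrow> U \<subseteq> N \<Longrightarrow> dim U \<ge> 1 \<Longrightarrow>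
      int (dim {x. \<forall>y. \<forall>u\<in>U. \<alpha> x y \<bullet> u = 0 \<and> \<alpha> (J x) y \<bullet> u = 0}) < 2 * (int n - int (dim U))"
begin

lemma linear_alpha: "linear (\<alpha> x)" "linear (\<lambda>x. \<alpha> x y)"
  using bilin by (auto simp: bilinear_def)

lemma alpha_simps [simp]:
  "\<alpha> (x + y) z = \<alpha> x z + \<alpha> y z" "\<alpha> (x - y) z = \<alpha> x z - \<alpha> y z" "\<alpha> (c *\<^sub>R x) z = c *\<^sub>R \<alpha> x z"
  "\<alpha> (- x) z = - \<alpha> x z" "\<alpha> 0 z = 0"
  "\<alpha> z (x + y) = \<alpha> z x + \<alpha> z y" "\<alpha> z (x - y) = \<alpha> z x - \<alpha> z y" "\<alpha> z (c *\<^sub>R x) = c *\<^sub>R \<alpha> z x"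
  "\<alpha> z (- x) = - \<alpha> z x" "\<alpha> z 0 = 0"
proof -
  interpret l: linear "\<lambda>x. \<alpha> x z" by (rule linear_alpha)
  interpret r: linear "\<alpha> z" by (rule linear_alpha)
  show "\<alpha> (x + y) z = \<alpha> x z + \<alpha> y z" "\<alpha> (x - y) z = \<alpha> x z - \<alpha> y z" "\<alpha> (c *\<^sub>R x) z = c *\<^sub>R \<alpha> x z"
    "\<alpha> (- x) z = - \<alpha> x z" "\<alpha> 0 z = 0"
    by (simp_all add: l.add l.diff l.scaleR l.neg l.zero)
  show "\<alpha> z (x + y) = \<alpha> z x + \<alpha> z y" "\<alpha> z (x - y) = \<alpha> z x - \<alpha> z y" "\<alpha> z (c *\<^sub>R x) = c *\<^sub>R \<alpha> z x"
    "\<alpha> z (- x) = - \<alpha> z x" "\<alpha> z 0 = 0"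
    by (simp_all add: r.add r.diff r.scaleR r.neg r.zero)
qed

lemma J_simps [simp]: "J (x + y) = J x + J y" "J (c *\<^sub>R x) = c *\<^sub>R J x" "J (- x) = - J x" "J 0 = 0"
  using J by (simp_all add: linear_add linear_scale linear_neg linear_0)

text \<open>Twice the (1,1)-part of \<alpha>. Since \<open>Q x y = P x (J y)\<close>, the equality
  \<open>\<alpha> (J x) y = \<alpha> x (J y)\<close> amounts to the vanishing of
  \<open>P\<close>.\<close>

definition P :: "'e \<Rightarrow> 'e \<Rightarrow> 'v" where "P x y = \<alpha> x y + \<alpha> (J x) (J y)"
definition Q :: "'e \<Rightarrow> 'e \<Rightarrow> 'v" where "Q x y = \<alpha> x (J y) - \<alpha> (J x) y"

lemma P_sym: "P y x = P x y"
  by (simp add: P_def sym)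

lemma Q_skew: "Q y x = - Q x y"
  by (simp add: Q_def sym)

text \<open>The pair \<open>(P, Q)\<close> is flat for the difference of the two inner products, a
  form of signature (p, p) on two copies of the normal space.\<close>

lemma PQ_flat: "P x y \<bullet> P z t - Q x y \<bullet> Q z t = P z y \<bullet> P x t - Q z y \<bullet> Q x t"
  using gauss[of x y z t] gauss[of "J x" "J y" "J z" "J t"] gauss[of x y "J z" "J t"]
    gauss[of "J x" "J y" z t]
  unfolding P_def Q_def by (simp add: inner_add_left inner_add_right inner_diff_left inner_diff_right)

text \<open>The mixed form, with \<alpha> in one factor, carries information on the kernel of
  \<open>(P, Q)\<close> over to \<alpha> itself.\<close>

lemma PQ_alpha_flat: "P x y \<bullet> \<alpha> z k - Q x y \<bullet> \<alpha> z (J k) = \<alpha> z y \<bullet> P x k - \<alpha> z (J y) \<bullet> Q x k"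
  using gauss[of x y z k] gauss[of "J x" "J y" z k]
  unfolding P_def Q_def by (simp add: inner_add_left inner_add_right inner_diff_left inner_diff_right)

text \<open>Flatness for an indefinite form yields isotropic values only. But \<open>P\<close> is
  symmetric and \<open>Q\<close> is skew, so the product of the value at (k, l) with the value at
  (l, k) is a sum of two squares; its vanishing kills both components.\<close>

lemma pluriharmonic: "\<alpha> (J x) y = \<alpha> x (J y)"
proof -
  let ?\<phi> = "\<lambda>x y. (P x y, Q x y)"
  interpret R: fd_pair_char_0 "scaleR :: real \<Rightarrow> 'e \<Rightarrow> 'e" Basis "scaleR :: real \<Rightarrow> 'v \<times> 'v \<Rightarrow> 'v \<times> 'v" Basis
    by unfold_locales
  have lin\<phi>: "linear (?\<phi> x)" "linear (\<lambda>x. ?\<phi> x y)" for x y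
    by (auto intro!: linearI simp: P_def Q_def algebra_simps)
  have bl: "R.bilinear_map ?\<phi>"
    unfolding R.bilinear_map_def using lin\<phi> by (simp add: linear_def)
  obtain X where X: "R.regular ?\<phi> X" using R.regular_exists by blast
  define K where "K = {k. P X k = 0 \<and> Q X k = 0}"
  \<comment> \<open>Moore's lemma writes the value at (l, k) as a value of \<open>?\<phi> X\<close>.
    Flatness then exchanges \<open>k\<close> and \<open>X\<close>, and \<open>X\<close> meets
    \<open>l\<close> in its kernel.\<close>
  have kk: "P k l = 0 \<and> Q k l = 0" if "k \<in> K" "l \<in> K" for k l
  proof -
    have "?\<phi> l k \<in> range (?\<phi> X)"
      by (rule R.regular_kernel_image[OF bl X]) (use that in \<open>simp add: K_def zero_prod_def\<close>)
    then obtain Y where Y: "P l k = P X Y" "Q l k = Q X Y" by auto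
    have "P k l \<bullet> P X Y - Q k l \<bullet> Q X Y = 0"
      using PQ_flat[of k l X Y] that by (simp add: K_def)
    moreover have "P X Y = P k l" "Q X Y = - Q k l"
      unfolding Y[symmetric] by (rule P_sym, rule Q_skew)
    ultimately have "P k l \<bullet> P k l + Q k l \<bullet> Q k l = 0" by simp
    then show ?thesis by (metis add_nonneg_eq_0_iff inner_ge_zero inner_eq_zero_iff)
  qed
  \<comment> \<open>Flatness turns the pairs (k, b), (b, k) into (b, b), (k, k), and the value at
    (k, k) is already zero.\<close>
  have Kall: "P b k = 0 \<and> Q b k = 0" if "k \<in> K" for b k
  proof -
    have "P k b \<bullet> P b k - Q k b \<bullet> Q b k = 0"
      using PQ_flat[of k b b k] kk[OF that that] by simp
    then have "P b k \<bullet> P b k + Q b k \<bullet> Q b k = 0" using P_sym[of k b] Q_skew[of k b] by simp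
    then show ?thesis by (metis add_nonneg_eq_0_iff inner_ge_zero inner_eq_zero_iff)
  qed
  define U where "U = span (\<Union>x. range (P x))"
  have PU: "P x y \<in> U" for x y unfolding U_def by (rule span_base) blast
  have QU: "Q x y \<in> U" for x y
    using PU[of x "J y"] by (simp add: P_def Q_def)
  have "(\<Union>x. range (P x)) \<subseteq> N"
    using in_N subspace_add[OF N(1)] by (auto simp: P_def)
  from subspace_span span_minimal[OF this N(1)]
  have U: "subspace U" "U \<subseteq> N" unfolding U_def .
  have Ksub: "K \<subseteq> {x. \<forall>y. \<forall>u\<in>U. \<alpha> x y \<bullet> u = 0 \<and> \<alpha> (J x) y \<bullet> u = 0}"
  proof -
    \<comment> \<open>Adding the mixed identities for (a, b) and (b, a) removes the \<open>Q\<close>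
      term by skewness and leaves twice the product with \<open>P a b\<close>.\<close>
    have perp: "\<alpha> k y \<bullet> u = 0" if k: "k \<in> K" and u: "u \<in> U" for k y u
    proof -
      have "\<alpha> k y \<bullet> P a b = 0" for a b
        using PQ_alpha_flat[of a b y k] PQ_alpha_flat[of b a y k] Kall[OF k] P_sym[of a b] Q_skew[of a b]
        by (simp add: sym[of k y] inner_commute)
      then have "orthogonal (\<alpha> k y) w" if "w \<in> (\<Union>x. range (P x))" for w
        using that by (auto simp: orthogonal_def)
      then show ?thesis using u orthogonal_to_span unfolding U_def orthogonal_def by blast
    qed
    moreover have "J k \<in> K" if "k \<in> K" for k
      using Kall[OF that, of X] by (simp add: K_def P_def Q_def neg_eq_iff_add_eq_0)
    ultimately show ?thesis by blast
  qed
  have pair: "finite_dimensional_vector_space_pair (scaleR :: real \<Rightarrow> 'e \<Rightarrow> 'e) Basis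
      (scaleR :: real \<Rightarrow> 'v \<times> 'v \<Rightarrow> 'v \<times> 'v) Basis"
    by unfold_locales
  have dimK: "2 * n = dim (range (?\<phi> X)) + dim K"
  proof -
    have "{u\<in>UNIV. ?\<phi> X u = 0} = K" by (auto simp: K_def zero_prod_def)
    then show ?thesis
      using finite_dimensional_vector_space_pair.rank_nullity[OF pair,
          of "?\<phi> X" UNIV, folded dim_raw_def subspace_raw_def linear_def] lin\<phi>(1)[of X] n by simp
  qed
  have "range (?\<phi> X) \<subseteq> U \<times> U" using PU QU by auto
  then have "dim (range (?\<phi> X)) \<le> dim (U \<times> U)" by (rule dim_subset)
  then have rk: "dim (range (?\<phi> X)) \<le> 2 * dim U" using dim_Times[OF U(1) U(1)] by simp
  \<comment> \<open>The values of \<open>?\<phi> X\<close> lie in \<open>U \<times> U\<close>, so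
    its kernel has dimension at least 2 n - 2 dim U, which contradicts \<open>nullity\<close> for
    \<open>U\<close>.\<close>
  have "\<not> dim U \<ge> 1"
  proof
    assume "dim U \<ge> 1"
    have False if "int a < 2 * (int n - int u)" "k \<le> a" "2 * n = r + k" "r \<le> 2 * u" for a k r u :: nat
      using that by presburger
    from this[OF nullity[OF U \<open>dim U \<ge> 1\<close>] dim_subset[OF Ksub] dimK rk] show False .
  qed
  then have "dim U = 0" by linarith
  then have "U \<subseteq> {0}" unfolding dim_eq_0 .
  then have "Q x y = 0" using QU by blast
  then show ?thesis by (simp add: Q_def)
qed


section \<open>The complexified second fundamental form\<close>

definition jW :: "'v \<times> 'v \<Rightarrow> 'v \<times> 'v" where "jW w = (- snd w, fst w)"

text \<open>The pair \<open>(a, b)\<close> stands for \<open>a + i b\<close> in the complexification of the ambient space, and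
  \<open>bf\<close> is the complex bilinear extension of the inner product.\<close>

definition bf :: "'v \<times> 'v \<Rightarrow> 'v \<times> 'v \<Rightarrow> complex" where
  "bf w z = Complex (fst w \<bullet> fst z - snd w \<bullet> snd z) (fst w \<bullet> snd z + snd w \<bullet> fst z)"

text \<open>The minus sign makes \<open>J\<close> act as multiplication by i, namely
  \<open>\<gamma> x (J y) = jW (\<gamma> x y)\<close>. Symmetry of \<open>\<gamma>\<close> is
  \<open>pluriharmonic\<close>.\<close>

definition \<gamma> :: "'e \<Rightarrow> 'e \<Rightarrow> 'v \<times> 'v" where "\<gamma> x y = (\<alpha> x y, - \<alpha> x (J y))"

lemma jW: "linear jW" "jW (jW w) = - w"
  by (auto intro!: linearI simp: jW_def prod_eq_iff)

lemma gamma_sym: "\<gamma> x y = \<gamma> y x"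
  using pluriharmonic[of y x] by (simp add: \<gamma>_def sym)

lemma gamma_linear: "Vector_Spaces.linear (cscale J) (cscale jW) (\<gamma> x)"
  unfolding Vector_Spaces.linear_iff
  by (auto intro!: vector_space_cscale J jW JJ simp: \<gamma>_def cscale_def jW_def)

lemma bf_sym: "bf w z = bf z w"
  by (simp add: bf_def inner_commute)

lemma bf_linear: "Vector_Spaces.linear (cscale jW) (*) (bf w)"
  unfolding Vector_Spaces.linear_iff
  by (auto intro!: vector_space_cscale jW vector_space_over_itself.vector_space_axioms
      simp: bf_def cscale_def jW_def complex_eq_iff inner_add_left inner_add_right inner_diff_right
        algebra_simps)

lemma gamma_flat: "bf (\<gamma> x y) (\<gamma> z t) = bf (\<gamma> z y) (\<gamma> x t)"
  using gauss[of x y z t] gauss[of x y z "J t"]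
  by (simp add: bf_def \<gamma>_def complex_eq_iff)

text \<open>This is the real part of the vanishing of \<open>bf\<close> on values of
  \<open>\<gamma>\<close>. The span of \<open>\<gamma>\<close> is shown to coincide with the radical
  of \<open>bf\<close> on it, by comparing dimensions with the nullity hypothesis.\<close>

lemma isotropic: "\<alpha> x y \<bullet> \<alpha> z t = \<alpha> x (J y) \<bullet> \<alpha> z (J t)"
proof -
  obtain B1 where B1: "finite_dimensional_vector_space (cscale J) B1"
    by (rule finite_dimensional_cscale[OF J JJ])
  obtain B2 where B2: "finite_dimensional_vector_space (cscale jW) B2"
    by (rule finite_dimensional_cscale[OF jW])
  from B1 B2 interpret C: finite_dimensional_vector_space_pair "cscale J" B1 "cscale jW" B2
    by (rule finite_dimensional_vector_space_pair.intro)
  have fd: "fd_pair_char_0 (cscale J) B1 (cscale jW) B2" by unfold_locales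
  then interpret fd_pair_char_0 "cscale J" B1 "cscale jW" B2 .
  let ?S = "C.vs2.span (\<Union>x. range (\<gamma> x))"
  have bf_simps: "bf u (v + w) = bf u v + bf u w" "bf u (v - w) = bf u v - bf u w"
    "bf u (cscale jW c w) = c * bf u w" "bf u 0 = 0" for u v w c
  proof -
    interpret l: Vector_Spaces.linear "cscale jW" "(*)" "bf u" by (rule bf_linear)
    show "bf u (v + w) = bf u v + bf u w" "bf u (v - w) = bf u v - bf u w"
      "bf u (cscale jW c w) = c * bf u w" "bf u 0 = 0" by (simp_all add: l.add l.diff l.scale l.zero)
  qed
  \<comment> \<open>The radical of \<open>bf\<close> on the span. The map \<open>q\<close> below
    realises the quotient by it inside the span, and \<open>q\<close> composed with
    \<open>\<gamma>\<close> stays flat because \<open>q\<close> changes vectors by elements of the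
    radical only.\<close>
  define S0 where "S0 = {w\<in>?S. \<forall>x y. bf (\<gamma> x y) w = 0}"
  have S0: "C.vs2.subspace S0"
    unfolding S0_def
    by (rule C.vs2.subspaceI) (auto simp: bf_simps C.vs2.span_zero C.vs2.span_add C.vs2.span_scale)
  have S0_S: "bf w u = 0" if "w \<in> S0" "u \<in> ?S" for w u
    using that(2)
  proof (induction rule: C.vs2.span_induct_alt)
    case base show ?case by (simp add: bf_simps)
  next
    case (step c x y)
    then show ?case using that(1) by (auto simp: bf_simps S0_def bf_sym[of w])
  qed
  obtain q where q: "Vector_Spaces.linear (cscale jW) (cscale jW) q" "\<And>w. w - q w \<in> S0"
    "\<And>w. w \<in> S0 \<Longrightarrow> q w = 0"
    by (rule C.vs2.projection_exists[OF S0]) (rule that)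
  interpret q: Vector_Spaces.linear "cscale jW" "cscale jW" q by (rule q)
  have qq: "q (q w) = q w" for w using q(3)[OF q(2)[of w]] by (simp add: q.diff)
  have gS: "\<gamma> x y \<in> ?S" for x y by (rule C.vs2.span_base) blast
  have qS: "q w \<in> ?S" if "w \<in> ?S" for w
  proof -
    have "w - q w \<in> ?S" using q(2)[of w] by (simp only: S0_def mem_Collect_eq)
    from C.vs2.span_diff[OF that this] show ?thesis by simp
  qed
  have qg_sub: "(\<Union>x. range (\<lambda>y. q (\<gamma> x y))) \<subseteq> ?S"
    using qS[OF gS] by blast
  have bfq: "bf (q u) (q w) = bf u w" if "u \<in> ?S" "w \<in> ?S" for u w
  proof -
    have "bf (q u) (w - q w) = 0" using S0_S[OF q(2) qS[OF that(1)]] by (simp add: bf_sym)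
    moreover have "bf w (u - q u) = 0" using S0_S[OF q(2) that(2)] by (simp add: bf_sym)
    ultimately show ?thesis by (simp add: bf_simps bf_sym[of _ w])
  qed
  have bil: "bilinear_map (\<lambda>x y. q (\<gamma> x y))"
  proof -
    have l: "Vector_Spaces.linear (cscale J) (cscale jW) (\<lambda>y. q (\<gamma> x y))" for x
      using Vector_Spaces.linear_compose[OF gamma_linear q(1)] by (simp add: o_def)
    moreover have "(\<lambda>x. q (\<gamma> x y)) = (\<lambda>x. q (\<gamma> y x))" for y
      by (rule ext) (simp only: gamma_sym[of _ y])
    ultimately show ?thesis unfolding bilinear_map_def by simp
  qed
  interpret flat_map "cscale J" B1 "cscale jW" B2 "\<lambda>x y. q (\<gamma> x y)" bf
  proof (rule flat_map.intro[OF fd], rule flat_map_axioms.intro)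
    show "bilinear_map (\<lambda>x y. q (\<gamma> x y))" by (rule bil)
    show "q (\<gamma> x y) = q (\<gamma> y x)" for x y by (simp add: gamma_sym)
    show "Vector_Spaces.linear (cscale jW) (*) (bf u)" for u by (rule bf_linear)
    show "bf u w = bf w u" for u w by (rule bf_sym)
    show "bf (q (\<gamma> x y)) (q (\<gamma> z t)) = bf (q (\<gamma> z y)) (q (\<gamma> x t))" for x y z t
      unfolding bfq[OF gS gS] by (rule gamma_flat)
    fix u assume u: "u \<in> C.vs2.span (\<Union>x. range (\<lambda>y. q (\<gamma> x y)))"
      and 0: "\<And>x y. bf u (q (\<gamma> x y)) = 0"
    have "q u = u"
      using u
    proof (induction rule: C.vs2.span_induct_alt)
      case base show ?case by simp
    next
      case (step c x y)
      have "q x = x" using step(1) qq by blast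
      then show ?case using step by (simp only: q.add q.scale)
    qed
    moreover have uS: "u \<in> ?S"
      using u C.vs2.span_minimal[OF qg_sub C.vs2.subspace_span] by blast
    have "bf (\<gamma> x y) u = 0" for x y
      using bfq[OF gS uS, of x y] 0[of x y] \<open>q u = u\<close> by (simp add: bf_sym)
    then have "u \<in> S0" using uS by (simp add: S0_def)
    ultimately show "u = 0" using q(3) by simp
  qed
  let ?dW = "vector_space.dim (cscale jW)"
  note real2 = real_dim_eq_twice_complex_dim[OF jW] and realJ = real_dim_eq_twice_complex_dim[OF J JJ]
  have S_sub: "S \<subseteq> ?S" unfolding S_def by (rule C.vs2.span_minimal[OF qg_sub C.vs2.subspace_span])
  have S_q: "q u = u" if "u \<in> S" for u
    using that unfolding S_def
  proof (induction rule: C.vs2.span_induct_alt)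
    case base show ?case by simp
  next
    case (step c x y)
    have "q x = x" using step(1) qq by blast
    then show ?case using step by (simp only: q.add q.scale)
  qed
  have S_S0: "S \<inter> S0 = {0}"
  proof
    show "S \<inter> S0 \<subseteq> {0}" using S_q q(3) by fastforce
    show "{0} \<subseteq> S \<inter> S0" using C.vs2.subspace_0[OF S0] C.vs2.subspace_0[OF subspace_S] by blast
  qed
  have "?dW S + ?dW S0 \<le> ?dW ?S"
  proof -
    have "{x + y | x y. x \<in> S \<and> y \<in> S0} \<subseteq> ?S"
      using S_sub S0_def C.vs2.span_add by blast
    then have "?dW {x + y | x y. x \<in> S \<and> y \<in> S0} \<le> ?dW ?S" by (rule C.vs2.dim_subset)
    then show ?thesis using C.vs2.dim_complement[OF subspace_S S0 S_S0 refl] by linarith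
  qed
  \<comment> \<open>The conjugate of the radical meets the span trivially: a radical vector is
    orthogonal to its own conjugate only if its Hermitian norm vanishes. Dimensions are counted over
    the reals as conjugation is not complex linear.\<close>
  moreover have "?dW ?S + ?dW S0 \<le> p"
  proof -
    let ?c = "\<lambda>w::'v \<times> 'v. (fst w, - snd w)"
    have lc: "linear ?c" by (auto intro!: linearI)
    have S0r: "subspace S0" and Sr: "subspace ?S"
      using cscale_subspace_iff[OF jW] S0 C.vs2.subspace_span by blast+
    have cS0: "subspace (?c ` S0)" using linear_subspace_image[OF lc S0r] .
    have "inj_on ?c (span S0)" by (auto intro!: inj_onI simp: prod_eq_iff)
    then have dc: "dim (?c ` S0) = dim S0" by (rule eucl.dim_image_eq[OF lc])
    have NN: "subspace (N \<times> N)" by (rule subspace_Times[OF N(1) N(1)])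
    have neg: "- x \<in> N \<longleftrightarrow> x \<in> N" for x using subspace_neg[OF N(1), of x] subspace_neg[OF N(1), of "- x"] by auto
    have "jW ` (N \<times> N) \<subseteq> N \<times> N" by (auto simp: jW_def neg)
    with NN have "C.vs2.subspace (N \<times> N)" unfolding cscale_subspace_iff[OF jW] by blast
    moreover have "(\<Union>x. range (\<gamma> x)) \<subseteq> N \<times> N" by (auto simp: \<gamma>_def neg in_N)
    ultimately have SN: "?S \<subseteq> N \<times> N" by (rule C.vs2.span_minimal[rotated])
    have "?c w \<in> N \<times> N" if "w \<in> N \<times> N" for w using that by (auto simp: neg)
    then have cN: "?c ` S0 \<subseteq> N \<times> N" using SN unfolding S0_def by blast
    have "?S \<inter> ?c ` S0 \<subseteq> {0}"
    proof
      fix w assume w: "w \<in> ?S \<inter> ?c ` S0"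
      then obtain u where u: "u \<in> S0" "w = ?c u" by auto
      have "bf u w = 0" using S0_S u w by blast
      then have "fst u \<bullet> fst u + snd u \<bullet> snd u = 0" by (simp add: u(2) bf_def complex_eq_iff)
      then have "fst u = 0" "snd u = 0"
        by (metis add_nonneg_eq_0_iff inner_ge_zero inner_eq_zero_iff)+
      then show "w \<in> {0}" by (simp add: u(2) zero_prod_def)
    qed
    then have z: "dim (?S \<inter> ?c ` S0) = 0" unfolding dim_eq_0 .
    have "{x + y |x y. x \<in> ?S \<and> y \<in> ?c ` S0} \<subseteq> N \<times> N"
      using SN cN subspace_add[OF NN] by blast
    then have "dim {x + y |x y. x \<in> ?S \<and> y \<in> ?c ` S0} \<le> dim (N \<times> N)" by (rule dim_subset)
    then have "dim ?S + dim S0 \<le> 2 * p"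
      using dim_sums_Int[OF Sr cS0] z dc dim_Times[OF N(1) N(1)] N(2) by simp
    then show ?thesis using real2[OF S0] real2[OF C.vs2.subspace_span, of "\<Union>x. range (\<gamma> x)"] by simp
  qed
  ultimately have dims: "?dW S + 2 * ?dW S0 \<le> p" by linarith
  \<comment> \<open>The normal vectors orthogonal to the real parts of the radical. These real parts
    span at most 2 dim S0 dimensions, so \<open>dims\<close> gives dim U \<ge> dim S; and where
    \<open>\<gamma> x\<close> takes values in the radical, the \<open>U\<close>-component of
    \<open>\<alpha> x\<close> vanishes.\<close>
  define U where "U = {y \<in> N. \<forall>r\<in>fst ` S0. orthogonal r y}"
  have S0r: "subspace S0" "jW ` S0 \<subseteq> S0" using cscale_subspace_iff[OF jW] S0 by blast+
  have R: "subspace (fst ` S0)" "fst ` S0 \<subseteq> N"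
  proof -
    show "subspace (fst ` S0)" using linear_subspace_image[OF linear_fst S0r(1)] .
    have "fst w \<in> N" if "w \<in> ?S" for w
      using that
    proof (induction rule: C.vs2.span_induct_alt)
      case base show ?case using subspace_0[OF N(1)] by simp
    next
      case (step c x y)
      then obtain a b where "x = \<gamma> a b" by blast
      then show ?case using step in_N
        by (auto simp: cscale_def jW_def \<gamma>_def intro!: subspace_add subspace_diff subspace_scale N)
    qed
    then show "fst ` S0 \<subseteq> N" by (auto simp: S0_def)
  qed
  have dimU: "dim U + 2 * ?dW S0 \<ge> p"
  proof -
    have "dim (fst ` S0) \<le> dim S0" by (rule dim_image_le[OF linear_fst])
    then show ?thesis using dim_subspace_orthogonal_to_vectors[OF R(1) N(1) R(2)] N(2) real2[OF S0]
      unfolding U_def by linarith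
  qed
  have "subspace {y. \<forall>r\<in>fst ` S0. orthogonal r y}"
    by (rule subspaceI) (simp_all add: orthogonal_clauses)
  moreover have "U = N \<inter> {y. \<forall>r\<in>fst ` S0. orthogonal r y}" by (auto simp: U_def)
  ultimately have U: "subspace U" "U \<subseteq> N" using subspace_inter[OF N(1)] by auto
  have null: "C.vs1.subspace null"
    unfolding null_def using bilinear_mapD[OF bil] by (intro C.vs1.subspaceI) auto
  have null_sub: "null \<subseteq> {x. \<forall>y. \<forall>u\<in>U. \<alpha> x y \<bullet> u = 0 \<and> \<alpha> (J x) y \<bullet> u = 0}"
  proof
    fix x assume x: "x \<in> null"
    have g: "\<gamma> x y \<in> S0" for y
      using q(2)[of "\<gamma> x y"] x by (simp add: null_def)
    have *: "\<alpha> x y \<bullet> u = 0" if "u \<in> U" for y u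
    proof -
      have "\<alpha> x y \<in> fst ` S0" using g[of y] by (force simp: \<gamma>_def)
      then show ?thesis using that by (auto simp: U_def orthogonal_def)
    qed
    then show "x \<in> {x. \<forall>y. \<forall>u\<in>U. \<alpha> x y \<bullet> u = 0 \<and> \<alpha> (J x) y \<bullet> u = 0}"
      by (simp add: pluriharmonic)
  qed
  have n_le: "n \<le> ?dW S + vector_space.dim (cscale J) null"
  proof -
    have "?dW S \<le> 11" using dims N(3) by linarith
    from dim_le_dim_span_plus_nullity[OF this] realJ[OF C.vs1.subspace_UNIV] n
    show ?thesis by simp
  qed
  \<comment> \<open>The real dimension of \<open>null\<close> is at least 2 (n - dim S), hence at
    least 2 (n - dim U), against \<open>nullity\<close>.\<close>
  have "\<not> dim U \<ge> 1"
  proof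
    assume "dim U \<ge> 1"
    have False
      if "int a < 2 * (int n - int u)" "k \<le> a" "k = 2 * l" "n \<le> m + l" "m + 2 * e \<le> p" "p \<le> u + 2 * e"
      for a k l m e u :: nat
      using that by presburger
    from this[OF nullity[OF U \<open>dim U \<ge> 1\<close>] dim_subset[OF null_sub] realJ[OF null] n_le dims dimU]
    show False .
  qed
  then have "?dW S = 0" using dims dimU by linarith
  then have "S \<subseteq> {0}" unfolding C.vs2.dim_eq_0 .
  then have "q (\<gamma> x y) = 0" using alpha_in_S by blast
  then have "\<gamma> x y \<in> S0" using q(2)[of "\<gamma> x y"] by simp
  then have "bf (\<gamma> x y) (\<gamma> z t) = 0" using S0_S gS by blast
  then show ?thesis by (simp add: bf_def \<gamma>_def complex_eq_iff)
qed

end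

section \<open>Second derivatives of smooth maps\<close>

abbreviation D :: "('a::real_normed_vector \<Rightarrow> 'b::real_normed_vector) \<Rightarrow> 'a \<Rightarrow> 'a \<Rightarrow> 'b" where
  "D f x \<equiv> frechet_derivative f (at x)"

lemma has_derivative_D: "f differentiable at x \<Longrightarrow> (f has_derivative D f x) (at x)"
  using frechet_derivative_works by blast

lemma D_eqI: "(f has_derivative f') (at x) \<Longrightarrow> D f x = f'"
  using frechet_derivative_at by metis

lemma linear_D: "f differentiable at x \<Longrightarrow> linear (D f x)"
  by (rule linear_frechet_derivative)

lemma smooth_on_differentiable: "smooth_on S f \<Longrightarrow> x \<in> S \<Longrightarrow> f differentiable at x"
  unfolding smooth_on_def by (metis Ck_on.simps(2))

lemma smooth_on_D: "smooth_on S f \<Longrightarrow> smooth_on S (\<lambda>x. D f x v)"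
  unfolding smooth_on_def by (metis Ck_on.simps(2))

lemma smooth_on_continuous: "smooth_on S f \<Longrightarrow> continuous_on S f"
  unfolding smooth_on_def by (metis Ck_on.simps(1))

lemma differentiable_transform_open:
  assumes S: "open S" "x \<in> S" and eq: "\<And>y. y \<in> S \<Longrightarrow> f y = g y" and f: "f differentiable at x"
  shows "g differentiable at x" "D g x = D f x"
proof -
  have "(g has_derivative D f x) (at x)"
    by (rule has_derivative_transform_within_open[OF has_derivative_D[OF f] S eq])
  then show "g differentiable at x" "D g x = D f x"
    by (auto simp: differentiable_def intro: D_eqI)
qed

lemma Ck_on_cong:
  assumes "open S" "Ck_on k S f" "\<And>x. x \<in> S \<Longrightarrow> f x = g x"
  shows "Ck_on k S g"
  using assms(2,3)
proof (induction k arbitrary: f g)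
  case 0
  then show ?case by (simp cong: continuous_on_cong)
next
  case (Suc k)
  have f: "f differentiable at x" if "x \<in> S" for x using Suc.prems(1) that by simp
  note g = differentiable_transform_open[OF assms(1) _ Suc.prems(2) f]
  have "Ck_on k S (\<lambda>x. D g x v)" for v
    by (rule Suc.IH[of "\<lambda>x. D f x v"]) (use Suc.prems g in auto)
  then show ?case using g by simp
qed

lemma smooth_on_cong:
  "open S \<Longrightarrow> smooth_on S f \<Longrightarrow> (\<And>x. x \<in> S \<Longrightarrow> f x = g x) \<Longrightarrow> smooth_on S g"
  unfolding smooth_on_def using Ck_on_cong by blast

lemma Ck_on_const: "Ck_on k S (\<lambda>_. c)"
proof (induction k arbitrary: c)
  case (Suc k)
  then show ?case by (simp add: frechet_derivative_const)
qed simp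

lemma smooth_on_const: "smooth_on S (\<lambda>_. c)"
  using Ck_on_const unfolding smooth_on_def by blast

lemma Ck_on_add:
  assumes S: "open S" and "Ck_on k S f" "Ck_on k S g"
  shows "Ck_on k S (\<lambda>x. f x + g x)"
  using assms(2,3)
proof (induction k arbitrary: f g)
  case 0
  then show ?case by (auto intro: continuous_on_add)
next
  case (Suc k)
  have e: "D (\<lambda>x. f x + g x) x v = D f x v + D g x v" if "x \<in> S" for x v
    using Suc.prems that by (intro fun_cong[OF D_eqI] has_derivative_add has_derivative_D) auto
  have "Ck_on k S (\<lambda>x. D (\<lambda>x. f x + g x) x v)" for v
    by (rule Ck_on_cong[OF S Suc.IH[of "\<lambda>x. D f x v" "\<lambda>x. D g x v"]]) (use Suc.prems e in auto)
  then show ?case using Suc.prems by (auto intro!: differentiable_add)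
qed

lemma smooth_on_add:
  "open S \<Longrightarrow> smooth_on S f \<Longrightarrow> smooth_on S g \<Longrightarrow> smooth_on S (\<lambda>x. f x + g x)"
  unfolding smooth_on_def using Ck_on_add by blast

text \<open>The induction keeps both factors smooth rather than \<open>Ck\<close>: the product rule
  leaves one factor undifferentiated, and smoothness supplies it at every order.\<close>

lemma smooth_on_scaleR:
  assumes S: "open S" and "smooth_on S a" "smooth_on S f"
  shows "smooth_on S (\<lambda>x. a x *\<^sub>R f x)"
proof -
  have "Ck_on k S (\<lambda>x. a x *\<^sub>R f x)" for k
    using assms(2,3)
  proof (induction k arbitrary: a f)
    case 0
    show ?case
      using continuous_on_scaleR[OF smooth_on_continuous[OF 0(1)] smooth_on_continuous[OF 0(2)]] by simp
  next
    case (Suc k)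
    note d = smooth_on_differentiable[OF Suc.prems(1)] smooth_on_differentiable[OF Suc.prems(2)]
    have h: "((\<lambda>x. a x *\<^sub>R f x) has_derivative (\<lambda>v. a x *\<^sub>R D f x v + D a x v *\<^sub>R f x)) (at x)"
      if "x \<in> S" for x
      by (intro has_derivative_scaleR has_derivative_D d that)
    have "Ck_on k S (\<lambda>x. D (\<lambda>x. a x *\<^sub>R f x) x v)" for v
      by (rule Ck_on_cong[OF S Ck_on_add[OF S Suc.IH[OF Suc.prems(1) smooth_on_D[OF Suc.prems(2)]]
              Suc.IH[OF smooth_on_D[OF Suc.prems(1)] Suc.prems(2)]]])
        (simp add: D_eqI[OF h])
    then show ?case using h by (auto simp: differentiable_def)
  qed
  then show ?thesis by (simp add: smooth_on_def)
qed

lemma smooth_on_sum: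
  assumes "open S" "finite I" "\<And>i. i \<in> I \<Longrightarrow> smooth_on S (f i)"
  shows "smooth_on S (\<lambda>x. \<Sum>i\<in>I. f i x)"
  using assms(2,3)
  by (induction I rule: finite_induct) (auto intro!: smooth_on_const smooth_on_add assms(1))

lemma smooth_on_linear:
  assumes S: "open S" and "linear h" "smooth_on S f"
  shows "smooth_on S (\<lambda>x. h (f x))"
proof -
  have "Ck_on k S (\<lambda>x. h (f x))" for k
    using assms(3)
  proof (induction k arbitrary: f)
    case 0
    then show ?case
      using smooth_on_continuous linear_continuous_on_compose[OF _ assms(2)] by auto
  next
    case (Suc k)
    have d: "((\<lambda>x. h (f x)) has_derivative (\<lambda>v. h (D f x v))) (at x)" if "x \<in> S" for x
      using bounded_linear.has_derivative[OF linear_conv_bounded_linear[THEN iffD1, OF assms(2)]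
          has_derivative_D[OF smooth_on_differentiable[OF Suc.prems that]]] .
    have "Ck_on k S (\<lambda>x. D (\<lambda>x. h (f x)) x v)" for v
      by (rule Ck_on_cong[OF S Suc.IH[OF smooth_on_D[OF Suc.prems]]]) (simp add: D_eqI[OF d])
    then show ?case using d by (auto simp: differentiable_def)
  qed
  then show ?thesis by (simp add: smooth_on_def)
qed

lemma second_difference_estimate:
  fixes f :: "'a::real_normed_vector \<Rightarrow> real"
  assumes S: "open S" "y \<in> S" and f: "\<And>x. x \<in> S \<Longrightarrow> f differentiable at x"
    and g: "(\<lambda>x. D f x v) differentiable at y" and e: "e > 0"
  shows "\<exists>d>0. \<forall>t. 0 < t \<and> t < d \<longrightarrow>
    \<bar>f (y + t *\<^sub>R v + t *\<^sub>R w) - f (y + t *\<^sub>R v) - f (y + t *\<^sub>R w) + f y - t\<^sup>2 * D (\<lambda>x. D f x v) y w\<bar> \<le> e * t\<^sup>2"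
proof -
  let ?g = "\<lambda>x. D f x v"
  let ?g' = "D ?g y"
  interpret g': linear ?g' by (rule linear_D[OF g])
  \<comment> \<open>All vectors \<open>s v + u w\<close> with s, u between 0 and t have norm at most
    \<open>t * M\<close>. The linear approximation is applied at two such points, and with
    \<open>e' = e / (2 * M)\<close> the errors add up to \<open>e * t\<close>.\<close>
  define M where "M = norm v + norm w + 1"
  have M: "M > 0" by (simp add: M_def add_nonneg_pos)
  define e' where "e' = e / (2 * M)"
  have e': "e' > 0" using e M by (simp add: e'_def)
  obtain r where r: "r > 0" "ball y r \<subseteq> S" using S openE by blast
  obtain d where d: "d > 0" "\<And>x. norm (x - y) < d \<Longrightarrow> \<bar>?g x - ?g y - ?g' (x - y)\<bar> \<le> e' * norm (x - y)"
    using has_derivative_D[OF g] e' unfolding has_derivative_at_alt by (metis real_norm_def)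
  have est: "\<bar>f (y + t *\<^sub>R v + t *\<^sub>R w) - f (y + t *\<^sub>R v) - f (y + t *\<^sub>R w) + f y - t\<^sup>2 * ?g' w\<bar> \<le> e * t\<^sup>2"
    if t: "0 < t" "t < min d r / M" for t
  proof -
    have tM: "t * M < d" "t * M < r" using t M by (auto simp: pos_less_divide_eq)
    have small: "norm (s *\<^sub>R v + u *\<^sub>R w) \<le> t * M" if "0 \<le> s" "s \<le> t" "0 \<le> u" "u \<le> t" for s u
    proof -
      have "norm (s *\<^sub>R v + u *\<^sub>R w) \<le> s * norm v + u * norm w"
        using norm_triangle_ineq[of "s *\<^sub>R v" "u *\<^sub>R w"] that by simp
      also have "\<dots> \<le> t * norm v + t * norm w"
        using that by (intro add_mono mult_right_mono) auto
      also have "\<dots> \<le> t * M" using t by (simp add: M_def algebra_simps)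
      finally show ?thesis .
    qed
    have inS: "y + (s *\<^sub>R v + u *\<^sub>R w) \<in> S" if "0 \<le> s" "s \<le> t" "0 \<le> u" "u \<le> t" for s u
    proof -
      have "dist y (y + z) = norm z" for z using norm_minus_cancel[of z] by (simp add: dist_norm)
      then have "y + (s *\<^sub>R v + u *\<^sub>R w) \<in> ball y r" using small[OF that] tM by simp
      then show ?thesis using r(2) by blast
    qed
    \<comment> \<open>The increment in direction \<open>w\<close>. The mean value theorem in
      direction \<open>v\<close> turns the second difference into \<open>t\<close> times a
      difference of values of \<open>?g\<close>. The term \<open>0 *\<^sub>R w\<close> keeps both
      points in the form treated by \<open>small\<close> and \<open>der\<close>.\<close>
    define \<phi> where "\<phi> s = f (y + (s *\<^sub>R v + t *\<^sub>R w)) - f (y + (s *\<^sub>R v + 0 *\<^sub>R w))" for s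
    have der: "((\<lambda>s. f (y + (s *\<^sub>R v + u *\<^sub>R w))) has_real_derivative ?g (y + (s *\<^sub>R v + u *\<^sub>R w))) (at s)"
      if "0 \<le> s" "s \<le> t" "0 \<le> u" "u \<le> t" for s u
    proof -
      have "((\<lambda>s. y + (s *\<^sub>R v + u *\<^sub>R w)) has_derivative (\<lambda>h. h *\<^sub>R v)) (at s)"
        by (auto intro!: derivative_eq_intros)
      from has_derivative_compose[OF this has_derivative_D[OF f[OF inS[OF that]]]]
      have "((\<lambda>s. f (y + (s *\<^sub>R v + u *\<^sub>R w))) has_derivative (\<lambda>h. D f (y + (s *\<^sub>R v + u *\<^sub>R w)) (h *\<^sub>R v))) (at s)" .
      moreover have "D f (y + (s *\<^sub>R v + u *\<^sub>R w)) (h *\<^sub>R v) = ?g (y + (s *\<^sub>R v + u *\<^sub>R w)) * h" for h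
        using linear_scale[OF linear_D[OF f[OF inS[OF that]]], of h v] by (simp add: mult.commute)
      ultimately show ?thesis by (simp add: has_field_derivative_def)
    qed
    have d\<phi>: "(\<phi> has_real_derivative ?g (y + (s *\<^sub>R v + t *\<^sub>R w)) - ?g (y + (s *\<^sub>R v + 0 *\<^sub>R w))) (at s)"
      if "0 \<le> s" "s \<le> t" for s
      unfolding \<phi>_def using that t by (intro DERIV_diff der) auto
    obtain \<xi> where \<xi>: "0 < \<xi>" "\<xi> < t"
      "\<phi> t - \<phi> 0 = (t - 0) * (?g (y + (\<xi> *\<^sub>R v + t *\<^sub>R w)) - ?g (y + (\<xi> *\<^sub>R v + 0 *\<^sub>R w)))"
      using MVT2[OF t(1) d\<phi>] by blast
    let ?a = "\<xi> *\<^sub>R v + t *\<^sub>R w" and ?b = "\<xi> *\<^sub>R v + 0 *\<^sub>R w"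
    have na: "norm ?a \<le> t * M" and nb: "norm ?b \<le> t * M" using small[of \<xi> t] small[of \<xi> 0] \<xi> t by auto
    have "\<bar>?g (y + ?a) - ?g y - ?g' ?a\<bar> \<le> e' * norm ?a" "\<bar>?g (y + ?b) - ?g y - ?g' ?b\<bar> \<le> e' * norm ?b"
      using d(2)[of "y + ?a"] d(2)[of "y + ?b"] na nb tM by auto
    moreover have "e' * norm ?a \<le> e' * (t * M)" "e' * norm ?b \<le> e' * (t * M)"
      using na nb e' by (auto intro!: mult_left_mono)
    moreover have "?g' ?a - ?g' ?b = t * ?g' w" by (simp add: g'.add g'.scaleR)
    ultimately have "\<bar>(?g (y + ?a) - ?g (y + ?b)) - t * ?g' w\<bar> \<le> 2 * (e' * (t * M))" by linarith
    also have "\<dots> = e * t" using M by (simp add: e'_def)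
    finally have *: "\<bar>(?g (y + ?a) - ?g (y + ?b)) - t * ?g' w\<bar> \<le> e * t" .
    have "f (y + t *\<^sub>R v + t *\<^sub>R w) - f (y + t *\<^sub>R v) - f (y + t *\<^sub>R w) + f y = \<phi> t - \<phi> 0"
      by (simp add: \<phi>_def add.assoc)
    also have "\<dots> - t\<^sup>2 * ?g' w = t * ((?g (y + ?a) - ?g (y + ?b)) - t * ?g' w)"
      unfolding \<xi>(3) by (simp add: algebra_simps power2_eq_square)
    finally have "\<bar>f (y + t *\<^sub>R v + t *\<^sub>R w) - f (y + t *\<^sub>R v) - f (y + t *\<^sub>R w) + f y - t\<^sup>2 * ?g' w\<bar>
      = t * \<bar>(?g (y + ?a) - ?g (y + ?b)) - t * ?g' w\<bar>"
      using t by (simp add: abs_mult)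
    also have "\<dots> \<le> t * (e * t)" using * t by (intro mult_left_mono) auto
    finally show ?thesis by (simp add: power2_eq_square mult.assoc mult.left_commute)
  qed
  show ?thesis
    by (rule exI[of _ "min d r / M"]) (use est d(1) r(1) M in auto)
qed

lemma second_derivative_symmetric_real:
  fixes f :: "'a::real_normed_vector \<Rightarrow> real"
  assumes S: "open S" "y \<in> S" and f: "\<And>x. x \<in> S \<Longrightarrow> f differentiable at x"
    and g: "\<And>v. (\<lambda>x. D f x v) differentiable at y"
  shows "D (\<lambda>x. D f x v) y w = D (\<lambda>x. D f x w) y v"
proof (rule ccontr)
  let ?a = "D (\<lambda>x. D f x v) y w" and ?b = "D (\<lambda>x. D f x w) y v"
  assume ne: "?a \<noteq> ?b"
  \<comment> \<open>The same second difference is approximated by both sides with error e t^2 each,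
    so the gap is at most 2 e and a third of it gives a contradiction.\<close>
  define e where "e = \<bar>?a - ?b\<bar> / 3"
  have e: "e > 0" using ne by (simp add: e_def)
  obtain d1 where d1: "d1 > 0" "\<And>t. 0 < t \<and> t < d1 \<Longrightarrow>
    \<bar>f (y + t *\<^sub>R v + t *\<^sub>R w) - f (y + t *\<^sub>R v) - f (y + t *\<^sub>R w) + f y - t\<^sup>2 * ?a\<bar> \<le> e * t\<^sup>2"
    using second_difference_estimate[OF S f g e, of v w] by blast
  obtain d2 where d2: "d2 > 0" "\<And>t. 0 < t \<and> t < d2 \<Longrightarrow>
    \<bar>f (y + t *\<^sub>R w + t *\<^sub>R v) - f (y + t *\<^sub>R w) - f (y + t *\<^sub>R v) + f y - t\<^sup>2 * ?b\<bar> \<le> e * t\<^sup>2"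
    using second_difference_estimate[OF S f g e, of w v] by blast
  define t where "t = min d1 d2 / 2"
  have t: "0 < t" "t < d1" "t < d2" using d1(1) d2(1) by (auto simp: t_def)
  have eq: "y + t *\<^sub>R w + t *\<^sub>R v = y + t *\<^sub>R v + t *\<^sub>R w" by simp
  have "\<bar>t\<^sup>2 * ?a - t\<^sup>2 * ?b\<bar> \<le> 2 * (e * t\<^sup>2)"
    using d1(2)[of t] d2(2)[of t] t unfolding eq by linarith
  then have "t\<^sup>2 * \<bar>?a - ?b\<bar> \<le> t\<^sup>2 * (2 * e)"
    by (simp add: right_diff_distrib[symmetric] abs_mult mult.commute mult.left_commute)
  then have "\<bar>?a - ?b\<bar> \<le> 2 * e" using t by simp
  then show False using e by (simp add: e_def)
qed

lemma second_derivative_symmetric: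
  fixes f :: "'a::euclidean_space \<Rightarrow> 'b::euclidean_space"
  assumes S: "open S" "y \<in> S" and f: "smooth_on S f"
  shows "D (\<lambda>x. D f x v) y w = D (\<lambda>x. D f x w) y v"
proof (rule euclidean_eqI)
  fix b :: 'b assume "b \<in> Basis"
  let ?h = "\<lambda>x. f x \<bullet> b"
  have d1: "D ?h x u = D f x u \<bullet> b" if "x \<in> S" for x u
    using D_eqI[OF has_derivative_inner_left[OF has_derivative_D[OF smooth_on_differentiable[OF f that]]]]
    by simp
  have 1: "((\<lambda>x. D f x u \<bullet> b) has_derivative (\<lambda>w. D (\<lambda>x. D f x u) y w \<bullet> b)) (at y)" for u
    by (rule has_derivative_inner_left[OF has_derivative_D[OF smooth_on_differentiable[OF smooth_on_D[OF f] S(2)]]])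
  have 2: "((\<lambda>x. D ?h x u) has_derivative (\<lambda>w. D (\<lambda>x. D f x u) y w \<bullet> b)) (at y)" for u
    by (rule has_derivative_transform_within_open[OF 1 S]) (simp add: d1)
  have "D (\<lambda>x. D ?h x v) y w = D (\<lambda>x. D ?h x w) y v"
  proof (rule second_derivative_symmetric_real[OF S])
    show "?h differentiable at x" if "x \<in> S" for x
      using has_derivative_inner_left[OF has_derivative_D[OF smooth_on_differentiable[OF f that]]]
      by (auto simp: differentiable_def)
    show "(\<lambda>x. D ?h x u) differentiable at y" for u using 2 by (auto simp: differentiable_def)
  qed
  then show "D (\<lambda>x. D f x v) y w \<bullet> b = D (\<lambda>x. D f x w) y v \<bullet> b"
    by (simp only: D_eqI[OF 2])
qed

section \<open>Orthogonal projections and isometries with prescribed values\<close>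

lemma orth_proj_eqI:
  assumes U: "subspace U" and u: "u \<in> U" "\<And>w. w \<in> U \<Longrightarrow> orthogonal (v - u) w"
  shows "orth_proj U v = u"
proof -
  let ?p = "orth_proj U v"
  have p: "?p \<in> U" by (rule orth_proj_correct(1)[OF U])
  have d: "u - ?p \<in> U" using subspace_diff[OF U u(1) p] .
  have "(v - ?p) \<bullet> (u - ?p) = 0" "(v - u) \<bullet> (u - ?p) = 0"
    using orth_proj_correct(2)[OF U d] u(2)[OF d] by (auto simp: orthogonal_def)
  then have "(u - ?p) \<bullet> (u - ?p) = 0" by (simp add: inner_diff_left)
  then show ?thesis by simp
qed

lemma orth_proj_eq_0_iff:
  assumes "subspace U"
  shows "orth_proj U v = 0 \<longleftrightarrow> (\<forall>u\<in>U. v \<bullet> u = 0)"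
proof
  assume "orth_proj U v = 0"
  then show "\<forall>u\<in>U. v \<bullet> u = 0"
    using orth_proj_correct(2)[OF assms, of _ v] by (simp add: orthogonal_def)
next
  assume "\<forall>u\<in>U. v \<bullet> u = 0"
  then show "orth_proj U v = 0"
    by (intro orth_proj_eqI[OF assms]) (auto simp: orthogonal_def subspace_0[OF assms])
qed

context pointwise_real_kaehler
begin

text \<open>For the part of \<open>N\<close> orthogonal to all values the nullity space is the whole
  tangent space, of dimension 2 n, which the hypothesis excludes as soon as that part is
  nonzero.\<close>

lemma span_alpha: "span (\<Union>x. range (\<alpha> x)) = N"
proof -
  let ?A = "span (\<Union>x. range (\<alpha> x))"
  define U where "U = {y \<in> N. \<forall>x\<in>?A. orthogonal x y}"
  have "(\<Union>x. range (\<alpha> x)) \<subseteq> N" using in_N by blast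
  then have AN: "?A \<subseteq> N" by (rule span_minimal[OF _ N(1)])
  have d: "dim U + dim ?A = dim N"
    unfolding U_def by (rule dim_subspace_orthogonal_to_vectors[OF subspace_span N(1) AN])
  have "subspace {y. \<forall>x\<in>?A. orthogonal x y}"
    by (rule subspaceI) (simp_all add: orthogonal_clauses)
  moreover have "U = N \<inter> {y. \<forall>x\<in>?A. orthogonal x y}" by (auto simp: U_def)
  ultimately have U: "subspace U" "U \<subseteq> N" using subspace_inter[OF N(1)] by auto
  have "\<not> dim U \<ge> 1"
  proof
    assume 1: "dim U \<ge> 1"
    have "\<alpha> x y \<bullet> u = 0" if "u \<in> U" for x y u
    proof -
      have "\<alpha> x y \<in> ?A" by (rule span_base) blast
      then show ?thesis using that by (auto simp: U_def orthogonal_def)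
    qed
    then have "{x. \<forall>y. \<forall>u\<in>U. \<alpha> x y \<bullet> u = 0 \<and> \<alpha> (J x) y \<bullet> u = 0} = UNIV" by blast
    then show False using nullity[OF U 1] n by simp
  qed
  then have "dim ?A = dim N" using d by linarith
  then show ?thesis using subspace_dim_equal[OF subspace_span N(1) AN] by linarith
qed

end

text \<open>A vector may occur in several pairs of \<open>R\<close>. The map is defined on a basis
  chosen among the first components, and for any other pair equal inner products give
  \<open>T b - c\<close> length zero.\<close>

lemma isometry_of_equal_gram:
  fixes R :: "('v::euclidean_space \<times> 'v) set"
  assumes gram: "\<And>b c b' c'. (b, c) \<in> R \<Longrightarrow> (b', c') \<in> R \<Longrightarrow> b \<bullet> b' = c \<bullet> c'"
    and full: "span (fst ` R) = UNIV"
  obtains T where "orthogonal_transformation T" "\<And>b c. (b, c) \<in> R \<Longrightarrow> T b = c"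
proof -
  obtain B where B: "B \<subseteq> fst ` R" "independent B" "fst ` R \<subseteq> span B"
    by (rule maximal_independent_subset)
  have spanB: "span B = UNIV" using full B(3) span_minimal[OF B(3) subspace_span] by blast
  have "\<forall>b\<in>B. \<exists>c. (b, c) \<in> R" using B(1) by force
  from bchoice[OF this] obtain h where h: "\<And>b. b \<in> B \<Longrightarrow> (b, h b) \<in> R" by blast
  obtain T where T: "linear T" "\<And>b. b \<in> B \<Longrightarrow> T b = h b"
    using linear_independent_extend[OF B(2), of h] by blast
  interpret T: linear T by (rule T)
  have 1: "T x \<bullet> c = x \<bullet> b" if bc: "(b, c) \<in> R" for x b c
  proof -
    have "x \<in> span B" using spanB by simp
    then show ?thesis
    proof (induction rule: span_induct_alt)
      case base show ?case by simp
    next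
      case (step k z w)
      have "T z \<bullet> c = z \<bullet> b" using T(2)[OF step(1)] gram[OF h[OF step(1)] bc] by simp
      then show ?case using step(2) by (simp add: T.add T.scaleR inner_add_left)
    qed
  qed
  have 2: "T x \<bullet> T y = x \<bullet> y" for x y
  proof -
    have "y \<in> span B" using spanB by simp
    then show ?thesis
    proof (induction rule: span_induct_alt)
      case base show ?case by simp
    next
      case (step k z w)
      have "T x \<bullet> T z = x \<bullet> z" using T(2)[OF step(1)] 1[OF h[OF step(1)]] by simp
      then show ?case using step(2) by (simp add: T.add T.scaleR inner_add_right)
    qed
  qed
  have "T b = c" if bc: "(b, c) \<in> R" for b c
  proof -
    have "T b \<bullet> T b = c \<bullet> c" "T b \<bullet> c = c \<bullet> c"
      using 2[of b b] 1[OF bc, of b] gram[OF bc bc] by simp_all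
    then have "(T b - c) \<bullet> (T b - c) = 0" by (simp add: inner_diff_left inner_diff_right inner_commute)
    then show ?thesis by simp
  qed
  moreover have "orthogonal_transformation T" using T(1) 2 by (simp add: orthogonal_transformation_def)
  ultimately show ?thesis using that by blast
qed

text \<open>As \<open>s\<close> vanishes at \<open>y\<close>, it is of order
  \<open>norm (x - y)\<close> near \<open>y\<close>, so replacing \<open>\<tau> x\<close> by
  \<open>\<tau> y\<close> costs only a term of smaller order by continuity of
  \<open>\<tau>\<close>.\<close>

lemma has_derivative_scaleR_vanishing:
  fixes s :: "'a::real_normed_vector \<Rightarrow> real" and \<tau> :: "'a \<Rightarrow> 'b::real_normed_vector"
  assumes s: "(s has_derivative s') (at y)" "s y = 0" and \<tau>: "isCont \<tau> y"
  shows "((\<lambda>x. s x *\<^sub>R \<tau> x) has_derivative (\<lambda>h. s' h *\<^sub>R \<tau> y)) (at y)"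
proof -
  have bl: "bounded_linear s'" using has_derivative_bounded_linear[OF s(1)] .
  then obtain K where K: "K > 0" "\<And>h. norm (s' h) \<le> norm h * K"
    using bounded_linear.pos_bounded by blast
  have 0: "((\<lambda>x. s x *\<^sub>R (\<tau> x - \<tau> y)) has_derivative (\<lambda>h. 0)) (at y)"
    unfolding has_derivative_at_alt
  proof (intro conjI allI impI)
    show "bounded_linear (\<lambda>h::'a. 0::'b)" by (rule bounded_linear_zero)
    fix e :: real assume e: "e > 0"
    define e' where "e' = e / (1 + K)"
    have e': "e' > 0" using e K by (simp add: e'_def)
    obtain d1 where d1: "d1 > 0" "\<And>x. norm (x - y) < d1 \<Longrightarrow> norm (s x - s y - s' (x - y)) \<le> 1 * norm (x - y)"
      using s(1) zero_less_one unfolding has_derivative_at_alt by blast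
    obtain d2 where d2: "d2 > 0" "\<And>x. norm (x - y) < d2 \<Longrightarrow> norm (\<tau> x - \<tau> y) < e'"
      using \<tau> e' unfolding continuous_at_eps_delta dist_norm by blast
    show "\<exists>d>0. \<forall>x. norm (x - y) < d \<longrightarrow>
        norm (s x *\<^sub>R (\<tau> x - \<tau> y) - s y *\<^sub>R (\<tau> y - \<tau> y) - 0) \<le> e * norm (x - y)"
    proof (intro exI[of _ "min d1 d2"] conjI allI impI)
      fix x assume x: "norm (x - y) < min d1 d2"
      have "\<bar>s x\<bar> \<le> norm (x - y) * (1 + K)"
        using d1(2)[of x] K(2)[of "x - y"] x s(2) by (simp add: algebra_simps)
      then have "\<bar>s x\<bar> * norm (\<tau> x - \<tau> y) \<le> (norm (x - y) * (1 + K)) * e'"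
        using d2(2)[of x] x K by (intro mult_mono) auto
      also have "\<dots> = e * norm (x - y)" using K by (simp add: e'_def)
      finally show "norm (s x *\<^sub>R (\<tau> x - \<tau> y) - s y *\<^sub>R (\<tau> y - \<tau> y) - 0) \<le> e * norm (x - y)" by simp
    qed (use d1 d2 in auto)
  qed
  have "((\<lambda>x. s x *\<^sub>R \<tau> y + s x *\<^sub>R (\<tau> x - \<tau> y)) has_derivative (\<lambda>h. s' h *\<^sub>R \<tau> y + 0)) (at y)"
    by (intro has_derivative_add has_derivative_scaleR_left s(1) 0)
  then show ?thesis by (simp add: scaleR_diff_right)
qed

text \<open>No smoothness of \<open>T\<close> is assumed: it follows from that of sufficiently many pairs \<open>(b, T b)\<close>.\<close>

lemma isometry_field_differentiable:
  fixes T :: "'a::euclidean_space \<Rightarrow> 'v::euclidean_space \<Rightarrow> 'v"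
  assumes V: "open V" "y \<in> V" and T: "\<And>x. x \<in> V \<Longrightarrow> orthogonal_transformation (T x)"
    and diff: "\<And>b c. (b, c) \<in> R \<Longrightarrow> b differentiable (at y) \<and> c differentiable (at y)"
    and eq: "\<And>b c x. (b, c) \<in> R \<Longrightarrow> x \<in> V \<Longrightarrow> T x (b x) = c x"
    and full: "span {b y | b c. (b, c) \<in> R} = UNIV"
  shows "(\<lambda>x. T x u) differentiable (at y)"
    and "(b, c) \<in> R \<Longrightarrow> D (\<lambda>x. T x (b y)) y h = D c y h - T y (D b y h)"
proof -
  have lin: "linear (T x)" if "x \<in> V" for x using T[OF that] by (simp add: orthogonal_transformation_linear)
  have ev: "eventually (\<lambda>x. x \<in> V) (at y)" using V eventually_at_topological by blast
  \<comment> \<open>The unknown dependence of \<open>T\<close> on \<open>x\<close> is moved to the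
    short vector \<open>b x - b y\<close>, which the isometry \<open>T x\<close> does not lengthen.
    This gives continuity first.\<close>
  have split: "T x (b y) = c x - T x (b x - b y)" if "(b, c) \<in> R" "x \<in> V" for b c x
    using eq[OF that] linear_diff[OF lin[OF that(2)]] by simp
  have cont_b: "isCont (\<lambda>x. T x (b y)) y" if bc: "(b, c) \<in> R" for b c
  proof -
    have cb: "isCont b y" and cc: "isCont c y"
      using diff[OF bc] differentiable_imp_continuous_within by blast+
    have "((\<lambda>x. norm (b x - b y)) \<longlongrightarrow> 0) (at y)"
      using cb by (simp add: isCont_def LIM_zero tendsto_norm_zero)
    moreover have "\<forall>\<^sub>F x in at y. norm (T x (b x - b y)) \<le> norm (b x - b y)"
      using ev by eventually_elim (simp add: orthogonal_transformation_norm[OF T])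
    ultimately have "((\<lambda>x. T x (b x - b y)) \<longlongrightarrow> 0) (at y)"
      by (rule Lim_null_comparison[rotated])
    then have "((\<lambda>x. c x - T x (b x - b y)) \<longlongrightarrow> c y - 0) (at y)"
      using cc by (intro tendsto_diff) (simp_all add: isCont_def)
    moreover have "\<forall>\<^sub>F x in at y. T x (b y) = c x - T x (b x - b y)"
      using ev by eventually_elim (rule split[OF bc])
    ultimately have "((\<lambda>x. T x (b y)) \<longlongrightarrow> c y) (at y)" by (simp add: tendsto_cong)
    then show ?thesis using eq[OF bc V(2)] by (simp add: isCont_def)
  qed
  have cont: "isCont (\<lambda>x. T x u) y" for u
  proof -
    have "u \<in> span {b y | b c. (b, c) \<in> R}" using full by simp
    then show ?thesis
    proof (induction rule: span_induct_alt)
      case base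
      have "\<forall>\<^sub>F x in at y. T x 0 = 0" using ev by eventually_elim (simp add: linear_0[OF lin])
      then show ?case by (simp add: isCont_def linear_0[OF lin[OF V(2)]] tendsto_cong)
    next
      case (step k z w)
      then obtain b c where "z = b y" "(b, c) \<in> R" by blast
      then have z: "isCont (\<lambda>x. T x z) y" using cont_b by blast
      have e: "T x (k *\<^sub>R z + w) = k *\<^sub>R T x z + T x w" if "x \<in> V" for x
        by (simp add: linear_add[OF lin[OF that]] linear_scale[OF lin[OF that]])
      have "\<forall>\<^sub>F x in at y. T x (k *\<^sub>R z + w) = k *\<^sub>R T x z + T x w"
        using ev by eventually_elim (rule e)
      moreover have "((\<lambda>x. k *\<^sub>R T x z + T x w) \<longlongrightarrow> k *\<^sub>R T y z + T y w) (at y)"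
        using z step(2) by (intro tendsto_intros) (simp_all add: isCont_def)
      ultimately show ?case by (simp add: isCont_def e[OF V(2)] tendsto_cong)
    qed
  qed
  have der: "((\<lambda>x. T x (b y)) has_derivative (\<lambda>h. D c y h - T y (D b y h))) (at y)"
    if bc: "(b, c) \<in> R" for b c
  proof -
    have db: "(b has_derivative D b y) (at y)" and dc: "(c has_derivative D c y) (at y)"
      using diff[OF bc] has_derivative_D by blast+
    have rep: "T x v = (\<Sum>i\<in>Basis. (v \<bullet> i) *\<^sub>R T x i)" if "x \<in> V" for x v
      using linear_sum[OF lin[OF that], of "\<lambda>i. (v \<bullet> i) *\<^sub>R i" Basis] linear_scale[OF lin[OF that]]
      by (simp add: euclidean_representation)
    \<comment> \<open>The coefficients \<open>(b x - b y) \<bullet> i\<close> vanish at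
      \<open>y\<close>, so continuity of \<open>T\<close> upgrades to differentiability through
      \<open>has_derivative_scaleR_vanishing\<close>.\<close>
    have "((\<lambda>x. \<Sum>i\<in>Basis. ((b x - b y) \<bullet> i) *\<^sub>R T x i) has_derivative
        (\<lambda>h. \<Sum>i\<in>Basis. (D b y h \<bullet> i) *\<^sub>R T y i)) (at y)"
    proof (intro has_derivative_sum has_derivative_scaleR_vanishing cont)
      fix i :: 'v
      have "((\<lambda>x. b x - b y) has_derivative (\<lambda>h. D b y h - 0)) (at y)"
        by (intro has_derivative_diff db has_derivative_const)
      from has_derivative_inner_left[OF this, of i]
      show "((\<lambda>x. (b x - b y) \<bullet> i) has_derivative (\<lambda>h. D b y h \<bullet> i)) (at y)" by simp
    qed simp
    then have "((\<lambda>x. c x - (\<Sum>i\<in>Basis. ((b x - b y) \<bullet> i) *\<^sub>R T x i)) has_derivative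
        (\<lambda>h. D c y h - T y (D b y h))) (at y)"
      unfolding rep[OF V(2), symmetric] by (intro has_derivative_diff dc)
    then show ?thesis
      by (rule has_derivative_transform_within_open[OF _ V])
        (simp add: split[OF bc] rep[symmetric])
  qed
  show "(\<lambda>x. T x u) differentiable (at y)"
  proof -
    have "u \<in> span {b y | b c. (b, c) \<in> R}" using full by simp
    then show ?thesis
    proof (induction rule: span_induct_alt)
      case base
      show ?case
        by (rule differentiable_transform_open(1)[OF V, of "\<lambda>_. 0"]) (simp_all add: linear_0[OF lin])
    next
      case (step k z w)
      then obtain b c where "z = b y" "(b, c) \<in> R" by blast
      then have z: "(\<lambda>x. T x z) differentiable (at y)" using der by (auto simp: differentiable_def)
      show ?case
        by (rule differentiable_transform_open(1)[OF V, of "\<lambda>x. k *\<^sub>R T x z + T x w"])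
          (use z step(2) in \<open>simp_all add: linear_add[OF lin] linear_scale[OF lin]\<close>)
    qed
  qed
  show "(b, c) \<in> R \<Longrightarrow> D (\<lambda>x. T x (b y)) y h = D c y h - T y (D b y h)"
    using D_eqI[OF der] by simp
qed

section \<open>Isometric immersions in a chart\<close>

locale complex_chart =
  fixes V :: "'e::euclidean_space set" and F :: "'e \<Rightarrow> 'v::euclidean_space" and Jc :: "'e \<Rightarrow> 'e \<Rightarrow> 'e"
  assumes V: "open V" and F: "smooth_on V F"
    and Jlin: "y \<in> V \<Longrightarrow> linear (Jc y)" and JJ: "y \<in> V \<Longrightarrow> Jc y (Jc y v) = - v"
    and Js: "smooth_on V (\<lambda>y. Jc y v)"
begin

definition F2 :: "'e \<Rightarrow> 'e \<Rightarrow> 'e \<Rightarrow> 'v" where "F2 y v w = D (\<lambda>x. D F x w) y v"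
text \<open>The differential applied to \<open>J w\<close>, for a coordinate-constant
  \<open>w\<close>. For a Kaehler metric these vectors have the same inner products as the vectors
  \<open>D F y w\<close>, which is why \<open>F2\<close> and \<open>G2\<close> are carried along in
  parallel.\<close>

definition G :: "'e \<Rightarrow> 'e \<Rightarrow> 'v" where "G w y = D F y (Jc y w)"
definition G2 :: "'e \<Rightarrow> 'e \<Rightarrow> 'e \<Rightarrow> 'v" where "G2 y v w = D (G w) y v"

lemma DF_lin: "y \<in> V \<Longrightarrow> linear (D F y)"
  by (rule linear_D[OF smooth_on_differentiable[OF F]])

lemma smooth_DF: "smooth_on V (\<lambda>x. D F x w)"
  by (rule smooth_on_D[OF F])

lemma DF_expand: "y \<in> V \<Longrightarrow> D F y u = (\<Sum>b\<in>Basis. (u \<bullet> b) *\<^sub>R D F y b)"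
  using linear_sum[OF DF_lin, of y "\<lambda>b. (u \<bullet> b) *\<^sub>R b" Basis] linear_scale[OF DF_lin, of y]
  by (simp add: euclidean_representation)

lemma smooth_J_coord: "smooth_on V (\<lambda>y. Jc y w \<bullet> b)"
  by (rule smooth_on_linear[OF V _ Js]) (auto intro!: linearI simp: inner_add_left)

lemma smooth_G: "smooth_on V (G w)"
proof (rule smooth_on_cong[OF V])
  show "smooth_on V (\<lambda>y. \<Sum>b\<in>Basis. (Jc y w \<bullet> b) *\<^sub>R D F y b)"
    by (intro smooth_on_sum smooth_on_scaleR V smooth_J_coord smooth_DF finite_Basis)
  show "(\<Sum>b\<in>Basis. (Jc y w \<bullet> b) *\<^sub>R D F y b) = G w y" if "y \<in> V" for y
    by (simp add: G_def DF_expand[OF that, of "Jc y w"])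
qed

lemma has_derivative_DF: "y \<in> V \<Longrightarrow> ((\<lambda>x. D F x w) has_derivative (\<lambda>v. F2 y v w)) (at y)"
  unfolding F2_def using has_derivative_D[OF smooth_on_differentiable[OF smooth_DF]] by simp

lemma has_derivative_G: "y \<in> V \<Longrightarrow> (G w has_derivative (\<lambda>v. G2 y v w)) (at y)"
  unfolding G2_def using has_derivative_D[OF smooth_on_differentiable[OF smooth_G]] by simp

lemma linear_F2: assumes y: "y \<in> V" shows "linear (\<lambda>v. F2 y v w)" "linear (F2 y v)"
proof -
  show "linear (\<lambda>v. F2 y v w)"
    using has_derivative_DF[OF y] has_derivative_linear by blast
  show "linear (F2 y v)"
  proof (rule linearI)
    fix a b :: 'e and c :: real
    have "((\<lambda>x. D F x a + D F x b) has_derivative (\<lambda>v. F2 y v a + F2 y v b)) (at y)"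
      by (intro has_derivative_add has_derivative_DF y)
    then have "((\<lambda>x. D F x (a + b)) has_derivative (\<lambda>v. F2 y v a + F2 y v b)) (at y)"
      by (rule has_derivative_transform_within_open[OF _ V y]) (simp add: linear_add[OF DF_lin])
    then show "F2 y v (a + b) = F2 y v a + F2 y v b" unfolding F2_def[of y v "a + b"] by (simp add: D_eqI)
    have "((\<lambda>x. c *\<^sub>R D F x a) has_derivative (\<lambda>v. c *\<^sub>R F2 y v a)) (at y)"
      by (intro has_derivative_scaleR_right has_derivative_DF y)
    then have "((\<lambda>x. D F x (c *\<^sub>R a)) has_derivative (\<lambda>v. c *\<^sub>R F2 y v a)) (at y)"
      by (rule has_derivative_transform_within_open[OF _ V y]) (simp add: linear_scale[OF DF_lin])
    then show "F2 y v (c *\<^sub>R a) = c *\<^sub>R F2 y v a" unfolding F2_def[of y v "c *\<^sub>R a"] by (simp add: D_eqI)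
  qed
qed

lemma F2_sym: "y \<in> V \<Longrightarrow> F2 y v w = F2 y w v"
  unfolding F2_def by (rule second_derivative_symmetric[OF V _ F])

lemma G2_eq:
  assumes y: "y \<in> V"
  shows "G2 y v w = F2 y v (Jc y w) + D F y (D (\<lambda>x. Jc x w) y v)"
proof -
  define j where "j = D (\<lambda>x. Jc x w) y v"
  have "((\<lambda>x. \<Sum>b\<in>Basis. (Jc x w \<bullet> b) *\<^sub>R D F x b) has_derivative
      (\<lambda>v. \<Sum>b\<in>Basis. (Jc y w \<bullet> b) *\<^sub>R F2 y v b + (D (\<lambda>x. Jc x w) y v \<bullet> b) *\<^sub>R D F y b)) (at y)"
    by (intro has_derivative_sum has_derivative_scaleR has_derivative_DF y has_derivative_inner_left
        has_derivative_D[OF smooth_on_differentiable[OF Js]])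
  then have "(G w has_derivative
      (\<lambda>v. \<Sum>b\<in>Basis. (Jc y w \<bullet> b) *\<^sub>R F2 y v b + (D (\<lambda>x. Jc x w) y v \<bullet> b) *\<^sub>R D F y b)) (at y)"
    by (rule has_derivative_transform_within_open[OF _ V y]) (simp add: G_def DF_expand[of _ "Jc _ w"])
  then have "G2 y v w = (\<Sum>b\<in>Basis. (Jc y w \<bullet> b) *\<^sub>R F2 y v b) + (\<Sum>b\<in>Basis. (j \<bullet> b) *\<^sub>R D F y b)"
    unfolding G2_def j_def by (simp add: D_eqI sum.distrib)
  also have "(\<Sum>b\<in>Basis. (j \<bullet> b) *\<^sub>R D F y b) = D F y j" by (simp add: DF_expand[OF y, of j])
  also have "(\<Sum>b\<in>Basis. (Jc y w \<bullet> b) *\<^sub>R F2 y v b) = F2 y v (Jc y w)"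
    using linear_sum[OF linear_F2(2)[OF y], of v "\<lambda>b. (Jc y w \<bullet> b) *\<^sub>R b" Basis]
      linear_scale[OF linear_F2(2)[OF y]] by (simp add: euclidean_representation)
  finally show ?thesis unfolding j_def .
qed

end

text \<open>\<open>par\<close> expresses that \<open>J\<close> is parallel in extrinsic terms: if
  the tangential part of the derivative of the field \<open>w\<close> is the image of
  \<open>u\<close>, then that of the field \<open>J w\<close> is the image of
  \<open>J u\<close>.\<close>

locale kaehler_chart = complex_chart V F Jc
  for V :: "'e::euclidean_space set" and F :: "'e \<Rightarrow> 'v::euclidean_space" and Jc :: "'e \<Rightarrow> 'e \<Rightarrow> 'e" +
  assumes isom: "y \<in> V \<Longrightarrow> D F y (Jc y v) \<bullet> D F y (Jc y w) = D F y v \<bullet> D F y w"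
    and par: "y \<in> V \<Longrightarrow> \<exists>u. (\<forall>z. D (\<lambda>x. D F x w) y v \<bullet> D F y z = D F y u \<bullet> D F y z) \<and>
      (\<forall>z. D (\<lambda>x. D F x (Jc x w)) y v \<bullet> D F y z = D F y (Jc y u) \<bullet> D F y z)"
begin

definition N :: "'e \<Rightarrow> 'v set" where "N y = orthogonal_comp (range (D F y))"
definition \<alpha> :: "'e \<Rightarrow> 'e \<Rightarrow> 'e \<Rightarrow> 'v" where "\<alpha> y v w = orth_proj (N y) (F2 y v w)"

lemma subspace_N: "subspace (N y)"
  unfolding N_def by (rule subspace_orthogonal_comp)

lemma N_perp: "a \<in> N y \<Longrightarrow> a \<bullet> D F y z = 0" "a \<in> N y \<Longrightarrow> D F y z \<bullet> a = 0"
  by (auto simp: N_def orthogonal_comp_def orthogonal_def inner_commute)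

lemma in_N_iff: "a \<in> N y \<longleftrightarrow> (\<forall>z. a \<bullet> D F y z = 0)"
  by (auto simp: N_def orthogonal_comp_def orthogonal_def inner_commute)

lemma orth_proj_tangential:
  assumes "\<And>z. a \<bullet> D F y z = D F y u \<bullet> D F y z"
  shows "orth_proj (N y) a = a - D F y u" "a - D F y u \<in> N y"
proof -
  show 1: "a - D F y u \<in> N y" using assms by (simp add: in_N_iff inner_diff_left)
  show "orth_proj (N y) a = a - D F y u"
    by (rule orth_proj_eqI[OF subspace_N 1]) (simp add: orthogonal_def N_perp)
qed

text \<open>The vector \<open>u\<close> is the Levi-Civita covariant derivative of \<open>w\<close> in direction \<open>v\<close>.\<close>

lemma gauss_formula:
  assumes y: "y \<in> V"
  obtains u where "F2 y v w = D F y u + \<alpha> y v w" "G2 y v w = D F y (Jc y u) + \<alpha> y v (Jc y w)"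
proof -
  obtain u where u: "\<And>z. F2 y v w \<bullet> D F y z = D F y u \<bullet> D F y z"
    "\<And>z. G2 y v w \<bullet> D F y z = D F y (Jc y u) \<bullet> D F y z"
    using par[OF y, of w v] unfolding F2_def G2_def G_def by blast
  define j where "j = D (\<lambda>x. Jc x w) y v"
  note G2 = G2_eq[OF y, of v w, folded j_def]
  have "F2 y v (Jc y w) \<bullet> D F y z = D F y (Jc y u - j) \<bullet> D F y z" for z
    using u(2)[of z] unfolding G2 by (simp add: linear_diff[OF DF_lin[OF y]] inner_diff_left inner_add_left)
  from orth_proj_tangential(1)[OF this]
  have "\<alpha> y v (Jc y w) = F2 y v (Jc y w) - D F y (Jc y u - j)" by (simp add: \<alpha>_def)
  then have "G2 y v w = D F y (Jc y u) + \<alpha> y v (Jc y w)"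
    unfolding G2 by (simp add: linear_diff[OF DF_lin[OF y]])
  moreover have "F2 y v w = D F y u + \<alpha> y v w"
    using orth_proj_tangential(1)[OF u(1)] by (simp add: \<alpha>_def)
  ultimately show ?thesis using that by blast
qed

lemma alpha_N: "\<alpha> y v w \<in> N y"
  unfolding \<alpha>_def by (rule orth_proj_correct(1)[OF subspace_N])

lemma alpha_sym: "y \<in> V \<Longrightarrow> \<alpha> y v w = \<alpha> y w v"
  unfolding \<alpha>_def by (simp add: F2_sym)

lemma orth_proj_linear: "linear (orth_proj (N y))"
proof (rule linearI)
  note c = orth_proj_correct[OF subspace_N[of y]]
  show "orth_proj (N y) (a + b) = orth_proj (N y) a + orth_proj (N y) b" for a b
  proof (rule orth_proj_eqI[OF subspace_N])
    show "orth_proj (N y) a + orth_proj (N y) b \<in> N y" by (intro subspace_add subspace_N c(1))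
    show "orthogonal (a + b - (orth_proj (N y) a + orth_proj (N y) b)) w" if "w \<in> N y" for w
      using c(2)[OF that, of a] c(2)[OF that, of b]
      by (simp add: orthogonal_def inner_diff_left inner_add_left)
  qed
  show "orth_proj (N y) (k *\<^sub>R a) = k *\<^sub>R orth_proj (N y) a" for k a
  proof (rule orth_proj_eqI[OF subspace_N])
    show "k *\<^sub>R orth_proj (N y) a \<in> N y" by (intro subspace_scale subspace_N c(1))
    show "orthogonal (k *\<^sub>R a - k *\<^sub>R orth_proj (N y) a) w" if "w \<in> N y" for w
      using c(2)[OF that, of a]
      by (simp add: orthogonal_def inner_diff_left)
  qed
qed

lemma alpha_bilinear: "y \<in> V \<Longrightarrow> bilinear (\<alpha> y)"
  unfolding bilinear_def \<alpha>_def
  using linear_compose[OF linear_F2(1) orth_proj_linear] linear_compose[OF linear_F2(2) orth_proj_linear]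
  by (simp add: o_def)

text \<open>Each side is a product of tangential parts, the images of two vectors on the left and of
  their \<open>J\<close>-images on the right, and \<open>J\<close> is isometric.\<close>

lemma normal_part_inner:
  assumes y: "y \<in> V"
  shows "F2 y v w \<bullet> F2 y t z - \<alpha> y v w \<bullet> \<alpha> y t z
    = G2 y v w \<bullet> G2 y t z - \<alpha> y v (Jc y w) \<bullet> \<alpha> y t (Jc y z)"
proof -
  obtain u where u: "F2 y v w = D F y u + \<alpha> y v w" "G2 y v w = D F y (Jc y u) + \<alpha> y v (Jc y w)"
    by (rule gauss_formula[OF y])
  obtain u' where u': "F2 y t z = D F y u' + \<alpha> y t z" "G2 y t z = D F y (Jc y u') + \<alpha> y t (Jc y z)"
    by (rule gauss_formula[OF y])
  show ?thesis unfolding u u'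
    by (simp add: inner_add_left inner_add_right N_perp[OF alpha_N] isom[OF y])
qed

lemma inner_FG: "y \<in> V \<Longrightarrow> G2 y v w \<bullet> G z y = F2 y v w \<bullet> D F y z"
proof -
  assume y: "y \<in> V"
  obtain u where u: "F2 y v w = D F y u + \<alpha> y v w" "G2 y v w = D F y (Jc y u) + \<alpha> y v (Jc y w)"
    by (rule gauss_formula[OF y])
  show ?thesis unfolding u G_def by (simp add: inner_add_left N_perp[OF alpha_N] isom[OF y])
qed

text \<open>Differentiate \<open>inner_FG\<close> in a further direction and antisymmetrise: the third derivatives drop
  out, and the Gauss equation appears without any mention of the curvature tensor.\<close>

lemma gauss_equation:
  assumes y: "y \<in> V"
  shows "\<alpha> y v w \<bullet> \<alpha> y t z - \<alpha> y t w \<bullet> \<alpha> y v z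
    = \<alpha> y v (Jc y w) \<bullet> \<alpha> y t (Jc y z) - \<alpha> y t (Jc y w) \<bullet> \<alpha> y v (Jc y z)"
proof -
  have dF2: "((\<lambda>x. F2 x v w) has_derivative D (\<lambda>x. F2 x v w) y) (at y)" for v w
    using has_derivative_D[OF smooth_on_differentiable[OF smooth_on_D[OF smooth_DF] y]]
    by (simp add: F2_def)
  have dG2: "((\<lambda>x. G2 x v w) has_derivative D (\<lambda>x. G2 x v w) y) (at y)" for v w
    using has_derivative_D[OF smooth_on_differentiable[OF smooth_on_D[OF smooth_G] y]]
    by (simp add: G2_def)
  have *: "G2 y v w \<bullet> G2 y t z + D (\<lambda>x. G2 x v w) y t \<bullet> G z y
      = F2 y v w \<bullet> F2 y t z + D (\<lambda>x. F2 x v w) y t \<bullet> D F y z" for v t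
  proof -
    have g: "((\<lambda>x. G2 x v w \<bullet> G z x) has_derivative
        (\<lambda>t. G2 y v w \<bullet> G2 y t z + D (\<lambda>x. G2 x v w) y t \<bullet> G z y)) (at y)"
      by (intro has_derivative_inner dG2 has_derivative_G y)
    have "((\<lambda>x. F2 x v w \<bullet> D F x z) has_derivative
        (\<lambda>t. F2 y v w \<bullet> F2 y t z + D (\<lambda>x. F2 x v w) y t \<bullet> D F y z)) (at y)"
      by (intro has_derivative_inner dF2 has_derivative_DF y)
    then have "((\<lambda>x. G2 x v w \<bullet> G z x) has_derivative
        (\<lambda>t. F2 y v w \<bullet> F2 y t z + D (\<lambda>x. F2 x v w) y t \<bullet> D F y z)) (at y)"
      by (rule has_derivative_transform_within_open[OF _ V y]) (simp add: inner_FG)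
    from has_derivative_unique[OF g this] show ?thesis by (rule fun_cong)
  qed
  have sF: "D (\<lambda>x. F2 x v w) y t = D (\<lambda>x. F2 x t w) y v"
    unfolding F2_def by (rule second_derivative_symmetric[OF V y smooth_DF])
  have sG: "D (\<lambda>x. G2 x v w) y t = D (\<lambda>x. G2 x t w) y v"
    unfolding G2_def by (rule second_derivative_symmetric[OF V y smooth_G])
  show ?thesis
    using *[of v t] *[of t v] normal_part_inner[OF y, of v w t z] normal_part_inner[OF y, of t w v z] sF sG
    by simp
qed

end

section \<open>The ambient complex structure in a chart and its constancy\<close>

locale generic_kaehler_chart = kaehler_chart +
  fixes n p :: nat
  assumes pointwise: "y \<in> V \<Longrightarrow> pointwise_real_kaehler (Jc y) (\<alpha> y) (N y) n p"
begin

lemma full_alpha: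
  assumes y: "y \<in> V"
  shows "span (range (D F y) \<union> (\<Union>v. range (\<alpha> y v))) = UNIV"
proof (rule ccontr)
  interpret pointwise_real_kaehler "Jc y" "\<alpha> y" "N y" n p by (rule pointwise[OF y])
  let ?H = "span (range (D F y) \<union> (\<Union>v. range (\<alpha> y v)))"
  assume "?H \<noteq> UNIV"
  then obtain a where a: "a \<noteq> 0" "\<And>x. x \<in> ?H \<Longrightarrow> a \<bullet> x = 0"
    using span_not_UNIV_orthogonal by blast
  have "a \<bullet> D F y z = 0" for z by (rule a(2), rule span_base) blast
  then have "a \<in> N y" by (simp add: in_N_iff)
  then have "a \<in> span (\<Union>v. range (\<alpha> y v))" by (simp add: span_alpha)
  then have "a \<in> ?H" using span_mono[of "\<Union>v. range (\<alpha> y v)" "range (D F y) \<union> (\<Union>v. range (\<alpha> y v))"] by blast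
  then have "a \<bullet> a = 0" by (rule a(2))
  then show False using a(1) by simp
qed

text \<open>\<open>F2\<close> differs from \<alpha> by tangential vectors only and is smooth in
  \<open>y\<close> by construction, so it replaces \<alpha> wherever the structure is
  differentiated.\<close>

lemma full_F2:
  assumes y: "y \<in> V"
  shows "span (range (D F y) \<union> (\<Union>v. range (F2 y v))) = UNIV"
proof -
  let ?H = "span (range (D F y) \<union> (\<Union>v. range (F2 y v)))"
  have DF: "D F y u \<in> ?H" for u by (rule span_base) blast
  have "\<alpha> y v w \<in> ?H" for v w
  proof -
    obtain u where "F2 y v w = D F y u + \<alpha> y v w" by (rule gauss_formula[OF y])
    then have "\<alpha> y v w = F2 y v w - D F y u" by simp
    moreover have "F2 y v w \<in> ?H" by (rule span_base) blast
    ultimately show ?thesis using span_diff DF by metis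
  qed
  then have "range (D F y) \<union> (\<Union>v. range (\<alpha> y v)) \<subseteq> ?H" using DF by blast
  from span_minimal[OF this subspace_span] show ?thesis unfolding full_alpha[OF y] by blast
qed

definition compatible :: "'a \<Rightarrow> ('b \<Rightarrow> 'b) \<Rightarrow> bool" where
  "compatible y T \<longleftrightarrow> orthogonal_transformation T \<and> (\<forall>v. T (D F y v) = G v y) \<and>
     (\<forall>v w. T (F2 y v w) = G2 y v w) \<and> (\<forall>u. T (T u) = - u)"

lemma compatible_exists:
  assumes y: "y \<in> V"
  shows "\<exists>T. compatible y T"
proof -
  interpret P: pointwise_real_kaehler "Jc y" "\<alpha> y" "N y" n p by (rule pointwise[OF y])
  \<comment> \<open>The inner products match by \<open>isom\<close> on tangent vectors and by
    \<open>P.isotropic\<close> on normal ones; the mixed ones are zero.\<close>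
  define R where "R = {(D F y v, D F y (Jc y v)) | v. True} \<union> {(\<alpha> y v w, \<alpha> y v (Jc y w)) | v w. True}"
  have fstR: "fst ` R = range (D F y) \<union> (\<Union>v. range (\<alpha> y v))"
    by (force simp: R_def)
  have full: "span (fst ` R) = UNIV" unfolding fstR by (rule full_alpha[OF y])
  have gram: "b \<bullet> b' = c \<bullet> c'" if "(b, c) \<in> R" "(b', c') \<in> R" for b c b' c'
    using that P.isotropic[symmetric] unfolding R_def
    by (auto simp: isom[OF y] N_perp[OF alpha_N])
  obtain T where T: "orthogonal_transformation T" "\<And>b c. (b, c) \<in> R \<Longrightarrow> T b = c"
    by (rule isometry_of_equal_gram[OF gram full]) (assumption, assumption, rule that)
  interpret T: linear T using T(1) by (rule orthogonal_transformation_linear)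
  have TF: "T (D F y v) = D F y (Jc y v)" for v by (rule T(2)) (auto simp: R_def)
  have Ta: "T (\<alpha> y v w) = \<alpha> y v (Jc y w)" for v w by (rule T(2)) (auto simp: R_def)
  have "T (F2 y v w) = G2 y v w" for v w
  proof -
    obtain u where "F2 y v w = D F y u + \<alpha> y v w" "G2 y v w = D F y (Jc y u) + \<alpha> y v (Jc y w)"
      by (rule gauss_formula[OF y])
    then show ?thesis by (simp add: T.add TF Ta)
  qed
  moreover have "T (T u) = - u" for u
  proof -
    have "u \<in> span (range (D F y) \<union> (\<Union>v. range (\<alpha> y v)))" using full_alpha[OF y] by simp
    then show ?thesis
    proof (induction rule: span_induct_alt)
      case base show ?case by simp
    next
      case (step c x z)
      have "T (T x) = - x"
        using step(1) by (auto simp: TF Ta JJ[OF y] linear_neg[OF DF_lin[OF y]])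
      then show ?case using step(2) by (simp add: T.add T.scaleR)
    qed
  qed
  ultimately have "compatible y T" using T(1) TF by (simp add: compatible_def G_def)
  then show ?thesis by blast
qed

text \<open>By \<open>full_F2\<close> there is only one compatible map at a point of
  \<open>V\<close>, so the choice is no choice; its regularity in \<open>y\<close> is still to be
  derived.\<close>

definition Jh :: "'a \<Rightarrow> 'b \<Rightarrow> 'b" where "Jh y = (SOME T. compatible y T)"

lemma Jh: "y \<in> V \<Longrightarrow> compatible y (Jh y)"
  unfolding Jh_def using compatible_exists by (rule someI_ex)

lemma derivative_Jh:
  assumes y: "y \<in> V"
  shows "((\<lambda>x. Jh x u) has_derivative (\<lambda>h. 0)) (at y)"
proof -
  define R where "R = {(\<lambda>x. D F x v, G v) | v. True} \<union> {(\<lambda>x. F2 x v w, \<lambda>x. G2 x v w) | v w. True}"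
  have RF: "(\<lambda>x. D F x v, G v) \<in> R" and R2: "(\<lambda>x. F2 x v w, \<lambda>x. G2 x v w) \<in> R" for v w
    by (auto simp: R_def)
  have orth: "orthogonal_transformation (Jh x)" and JhF: "Jh x (D F x v) = G v x"
    and JhF2: "Jh x (F2 x v w) = G2 x v w" and JhJh: "Jh x (Jh x u) = - u" if "x \<in> V" for x v w u
    using Jh[OF that] by (auto simp: compatible_def)
  have smF2: "smooth_on V (\<lambda>x. F2 x v w)" and smG2: "smooth_on V (\<lambda>x. G2 x v w)" for v w
    unfolding F2_def G2_def by (rule smooth_on_D, rule smooth_DF, rule smooth_on_D, rule smooth_G)
  have diffR: "b differentiable (at y) \<and> c differentiable (at y)" if "(b, c) \<in> R" for b c
    using that smooth_on_differentiable[OF smooth_DF y] smooth_on_differentiable[OF smooth_G y]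
      smooth_on_differentiable[OF smF2 y] smooth_on_differentiable[OF smG2 y]
    unfolding R_def by blast
  have eqR: "Jh x (b x) = c x" if "(b, c) \<in> R" "x \<in> V" for b c x
    using that JhF JhF2 unfolding R_def by auto
  have "range (D F y) \<union> (\<Union>v. range (F2 y v)) \<subseteq> {b y | b c. (b, c) \<in> R}"
  proof
    fix w assume "w \<in> range (D F y) \<union> (\<Union>v. range (F2 y v))"
    then consider v where "w = D F y v" | v u where "w = F2 y v u" by blast
    then show "w \<in> {b y | b c. (b, c) \<in> R}"
    proof cases
      case (1 v)
      then show ?thesis
        using RF[of v] by (intro CollectI exI[of _ "\<lambda>x. D F x v"] exI[of _ "G v"]) simp
    next
      case (2 v u)
      then show ?thesis
        using R2[of v u] by (intro CollectI exI[of _ "\<lambda>x. F2 x v u"] exI[of _ "\<lambda>x. G2 x v u"]) simp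
    qed
  qed
  from span_mono[OF this] have fullR: "span {b y | b c. (b, c) \<in> R} = UNIV"
    using full_F2[OF y] by (simp add: top.extremum_unique)
  note iso = isometry_field_differentiable[where T = Jh and R = R, OF V y orth diffR]
  have diff: "(\<lambda>x. Jh x u) differentiable (at y)" for u
    by (rule iso(1)) (assumption, assumption, erule (1) eqR, rule fullR)
  have der: "D (\<lambda>x. Jh x (b y)) y h = D c y h - Jh y (D b y h)" if "(b, c) \<in> R" for b c h
    by (rule iso(2)) (assumption, assumption, erule (1) eqR, rule fullR, rule that)
  define K where "K z u = D (\<lambda>x. Jh x u) y z" for z u
  have hK: "((\<lambda>x. Jh x u) has_derivative (\<lambda>z. K z u)) (at y)" for u
    unfolding K_def using has_derivative_D[OF diff] by simp
  have linK: "linear (K z)" for z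
  proof (rule linearI)
    have lin: "linear (Jh x)" if "x \<in> V" for x using orth[OF that] by (rule orthogonal_transformation_linear)
    fix a b :: 'b and c :: real
    have "((\<lambda>x. Jh x a + Jh x b) has_derivative (\<lambda>z. K z a + K z b)) (at y)"
      by (intro has_derivative_add hK)
    then have "((\<lambda>x. Jh x (a + b)) has_derivative (\<lambda>z. K z a + K z b)) (at y)"
      by (rule has_derivative_transform_within_open[OF _ V y]) (simp add: linear_add[OF lin])
    then show "K z (a + b) = K z a + K z b" unfolding K_def[of z "a + b"] by (simp add: D_eqI)
    have "((\<lambda>x. c *\<^sub>R Jh x a) has_derivative (\<lambda>z. c *\<^sub>R K z a)) (at y)"
      by (intro has_derivative_scaleR_right hK)
    then have "((\<lambda>x. Jh x (c *\<^sub>R a)) has_derivative (\<lambda>z. c *\<^sub>R K z a)) (at y)"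
      by (rule has_derivative_transform_within_open[OF _ V y]) (simp add: linear_scale[OF lin])
    then show "K z (c *\<^sub>R a) = c *\<^sub>R K z a" unfolding K_def[of z "c *\<^sub>R a"] by (simp add: D_eqI)
  qed
  \<comment> \<open>An orthogonal map with square -1 is skew, and this linear relation passes to the
    derivative.\<close>
  have skew: "K z a \<bullet> b = - (a \<bullet> K z b)" for z a b
  proof -
    have jj: "Jh x a \<bullet> b = - (a \<bullet> Jh x b)" if "x \<in> V" for x
    proof -
      have "Jh x a \<bullet> Jh x (Jh x b) = a \<bullet> Jh x b"
        using orth[OF that] by (simp add: orthogonal_transformation_def)
      then show ?thesis using JhJh[OF that, of b] by simp
    qed
    have "((\<lambda>x. - (a \<bullet> Jh x b)) has_derivative (\<lambda>z. - (a \<bullet> K z b))) (at y)"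
      by (intro has_derivative_minus has_derivative_inner_right hK)
    then have "((\<lambda>x. Jh x a \<bullet> b) has_derivative (\<lambda>z. - (a \<bullet> K z b))) (at y)"
      by (rule has_derivative_transform_within_open[OF _ V y]) (simp only: jj)
    from has_derivative_unique[OF has_derivative_inner_left[OF hK] this] show ?thesis by (rule fun_cong)
  qed
  have KF: "K z (D F y v) = 0" for z v
    using der[OF RF, of v z] JhF2[OF y, of z v] unfolding K_def by (simp add: F2_def G2_def)
  have KF2: "K z (F2 y v w) = D (\<lambda>x. G2 x v w) y z - Jh y (D (\<lambda>x. F2 x v w) y z)" for z v w
    unfolding K_def by (rule der[OF R2])
  have "D (\<lambda>x. F2 x v w) y z = D (\<lambda>x. F2 x z w) y v" for v w z
    unfolding F2_def by (rule second_derivative_symmetric[OF V y smooth_DF])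
  moreover have "D (\<lambda>x. G2 x v w) y z = D (\<lambda>x. G2 x z w) y v" for v w z
    unfolding G2_def by (rule second_derivative_symmetric[OF V y smooth_G])
  \<comment> \<open>By \<open>KF2\<close> the vector \<open>K z (F2 y v w)\<close> is built from
    derivatives of \<open>F2\<close> and \<open>G2\<close>, i.e. from third derivatives of the
    immersion and second derivatives of \<open>G\<close>, in which \<open>z\<close> and
    \<open>v\<close> may be exchanged.\<close>
  ultimately have s1: "K z (F2 y v w) = K v (F2 y z w)" for z v w
    unfolding KF2 by metis
  have s2: "F2 y v w = F2 y w v" for v w by (rule F2_sym[OF y])
  define A where "A z v w s t = K z (F2 y v w) \<bullet> F2 y s t" for z v w s t
  have A1: "A z v w s t = A v z w s t" for z v w s t by (simp only: A_def s1[of z v w])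
  have A2: "A z v w s t = A z w v s t" for z v w s t by (simp only: A_def s2[of v w])
  have A3: "A z v w s t = A z v w t s" for z v w s t by (simp only: A_def s2[of s t])
  have A4: "A z v w s t = - A z s t v w" for z v w s t
    using skew[of z "F2 y v w" "F2 y s t"] by (simp only: A_def inner_commute)
  \<comment> \<open>The pairs are exchanged twice, so the signs cancel; between the two exchanges
    the derivative direction is swapped with \<open>s\<close>. The result is a transposition across
    the two pairs.\<close>
  have sw: "A z v w s t = A z s w v t" for z v w s t
  proof -
    have "A z v w s t = A v z w s t" by (rule A1)
    also have "\<dots> = - A v s t z w" by (rule A4)
    also have "\<dots> = - A s v t z w" using A1[of v s t z w] by simp
    also have "\<dots> = A s z w v t" using A4[of s z w v t] by simp
    also have "\<dots> = A z s w v t" by (rule A1)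
    finally show ?thesis .
  qed
  \<comment> \<open>Two transpositions across the pairs exchange the pairs without a sign, while
    \<open>A4\<close> exchanges them with one.\<close>
  have A0: "A z v w s t = 0" for z v w s t
  proof -
    have "A z v w s t = A z s w v t" by (rule sw)
    also have "\<dots> = A z w s t v" using A2[of z s w v t] A3[of z w s v t] by simp
    also have "\<dots> = A z t s w v" by (rule sw)
    also have "\<dots> = A z s t v w" using A2[of z t s w v] A3[of z s t w v] by simp
    also have "\<dots> = - A z v w s t" using A4[of z s t v w] .
    finally show ?thesis by simp
  qed
  \<comment> \<open>The vector is orthogonal to all \<open>F2\<close> by \<open>A0\<close>, and to
    tangent vectors by skewness and \<open>KF\<close>.\<close>
  have K20: "K z (F2 y v w) = 0" for z v w
  proof -
    let ?a = "K z (F2 y v w)"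
    have "?a \<bullet> b = 0" if "b \<in> range (D F y) \<union> (\<Union>v. range (F2 y v))" for b
      using that A0[of z v w] skew[of z "F2 y v w"] by (auto simp: A_def KF)
    then have "orthogonal ?a b" if "b \<in> range (D F y) \<union> (\<Union>v. range (F2 y v))" for b
      using that by (simp add: orthogonal_def)
    then have "orthogonal ?a ?a"
      using orthogonal_to_span[of ?a "range (D F y) \<union> (\<Union>v. range (F2 y v))" ?a] full_F2[OF y] by simp
    then show ?thesis by (simp add: orthogonal_def)
  qed
  have "K z u = 0" for z
  proof -
    have "u \<in> span (range (D F y) \<union> (\<Union>v. range (F2 y v)))" using full_F2[OF y] by simp
    moreover have "K z b = 0" if "b \<in> range (D F y) \<union> (\<Union>v. range (F2 y v))" for b
      using that KF K20 by auto
    ultimately show ?thesis using linear_eq_0_on_span[OF linK] by blast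
  qed
  then show ?thesis using hK[of u] by simp
qed

lemma locally_compatible:
  assumes y: "y \<in> V"
  shows "\<exists>T W. open W \<and> y \<in> W \<and> W \<subseteq> V \<and> orthogonal_transformation T \<and> (\<forall>u. T (T u) = - u) \<and>
    (\<forall>x\<in>W. \<forall>v. D F x (Jc x v) = T (D F x v))"
proof -
  obtain e where e: "e > 0" "ball y e \<subseteq> V" using V y openE by blast
  have const: "Jh x u = Jh y u" if "x \<in> ball y e" for x u
  proof -
    have "((\<lambda>x. Jh x u) has_derivative (\<lambda>h. 0)) (at x within ball y e)" if "x \<in> ball y e" for x
      using derivative_Jh that e(2) by (blast intro: has_derivative_at_withinI)
    from has_derivative_zero_constant[OF convex_ball this]
    obtain c where "\<forall>x\<in>ball y e. Jh x u = c" by blast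
    then show ?thesis using that e(1) by simp
  qed
  have "D F x (Jc x v) = Jh y (D F x v)" if "x \<in> ball y e" for x v
    using const[OF that] Jh[of x] that e(2) by (auto simp: compatible_def G_def)
  then show ?thesis using Jh[OF y] e
    by (intro exI[of _ "Jh y"] exI[of _ "ball y e"]) (auto simp: compatible_def)
qed

text \<open>At \<open>y\<close> alone the relation fixes a linear map on the tangent space. Being
  valid on an open set, it may be differentiated, which fixes the map on the values of
  \<open>F2\<close> too and thus everywhere.\<close>

lemma compatible_unique:
  assumes y: "y \<in> V" and W: "open W" "y \<in> W" "W \<subseteq> V" and lin: "linear S" "linear T"
    and S: "\<And>x v. x \<in> W \<Longrightarrow> D F x (Jc x v) = S (D F x v)"
    and T: "\<And>x v. x \<in> W \<Longrightarrow> D F x (Jc x v) = T (D F x v)"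
  shows "S = T"
proof -
  have F2: "L (F2 y v w) = G2 y v w"
    if "linear L" "\<And>x v. x \<in> W \<Longrightarrow> D F x (Jc x v) = L (D F x v)" for L v w
  proof -
    have "((\<lambda>x. L (D F x w)) has_derivative (\<lambda>v. L (F2 y v w))) (at y)"
      by (rule bounded_linear.has_derivative[OF _ has_derivative_DF[OF y]])
        (use that(1) linear_conv_bounded_linear in blast)
    then have "(G w has_derivative (\<lambda>v. L (F2 y v w))) (at y)"
      by (rule has_derivative_transform_within_open[OF _ W(1,2)]) (simp add: G_def that(2))
    from has_derivative_unique[OF this has_derivative_G[OF y]] show ?thesis by (rule fun_cong)
  qed
  have "S b = T b" if "b \<in> range (D F y) \<union> (\<Union>v. range (F2 y v))" for b
    using that F2[OF lin(1) S] F2[OF lin(2) T] S[OF W(2)] T[OF W(2)] by auto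
  from linear_eq_on_span[OF lin this]
  show ?thesis using full_F2[OF y] by blast
qed

end

section \<open>Real Kaehler submanifolds\<close>

locale manifold_chart =
  fixes X :: "'a topology" and A :: "('a, 'e::euclidean_space) chart set" and c :: "('a, 'e) chart"
  assumes atlas: "smooth_atlas X A" and c: "c \<in> A"
begin

lemma chart: "openin X (chart_dom c)" "open (chart_img c)"
  "homeomorphic_map (subtopology X (chart_dom c)) (top_of_set (chart_img c)) (coord c)"
  using atlas c by (auto simp: smooth_atlas_def is_chart_def)

lemma dom_topspace: "topspace (subtopology X (chart_dom c)) = chart_dom c"
  using openin_subset[OF chart(1)] by auto

lemma inj_coord: "inj_on (coord c) (chart_dom c)"
  using homeomorphic_imp_injective_map[OF chart(3)] by (simp only: dom_topspace)

lemma chart_inv_coord [simp]: "x \<in> chart_dom c \<Longrightarrow> chart_inv c (coord c x) = x"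
  unfolding chart_inv_def by (rule inv_into_f_f[OF inj_coord])

lemma coord_chart_inv [simp]: "y \<in> chart_img c \<Longrightarrow> coord c (chart_inv c y) = y"
  unfolding chart_inv_def chart_img_def by (rule f_inv_into_f)

lemma chart_inv_dom [simp]: "y \<in> chart_img c \<Longrightarrow> chart_inv c y \<in> chart_dom c"
  unfolding chart_inv_def chart_img_def by (rule inv_into_into)

lemma coord_img [simp]: "x \<in> chart_dom c \<Longrightarrow> coord c x \<in> chart_img c"
  unfolding chart_img_def by blast

lemma open_coord_image:
  assumes "openin X W" "W \<subseteq> chart_dom c"
  shows "open (coord c ` W)"
proof -
  have "openin (subtopology X (chart_dom c)) W"
    using assms openin_open_subtopology[OF chart(1)] by blast
  then have "openin (top_of_set (chart_img c)) (coord c ` W)"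
    using homeomorphic_imp_open_map[OF chart(3)] by (simp add: open_map_def)
  then show ?thesis using chart(2) openin_open_eq by blast
qed

lemma openin_coord_preimage:
  assumes "open W"
  shows "openin X {x \<in> chart_dom c. coord c x \<in> W}"
proof -
  have "continuous_map (subtopology X (chart_dom c)) (top_of_set (chart_img c)) (coord c)"
    by (rule homeomorphic_imp_continuous_map[OF chart(3)])
  moreover have "openin (top_of_set (chart_img c)) (chart_img c \<inter> W)"
    using assms by (rule openin_open_Int)
  ultimately have "openin (subtopology X (chart_dom c))
      {x \<in> topspace (subtopology X (chart_dom c)). coord c x \<in> chart_img c \<inter> W}"
    by (rule openin_continuous_map_preimage)
  moreover have "{x \<in> topspace (subtopology X (chart_dom c)). coord c x \<in> chart_img c \<inter> W}
      = {x \<in> chart_dom c. coord c x \<in> W}"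
    unfolding dom_topspace by auto
  ultimately show ?thesis using openin_open_subtopology[OF chart(1)] by simp
qed

end

section \<open>The immersion read in a chart\<close>

locale immersion_chart = manifold_chart X A c
  for X :: "'a topology" and A :: "('a, 'e::euclidean_space) chart set" and c +
  fixes g :: "('a, 'e) metric_field" and J :: "('a, 'e) endo_field" and f :: "'a \<Rightarrow> 'v::euclidean_space"
  assumes kaehler: "kaehler_manifold X A g J" and immersion: "isometric_immersion A g f"
begin

abbreviation "V \<equiv> chart_img c"
abbreviation "F \<equiv> f \<circ> chart_inv c"
abbreviation "Jc \<equiv> \<lambda>y. J c (chart_inv c y)"

lemma J_facts: "x \<in> chart_dom c \<Longrightarrow> linear (J c x)" "x \<in> chart_dom c \<Longrightarrow> J c x (J c x v) = - v"
  "smooth_on V (\<lambda>y. Jc y v)" "x \<in> chart_dom c \<Longrightarrow> g c x (J c x v) (J c x w) = g c x v w"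
  using kaehler c by (auto simp: kaehler_manifold_def almost_complex_structure_def)

lemma F_smooth: "smooth_on V F"
  using immersion c by (auto simp: isometric_immersion_def)

lemma differential_D: "y \<in> V \<Longrightarrow> differential f c (chart_inv c y) = D F y"
  by (simp add: differential_def)

lemma g_D: "y \<in> V \<Longrightarrow> g c (chart_inv c y) v w = D F y v \<bullet> D F y w"
  using immersion c by (simp add: isometric_immersion_def differential_D[symmetric])

lemma inj_D: "y \<in> V \<Longrightarrow> inj (D F y)"
  using immersion c by (auto simp: isometric_immersion_def differential_D[symmetric])

sublocale complex_chart V F Jc
  by (rule complex_chart.intro) (use chart(2) F_smooth J_facts in auto)

lemma metric_deriv_eq:
  assumes y: "y \<in> V"
  shows "metric_deriv g c (chart_inv c y) v w z = F2 y v w \<bullet> D F y z + D F y w \<bullet> F2 y v z"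
proof -
  have "((\<lambda>y. D F y w \<bullet> D F y z) has_derivative
      (\<lambda>v. D F y w \<bullet> F2 y v z + F2 y v w \<bullet> D F y z)) (at y)"
    by (intro has_derivative_inner has_derivative_DF y)
  then have "((\<lambda>y. g c (chart_inv c y) w z) has_derivative
      (\<lambda>v. D F y w \<bullet> F2 y v z + F2 y v w \<bullet> D F y z)) (at y)"
    by (rule has_derivative_transform_within_open[OF _ chart(2) y]) (simp only: g_D)
  then show ?thesis using y by (simp add: metric_deriv_def D_eqI)
qed

text \<open>In Koszul's formula for the induced metric four of the six terms cancel by symmetry of
  \<open>F2\<close>. The other two agree, so the Christoffel vector is the tangential part of
  \<open>F2\<close>.\<close>

lemma christoffel_eqI:
  assumes y: "y \<in> V" and u: "\<And>z. F2 y v w \<bullet> D F y z = D F y u \<bullet> D F y z"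
  shows "christoffel g c (chart_inv c y) v w = u"
  unfolding christoffel_def
proof (rule the_equality)
  have m: "metric_deriv g c (chart_inv c y) v w z + metric_deriv g c (chart_inv c y) w v z
      - metric_deriv g c (chart_inv c y) z v w = 2 * (F2 y v w \<bullet> D F y z)" for z
    using F2_sym[OF y, of w v] F2_sym[OF y, of z v] F2_sym[OF y, of z w]
    by (simp add: metric_deriv_eq[OF y] inner_commute)
  show "\<forall>z. 2 * g c (chart_inv c y) u z = metric_deriv g c (chart_inv c y) v w z +
      metric_deriv g c (chart_inv c y) w v z - metric_deriv g c (chart_inv c y) z v w"
    unfolding m by (simp add: g_D[OF y] u)
  fix u' assume "\<forall>z. 2 * g c (chart_inv c y) u' z = metric_deriv g c (chart_inv c y) v w z +
      metric_deriv g c (chart_inv c y) w v z - metric_deriv g c (chart_inv c y) z v w"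
  then have "D F y u' \<bullet> D F y z = D F y u \<bullet> D F y z" for z
    unfolding m by (simp add: g_D[OF y] u)
  then have "D F y (u' - u) \<bullet> D F y (u' - u) = 0"
    by (simp only: linear_diff[OF DF_lin[OF y]] inner_diff_left inner_diff_right diff_self)
  then have "D F y (u' - u) = D F y 0" by (simp add: linear_0[OF DF_lin[OF y]])
  then show "u' = u" using inj_D[OF y] by (auto dest: injD)
qed

sublocale kaehler_chart V F Jc
proof
  show "D F y (Jc y v) \<bullet> D F y (Jc y w) = D F y v \<bullet> D F y w" if "y \<in> V" for y v w
    using J_facts(4)[of "chart_inv c y" v w] that by (simp add: g_D)
  show "\<exists>u. (\<forall>z. D (\<lambda>x. D F x w) y v \<bullet> D F y z = D F y u \<bullet> D F y z) \<and>
      (\<forall>z. D (\<lambda>x. D F x (Jc x w)) y v \<bullet> D F y z = D F y (Jc y u) \<bullet> D F y z)"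
    if y: "y \<in> V" for y v w
  proof -
    have ex: "\<exists>u. \<forall>z. a \<bullet> D F y z = D F y u \<bullet> D F y z" for a
    proof -
      obtain b d where bd: "b \<in> span (range (D F y))" "\<And>w. w \<in> span (range (D F y)) \<Longrightarrow> orthogonal d w" "a = b + d"
        using orthogonal_subspace_decomp_exists by metis
      have "subspace (range (D F y))" using linear_subspace_image[OF DF_lin[OF y] subspace_UNIV] .
      then have "b \<in> range (D F y)" using bd(1) span_eq_iff by blast
      then obtain u where u: "b = D F y u" by blast
      have "d \<bullet> D F y z = 0" for z using bd(2)[OF span_base, of "D F y z"] by (simp add: orthogonal_def)
      then show ?thesis using bd(3) u by (intro exI[of _ u]) (simp add: inner_add_left)
    qed
    obtain u where u: "\<And>z. F2 y v w \<bullet> D F y z = D F y u \<bullet> D F y z" using ex by blast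
    obtain u' where u': "\<And>z. F2 y v (Jc y w) \<bullet> D F y z = D F y u' \<bullet> D F y z" using ex by blast
    \<comment> \<open>Parallelism of \<open>J\<close> is applied to the constant field
      \<open>w\<close>; its covariant derivative is the Christoffel vector \<open>u\<close>, while
      that of \<open>J w\<close> has the derivative of \<open>J\<close> as an additional
      term.\<close>
    have "cov_deriv g c (\<lambda>y. Jc y w) (chart_inv c y) v = J c (chart_inv c y) (cov_deriv g c (\<lambda>_. w) (chart_inv c y) v)"
      using kaehler c y smooth_on_const[of V w] unfolding kaehler_manifold_def parallel_endo_def
      by (meson chart_inv_dom)
    then have "D (\<lambda>x. Jc x w) y v + u' = Jc y u"
      using y by (simp add: cov_deriv_def christoffel_eqI[OF y u] christoffel_eqI[OF y u'] frechet_derivative_const)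
    then have "D F y (Jc y u) = D F y (D (\<lambda>x. Jc x w) y v) + D F y u'"
      using linear_add[OF DF_lin[OF y]] by metis
    then have "G2 y v w \<bullet> D F y z = D F y (Jc y u) \<bullet> D F y z" for z
      by (simp add: G2_eq[OF y] inner_add_left u')
    then show ?thesis using u unfolding F2_def G2_def G_def by blast
  qed
qed

lemma normal_space_eq: "y \<in> V \<Longrightarrow> normal_space f c (chart_inv c y) = N y"
  by (simp add: normal_space_def N_def differential_D)

lemma second_fundamental_form_eq:
  "y \<in> V \<Longrightarrow> second_fundamental_form f c (chart_inv c y) v w = \<alpha> y v w"
  by (simp add: second_fundamental_form_def normal_space_eq \<alpha>_def F2_def)

lemma dim_N:
  assumes y: "y \<in> V" and dims: "DIM('v) = DIM('e) + p"
  shows "dim (N y) = p"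
proof -
  have sub: "subspace (range (D F y))" using linear_subspace_image[OF DF_lin[OF y] subspace_UNIV] .
  have "dim (range (D F y)) = DIM('e)"
    using eucl.dim_image_eq[OF DF_lin[OF y], of UNIV] inj_D[OF y] by simp
  moreover have "N y = {a \<in> UNIV. \<forall>b\<in>range (D F y). orthogonal b a}"
    by (auto simp: N_def orthogonal_comp_def)
  ultimately show ?thesis
    using dim_subspace_orthogonal_to_vectors[OF sub subspace_UNIV] dims by simp
qed

text \<open>The maximum is over a finite set of dimensions, so each \<open>U\<close> bounds it from
  below. A vector \<open>v\<close> is in the \<open>J\<close>-image of the nullity space once
  \<open>J v\<close> is in the nullity space, since \<open>v = J (- J v)\<close>.\<close>

lemma dim_le_complex_nullity:
  assumes y: "y \<in> V" and U: "subspace U" "U \<subseteq> N y"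
  shows "dim {v. \<forall>w. \<forall>u\<in>U. \<alpha> y v w \<bullet> u = 0 \<and> \<alpha> y (Jc y v) w \<bullet> u = 0}
    \<le> complex_nullity J f c (dim U) (chart_inv c y)"
proof -
  let ?x = "chart_inv c y"
  let ?nu = "\<lambda>U. dim (nullity_space f c ?x U \<inter> J c ?x ` nullity_space f c ?x U)"
  let ?D = "{?nu U' | U'. subspace U' \<and> U' \<subseteq> normal_space f c ?x \<and> dim U' = dim U}"
  have "?D \<subseteq> {..DIM('e)}" using dim_subset_UNIV by auto
  then have "finite ?D" using finite_subset by blast
  moreover have "?nu U \<in> ?D" using U normal_space_eq[OF y] by blast
  ultimately have "?nu U \<le> complex_nullity J f c (dim U) ?x"
    unfolding complex_nullity_def by (rule Max_ge)
  moreover have "{v. \<forall>w. \<forall>u\<in>U. \<alpha> y v w \<bullet> u = 0 \<and> \<alpha> y (Jc y v) w \<bullet> u = 0}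
      \<subseteq> nullity_space f c ?x U \<inter> J c ?x ` nullity_space f c ?x U"
  proof
    fix v assume v: "v \<in> {v. \<forall>w. \<forall>u\<in>U. \<alpha> y v w \<bullet> u = 0 \<and> \<alpha> y (Jc y v) w \<bullet> u = 0}"
    have nul: "z \<in> nullity_space f c ?x U \<longleftrightarrow> (\<forall>w. \<forall>u\<in>U. \<alpha> y z w \<bullet> u = 0)" for z
      by (simp add: nullity_space_def second_fundamental_form_eq[OF y] orth_proj_eq_0_iff[OF U(1)])
    have lin: "linear (\<lambda>v. \<alpha> y v w)" for w using alpha_bilinear[OF y] by (simp add: bilinear_def)
    have "\<alpha> y (- Jc y v) w = - \<alpha> y (Jc y v) w" for w by (rule linear_neg[OF lin])
    then have "- Jc y v \<in> nullity_space f c ?x U"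
      unfolding nul using v by simp
    moreover have "v = J c ?x (- Jc y v)" using JJ[OF y] linear_neg[OF Jlin[OF y]] by simp
    moreover have "v \<in> nullity_space f c ?x U" unfolding nul using v by blast
    ultimately show "v \<in> nullity_space f c ?x U \<inter> J c ?x ` nullity_space f c ?x U" by blast
  qed
  then have "dim {v. \<forall>w. \<forall>u\<in>U. \<alpha> y v w \<bullet> u = 0 \<and> \<alpha> y (Jc y v) w \<bullet> u = 0} \<le> ?nu U" by (rule dim_subset)
  ultimately show ?thesis by linarith
qed

lemma generic:
  assumes dims: "DIM('e) = 2 * n" "DIM('v) = 2 * n + p" and p: "p \<le> 11"
    and nullity: "\<And>x s. x \<in> chart_dom c \<Longrightarrow> 1 \<le> s \<Longrightarrow> s \<le> p \<Longrightarrow>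
      int (complex_nullity J f c s x) < 2 * (int n - int s)"
  shows "generic_kaehler_chart V F Jc n p"
proof (rule generic_kaehler_chart.intro[OF kaehler_chart_axioms], rule generic_kaehler_chart_axioms.intro)
  fix y assume y: "y \<in> V"
  show "pointwise_real_kaehler (Jc y) (\<alpha> y) (N y) n p"
  proof (rule pointwise_real_kaehler.intro)
    show "linear (Jc y)" by (rule Jlin[OF y])
    show "Jc y (Jc y x) = - x" for x by (rule JJ[OF y])
    show "bilinear (\<alpha> y)" by (rule alpha_bilinear[OF y])
    show "\<alpha> y v w = \<alpha> y w v" for v w by (rule alpha_sym[OF y])
    show "\<alpha> y v w \<in> N y" for v w by (rule alpha_N)
    show "subspace (N y)" by (rule subspace_N)
    show dN: "dim (N y) = p" using dim_N[OF y] dims by simp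
    show "p \<le> 11" by (rule p)
    show "DIM('e) = 2 * n" by (rule dims)
    show "\<alpha> y v w \<bullet> \<alpha> y t z - \<alpha> y t w \<bullet> \<alpha> y v z
        = \<alpha> y v (Jc y w) \<bullet> \<alpha> y t (Jc y z) - \<alpha> y t (Jc y w) \<bullet> \<alpha> y v (Jc y z)" for v w t z
      by (rule gauss_equation[OF y])
    fix U assume U: "subspace U" "U \<subseteq> N y" "dim U \<ge> 1"
    have "dim U \<le> p" using dim_subset[OF U(2)] dN by simp
    from nullity[OF chart_inv_dom[OF y] U(3) this] dim_le_complex_nullity[OF y U(1,2)]
    show "int (dim {v. \<forall>w. \<forall>u\<in>U. \<alpha> y v w \<bullet> u = 0 \<and> \<alpha> y (Jc y v) w \<bullet> u = 0}) < 2 * (int n - int (dim U))"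
      by linarith
  qed
qed

end

section \<open>Change of charts and the passage from local to global\<close>

lemma differential_transition:
  fixes f :: "'a \<Rightarrow> 'v::euclidean_space" and A :: "('a, 'e::euclidean_space) chart set"
  assumes atlas: "smooth_atlas X A" and f: "isometric_immersion A g f"
    and c: "c \<in> A" and d: "d \<in> A" and x: "x \<in> chart_dom c" "x \<in> chart_dom d"
  shows "differential f c x v = differential f d x (transition_deriv c d x v)"
proof -
  interpret c: manifold_chart X A c by (rule manifold_chart.intro[OF atlas c])
  interpret d: manifold_chart X A d by (rule manifold_chart.intro[OF atlas d])
  let ?W = "coord c ` (chart_dom c \<inter> chart_dom d)" and ?y = "coord c x"
  let ?h = "coord d \<circ> chart_inv c"
  have W: "open ?W" by (rule c.open_coord_image[OF openin_Int[OF c.chart(1) d.chart(1)]]) blast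
  have y: "?y \<in> ?W" using x by blast
  have "smooth_on ?W ?h" using atlas c d by (auto simp: smooth_atlas_def)
  then have h: "(?h has_derivative D ?h ?y) (at ?y)"
    using has_derivative_D smooth_on_differentiable y by blast
  have "smooth_on (chart_img d) (f \<circ> chart_inv d)"
    using f d by (auto simp: isometric_immersion_def)
  then have "(f \<circ> chart_inv d) differentiable (at (?h ?y))"
    using smooth_on_differentiable d.coord_img[OF x(2)] x(1) by (metis c.chart_inv_coord o_apply)
  from has_derivative_compose[OF h has_derivative_D[OF this]]
  have "((\<lambda>y. (f \<circ> chart_inv d) (?h y)) has_derivative (\<lambda>v. D (f \<circ> chart_inv d) (?h ?y) (D ?h ?y v))) (at ?y)" .
  then have "((f \<circ> chart_inv c) has_derivative (\<lambda>v. D (f \<circ> chart_inv d) (?h ?y) (D ?h ?y v))) (at ?y)"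
    by (rule has_derivative_transform_within_open[OF _ W y]) auto
  then show ?thesis using x(1) by (simp add: differential_def transition_deriv_def D_eqI)
qed

definition tangentially_complex ::
  "('a, 'e::euclidean_space) chart set \<Rightarrow> ('a, 'e) endo_field \<Rightarrow> ('a \<Rightarrow> 'v::euclidean_space) \<Rightarrow>
   ('v \<Rightarrow> 'v) \<Rightarrow> 'a \<Rightarrow> bool" where
  "tangentially_complex A J f T x \<longleftrightarrow>
     (\<forall>d\<in>A. x \<in> chart_dom d \<longrightarrow> (\<forall>v. differential f d x (J d x v) = T (differential f d x v)))"

text \<open>One chart around the point suffices, because the transition derivative intertwines the
  differentials as well as the components of \<open>J\<close>.\<close>

lemma tangentially_complexI:
  assumes kaehler: "kaehler_manifold X A g J" and f: "isometric_immersion A g f"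
    and c: "c \<in> A" "x \<in> chart_dom c"
    and T: "\<And>v. differential f c x (J c x v) = T (differential f c x v)"
  shows "tangentially_complex A J f T x"
  unfolding tangentially_complex_def
proof (intro ballI impI allI)
  fix d v assume d: "d \<in> A" "x \<in> chart_dom d"
  have atlas: "smooth_atlas X A" using kaehler by (simp add: kaehler_manifold_def smooth_manifold_def)
  note t = differential_transition[OF atlas f d(1) c(1) d(2) c(2)]
  have "J c x (transition_deriv d c x v) = transition_deriv d c x (J d x v)"
    using kaehler c d by (simp add: kaehler_manifold_def almost_complex_structure_def)
  then show "differential f d x (J d x v) = T (differential f d x v)"
    unfolding t by (simp only: T[symmetric])
qed

text \<open>\<open>J\<close> is carried to an ambient complex structure near every point, and this structure is
  determined by the tangent spaces near the point; connectedness makes it global.\<close>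

theorem theorem2:
  fixes X :: "'a topology"
    and A :: "('a, 'e::euclidean_space) chart set"
    and g :: "('a, 'e) metric_field"
    and J :: "('a, 'e) endo_field"
    and f :: "'a \<Rightarrow> 'v::euclidean_space"
    and n p :: nat
  assumes "n \<ge> 2" and "p \<ge> 1"
    and "DIM('e) = 2 * n" and "DIM('v) = 2 * n + p"
    and "real_kaehler_submanifold X A g J f"
    and "p \<le> 11"
    and "\<And>c x s. \<lbrakk>c \<in> A; x \<in> chart_dom c; 1 \<le> s; s \<le> p\<rbrakk> \<Longrightarrow>
           int (complex_nullity J f c s x) < 2 * (int n - int s)"
  shows "even p \<and> holomorphic_immersion A J f"
proof -
  have kaehler: "kaehler_manifold X A g J" and conn: "connected_space X" and im: "isometric_immersion A g f"
    using assms(5) by (auto simp: real_kaehler_submanifold_def)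
  have atlas: "smooth_atlas X A" and ne: "topspace X \<noteq> {}"
    using kaehler by (auto simp: kaehler_manifold_def smooth_manifold_def)
  have loc: "immersion_chart X A c g J f" if "c \<in> A" for c
    by (intro immersion_chart.intro manifold_chart.intro immersion_chart_axioms.intro atlas that kaehler im)
  \<comment> \<open>Validity on a neighbourhood is part of the condition: it makes the condition
    open in \<open>x\<close>, and it is what determines \<open>T\<close> beyond the tangent
    space.\<close>
  define good where "good T x \<longleftrightarrow> orthogonal_transformation T \<and> (\<forall>u. T (T u) = - u) \<and>
    (\<exists>W. openin X W \<and> x \<in> W \<and> (\<forall>z\<in>W. tangentially_complex A J f T z))" for T x
  have ex: "\<exists>T. good T x" if x: "x \<in> topspace X" for x
  proof -
    obtain c where cx: "c \<in> A" "x \<in> chart_dom c" using atlas x unfolding smooth_atlas_def by blast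
    interpret immersion_chart X A c g J f by (rule loc[OF cx(1)])
    interpret generic_kaehler_chart V F Jc n p
      by (rule generic[OF assms(3,4,6)]) (use assms(7) cx(1) in blast)
    obtain T W where TW: "open W" "coord c x \<in> W" "W \<subseteq> V" "orthogonal_transformation T"
      "\<forall>u. T (T u) = - u" "\<forall>y\<in>W. \<forall>v. D F y (Jc y v) = T (D F y v)"
      using locally_compatible[OF coord_img[OF cx(2)]] by blast
    let ?W = "{z \<in> chart_dom c. coord c z \<in> W}"
    have "openin X ?W" by (rule openin_coord_preimage[OF TW(1)])
    moreover have "x \<in> ?W" using cx(2) TW(2) by simp
    moreover have "tangentially_complex A J f T z" if "z \<in> ?W" for z
    proof (rule tangentially_complexI[OF kaehler im cx(1)])
      show "z \<in> chart_dom c" using that by simp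
      have "D F (coord c z) (Jc (coord c z) v) = T (D F (coord c z) v)" for v
        using TW(6) that by blast
      then show "differential f c z (J c z v) = T (differential f c z v)" for v
        using that by (simp add: differential_def)
    qed
    ultimately have "good T x" using TW(4,5) unfolding good_def by blast
    then show ?thesis by blast
  qed
  have uniq: "S = T" if S: "good S x" and T: "good T x" for S T x
  proof -
    obtain W1 where W1: "openin X W1" "x \<in> W1" "\<And>z. z \<in> W1 \<Longrightarrow> tangentially_complex A J f S z"
      using S unfolding good_def by blast
    obtain W2 where W2: "openin X W2" "x \<in> W2" "\<And>z. z \<in> W2 \<Longrightarrow> tangentially_complex A J f T z"
      using T unfolding good_def by blast
    have "x \<in> topspace X" using W1 openin_subset by blast
    then obtain c where cx: "c \<in> A" "x \<in> chart_dom c" using atlas unfolding smooth_atlas_def by blast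
    interpret immersion_chart X A c g J f by (rule loc[OF cx(1)])
    interpret generic_kaehler_chart V F Jc n p
      by (rule generic[OF assms(3,4,6)]) (use assms(7) cx(1) in blast)
    let ?W = "coord c ` (W1 \<inter> W2 \<inter> chart_dom c)"
    have opn: "open ?W" by (rule open_coord_image) (use W1(1) W2(1) chart(1) in blast)+
    have xW: "coord c x \<in> ?W" using W1(2) W2(2) cx(2) by blast
    have WV: "?W \<subseteq> V" using coord_img by blast
    have *: "D F y (Jc y v) = L (D F y v)"
      if y: "y \<in> ?W" and L: "\<And>z. z \<in> W1 \<inter> W2 \<Longrightarrow> tangentially_complex A J f L z" for L y v
    proof -
      obtain z where z: "z \<in> W1 \<inter> W2" "z \<in> chart_dom c" "y = coord c z" using y by blast
      have "differential f c z (J c z v) = L (differential f c z v)"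
        using L[OF z(1)] cx(1) z(2) unfolding tangentially_complex_def by blast
      then show ?thesis using z(2,3) by (simp add: differential_def)
    qed
    show "S = T"
    proof (rule compatible_unique[OF coord_img[OF cx(2)] opn xW WV])
      show "linear S" "linear T"
        using S T unfolding good_def by (blast intro: orthogonal_transformation_linear)+
      show "D F y (Jc y v) = S (D F y v)" if "y \<in> ?W" for y v by (rule *[OF that]) (simp add: W1(3))
      show "D F y (Jc y v) = T (D F y v)" if "y \<in> ?W" for y v by (rule *[OF that]) (simp add: W2(3))
    qed
  qed
  have near: "\<exists>W. openin X W \<and> x \<in> W \<and> (\<forall>z\<in>W. good T z)" if "good T x" for T x
    using that unfolding good_def by blast
  obtain x0 where x0: "x0 \<in> topspace X" using ne by blast
  obtain T where T: "good T x0" using ex[OF x0] by (rule exE)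
  let ?U = "{x \<in> topspace X. good T x}"
  have "openin X ?U"
  proof (subst openin_subopen, rule ballI)
    fix x assume "x \<in> ?U"
    then have "good T x" by simp
    from near[OF this] obtain W where W: "openin X W" "x \<in> W" "\<forall>z\<in>W. good T z" by (elim exE conjE)
    then have "W \<subseteq> ?U" using openin_subset[OF W(1)] by auto
    then show "\<exists>W. openin X W \<and> x \<in> W \<and> W \<subseteq> ?U" using W by blast
  qed
  \<comment> \<open>A point outside has a structure \<open>S\<close> of its own, valid nearby. A
    nearby point where \<open>T\<close> is good as well would give \<open>S = T\<close> by
    \<open>uniq\<close>.\<close>
  moreover have "openin X (topspace X - ?U)"
  proof (subst openin_subopen, rule ballI)
    fix x assume x: "x \<in> topspace X - ?U"
    then have xX: "x \<in> topspace X" and nT: "\<not> good T x" by simp_all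
    obtain S where S: "good S x" using ex[OF xX] by (rule exE)
    from near[OF S] obtain W where W: "openin X W" "x \<in> W" "\<forall>z\<in>W. good S z" by (elim exE conjE)
    have "\<not> good T z" if z: "z \<in> W" for z
    proof
      assume "good T z"
      with uniq[OF bspec[OF W(3) z]] have "S = T" .
      then show False using S nT by simp
    qed
    then have "W \<subseteq> topspace X - ?U" using openin_subset[OF W(1)] by auto
    then show "\<exists>W. openin X W \<and> x \<in> W \<and> W \<subseteq> topspace X - ?U" using W by blast
  qed
  then have "closedin X ?U" by (simp add: closedin_def)
  ultimately have "?U = topspace X"
    using conn T x0 unfolding connected_space_clopen_in by blast
  then have all: "good T x" if "x \<in> topspace X" for x using that by blast
  have orth: "orthogonal_transformation T" and TT: "T (T u) = - u" for u
    using T by (auto simp: good_def)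
  have "even (DIM('v))"
    by (rule even_DIM_of_complex_structure[OF orthogonal_transformation_linear[OF orth] TT])
  then have "even p" using assms(4) by simp
  moreover have "differential f c x (J c x v) = T (differential f c x v)"
    if c: "c \<in> A" "x \<in> chart_dom c" for c x v
  proof -
    have "x \<in> topspace X" using atlas c unfolding smooth_atlas_def by blast
    then have "tangentially_complex A J f T x" using all unfolding good_def by blast
    then show ?thesis using c unfolding tangentially_complex_def by blast
  qed
  then have "holomorphic_immersion A J f"
    unfolding holomorphic_immersion_def using orth TT by blast
  ultimately show ?thesis by blast
qed

end
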